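(* Assume the $k$-SUM hypothesis. Then for every $\delta,\epsilon\in(0,1)$, for every sufficiently large integer $k$, and for every computable function $f:\mathbb{N}\to\mathbb{N}$, there is no algorithm running in time $f(k)\cdot N^{\lceil k/2\rceil-\epsilon}$ that, given an $N$-vertex set cover instance $I$, distinguishes between (1) $opt(I)\le k$, and (2) $opt(I)>\frac{1}{1+\delta}\left(\frac{\log N}{\log\log N}\right)^{1/k}$.
   Context: A set cover instance is a bipartite graph $I=(S,U,E)$; a subset $C\subseteq S$ covers $U$ if every vertex of $U$ is adjacent to some vertex of $C$, and $opt(I)$ is the minimum size of such a $C$. The number of vertices of $I$ is $|S|+|U|$. Logarithms are base 2. The $k$-SUM hypothesis: for every $k\ge 2$ and $\epsilon>0$, no $O(n^{\lceil k/2\rceil-\epsilon})$-time algorithm can, given $k$ sets $S_1,\ldots,S_k$ each of $n$ integers in $[-n^{2k},n^{2k}]$, decide whether there exist $x_1\in S_1,\ldots,x_k\in S_k$ with $\sum_{i=1}^k x_i=0$. *)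

theory Defs
  imports Complex_Main "HOL-Library.Landau_Symbols" "HOL-Library.Extended_Real"
begin

section \<open>Word RAM\<close>

text \<open>
  A program works on finitely many registers and an array of cells, both holding integers; cells
  are addressed by words. Operations have unit cost. The word size is not part of the operational
  semantics: it is imposed on runs by \<open>fits\<close> below, so there is no overflow behaviour.
\<close>

datatype binop = Add | Sub | Mul | Div | Mod | And | Or | Xor | Shl | Shr

fun apply_op :: "binop \<Rightarrow> int \<Rightarrow> int \<Rightarrow> int" where
  "apply_op Add x y = x + y"
| "apply_op Sub x y = x - y"
| "apply_op Mul x y = x * y"
| "apply_op Div x y = x div y"
| "apply_op Mod x y = x mod y"
| "apply_op And x y = Bit_Operations.and x y"
| "apply_op Or x y = Bit_Operations.or x y"
| "apply_op Xor x y = Bit_Operations.xor x y"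
| "apply_op Shl x y = push_bit (nat y) x"
| "apply_op Shr x y = drop_bit (nat y) x"

datatype instr =
    Const nat int
  | Op binop nat nat nat
  | Load nat nat
  | Store nat nat
  | Jump nat
  | JumpLess nat nat nat

type_synonym program = "instr list"

record config =
  pc :: nat
  reg :: "nat \<Rightarrow> int"
  mem :: "int \<Rightarrow> int"

fun exec :: "instr \<Rightarrow> config \<Rightarrow> config" where
  "exec (Const i c) s = s\<lparr>pc := Suc (pc s), reg := (reg s)(i := c)\<rparr>"
| "exec (Op f i j l) s = s\<lparr>pc := Suc (pc s), reg := (reg s)(i := apply_op f (reg s j) (reg s l))\<rparr>"
| "exec (Load i j) s = s\<lparr>pc := Suc (pc s), reg := (reg s)(i := mem s (reg s j))\<rparr>"
| "exec (Store i j) s = s\<lparr>pc := Suc (pc s), mem := (mem s)(reg s i := reg s j)\<rparr>"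
| "exec (Jump q) s = s\<lparr>pc := q\<rparr>"
| "exec (JumpLess i j q) s = s\<lparr>pc := (if reg s i < reg s j then q else Suc (pc s))\<rparr>"

definition halted :: "program \<Rightarrow> config \<Rightarrow> bool" where
  "halted P s \<longleftrightarrow> length P \<le> pc s"

definition step :: "program \<Rightarrow> config \<Rightarrow> config" where
  "step P s = (if halted P s then s else exec (P ! pc s) s)"

definition init :: "int list \<Rightarrow> config" where
  "init xs = \<lparr>pc = 0, reg = (\<lambda>_. 0),
     mem = (\<lambda>a. if 0 \<le> a \<and> a < int (length xs) then xs ! nat a else 0)\<rparr>"

definition run :: "program \<Rightarrow> int list \<Rightarrow> nat \<Rightarrow> config" where
  "run P xs t = (step P ^^ t) (init xs)"

definition fits :: "nat \<Rightarrow> config \<Rightarrow> bool" where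
  "fits W s \<longleftrightarrow> (\<forall>i. \<bar>reg s i\<bar> \<le> int W) \<and> (\<forall>a. \<bar>mem s a\<bar> \<le> int W)"

text \<open>
  The bound \<open>c * (m + 1) ^ c\<close> on the absolute value of words amounts to words of \<open>O(log m)\<close>
  bits, where \<open>m\<close> is the size parameter of the problem.
\<close>

definition word_bound :: "nat \<Rightarrow> nat \<Rightarrow> nat" where
  "word_bound c m = c * (m + 1) ^ c"

text \<open>
  On input \<open>xs\<close>, the program stops after at most \<open>T\<close> steps with answer \<open>b\<close>, all words
  occurring in the run being bounded by \<open>W\<close>. The answer is yes iff register 0 is nonzero.
\<close>

definition answers :: "program \<Rightarrow> nat \<Rightarrow> real \<Rightarrow> int list \<Rightarrow> bool \<Rightarrow> bool" where
  "answers P W T xs b \<longleftrightarrow>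
     (\<exists>t. real t \<le> T \<and> halted P (run P xs t) \<and> (\<forall>t'\<le>t. fits W (run P xs t')) \<and>
          (reg (run P xs t) 0 \<noteq> 0 \<longleftrightarrow> b))"

text \<open>For computability as such, words are unbounded.\<close>

definition computable :: "(nat \<Rightarrow> nat) \<Rightarrow> bool" where
  "computable f \<longleftrightarrow>
     (\<exists>P. \<forall>n. \<exists>t. halted P (run P [int n] t) \<and> reg (run P [int n] t) 0 = int (f n))"


section \<open>The k-SUM hypothesis\<close>

text \<open>The sets are listed without repetition, in an arbitrary order.\<close>

definition ksum_instance :: "nat \<Rightarrow> nat \<Rightarrow> int list list \<Rightarrow> bool" where
  "ksum_instance k n Ss \<longleftrightarrow> length Ss = k \<and>
     (\<forall>S\<in>set Ss. distinct S \<and> length S = n \<and> set S \<subseteq> {- (int n ^ (2 * k))..int n ^ (2 * k)})"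

definition ksum_solvable :: "int list list \<Rightarrow> bool" where
  "ksum_solvable Ss \<longleftrightarrow>
     (\<exists>x. (\<forall>i<length Ss. x i \<in> set (Ss ! i)) \<and> (\<Sum>i<length Ss. x i) = 0)"

definition ksum_encode :: "nat \<Rightarrow> int list list \<Rightarrow> int list" where
  "ksum_encode n Ss = int n # concat Ss"

definition decides_ksum :: "nat \<Rightarrow> program \<Rightarrow> nat \<Rightarrow> (nat \<Rightarrow> real) \<Rightarrow> bool" where
  "decides_ksum k P c T \<longleftrightarrow>
     (\<forall>n Ss. ksum_instance k n Ss \<longrightarrow>
        answers P (word_bound c n) (T n) (ksum_encode n Ss) (ksum_solvable Ss))"

definition ksum_hypothesis :: bool where
  "ksum_hypothesis \<longleftrightarrow>
     (\<forall>k\<ge>2. \<forall>\<epsilon>>0. \<not> (\<exists>P c T.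
        T \<in> O(\<lambda>n. real n powr (real_of_int \<lceil>real k / 2\<rceil> - \<epsilon>)) \<and> decides_ksum k P c T))"


section \<open>Set cover\<close>

type_synonym ('s, 'u) set_cover = "'s set \<times> 'u set \<times> ('s \<times> 'u) set"

definition set_cover_instance :: "('s, 'u) set_cover \<Rightarrow> bool" where
  "set_cover_instance = (\<lambda>(S, U, E). finite S \<and> finite U \<and> E \<subseteq> S \<times> U)"

definition num_vertices :: "('s, 'u) set_cover \<Rightarrow> nat" where
  "num_vertices = (\<lambda>(S, U, E). card S + card U)"

definition covers :: "('s, 'u) set_cover \<Rightarrow> 's set \<Rightarrow> bool" where
  "covers = (\<lambda>(S, U, E) C. C \<subseteq> S \<and> (\<forall>u\<in>U. \<exists>s\<in>C. (s, u) \<in> E))"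

text \<open>The value is \<open>\<infinity>\<close> if there is no cover at all.\<close>

definition opt :: "('s, 'u) set_cover \<Rightarrow> enat" where
  "opt I = (INF C\<in>{C. covers I C}. enat (card C))"

text \<open>
  As inputs, the vertices on each side are numbered from 0, and the graph is given by the numbers
  of vertices and the adjacency matrix, row by row.
\<close>

definition numbered :: "nat \<Rightarrow> nat \<Rightarrow> (nat, nat) set_cover \<Rightarrow> bool" where
  "numbered s u I \<longleftrightarrow> set_cover_instance I \<and> fst I = {..<s} \<and> fst (snd I) = {..<u}"

definition set_cover_encode :: "nat \<Rightarrow> nat \<Rightarrow> (nat, nat) set_cover \<Rightarrow> int list" where
  "set_cover_encode s u I = int s # int u #
     concat (map (\<lambda>i. map (\<lambda>j. if (i, j) \<in> snd (snd I) then 1 else 0) [0..<u]) [0..<s])"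

text \<open>
  For small numbers of vertices an instance may satisfy both \<open>yes I\<close> and \<open>no I\<close>; any answer is
  allowed then, as it is when neither holds. The graph without vertices is not an input: the
  running time \<open>f k * 0 powr e\<close> would be 0.
\<close>

definition distinguishes ::
  "((nat, nat) set_cover \<Rightarrow> bool) \<Rightarrow> ((nat, nat) set_cover \<Rightarrow> bool) \<Rightarrow>
   program \<Rightarrow> nat \<Rightarrow> (nat \<Rightarrow> real) \<Rightarrow> bool" where
  "distinguishes yes no P c T \<longleftrightarrow>
     (\<forall>s u I. numbered s u I \<and> num_vertices I \<ge> 1 \<longrightarrow>
        (\<exists>b. answers P (word_bound c (num_vertices I)) (T (num_vertices I)) (set_cover_encode s u I) b \<and>
             (yes I \<and> \<not> no I \<longrightarrow> b) \<and> (no I \<and> \<not> yes I \<longrightarrow> \<not> b)))"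

definition gap_threshold :: "real \<Rightarrow> nat \<Rightarrow> nat \<Rightarrow> real" where
  "gap_threshold \<delta> k N =
     1 / (1 + \<delta>) * (log 2 (real N) / log 2 (log 2 (real N))) powr (1 / real k)"

end

theory Submission
  imports Defs "HOL-Real_Asymp.Real_Asymp"
begin

text \<open>
  The reduction combines B. Lin's gap-producing gadget with the residues of the summands modulo
  small numbers. The sets of the cover instance are the pairs \<open>(j, i)\<close>, standing for the \<open>i\<close>-th
  element \<open>x\<close> of the \<open>j\<close>-th input set. If a sum of \<open>k\<close> chosen elements is nonzero, some modulus
  \<open>\<mu> < P\<close> does not divide it, because a common multiple of \<open>1, \<dots>, P - 1\<close> is exponentially large in
  \<open>P\<close>; so non-solutions are exposed by \<open>\<mu>\<close> and the residues \<open>v j = x j mod \<mu>\<close>, where \<open>P\<close> is only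
  polylogarithmic in the number \<open>n\<close> of elements.

  A vertex to be covered prescribes a colouring of the indices \<open>i\<close> by \<open>q\<close> colours, and for every tuple
  of \<open>k\<close> colours such a pair \<open>(\<mu>, v)\<close>; a solution covers it within the block of its own colour tuple.
  Conversely, at most \<open>q\<close> sets are coloured injectively by one of the colourings (again by
  reduction modulo a small number), so that every block sees at most one element of each input
  set, and the residues can be chosen adversarially in all blocks simultaneously.

  With \<open>P = q ^ (2 * k)\<close> and \<open>L = 1 + q + (k + 1) * q ^ k\<close> digits in base \<open>P\<close> there are \<open>P ^ L\<close>
  vertices to cover. The input sets are padded to this size, which costs only a factor
  \<open>n powr o(1)\<close>, for the least \<open>q\<close> with \<open>n \<le> P ^ L\<close>. Then \<open>log N / log (log N) \<le> 2 * (k + 3) * q ^ k\<close>,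
  and the \<open>k\<close>-th root of \<open>2 * (k + 3)\<close> is below \<open>1 + \<delta>\<close> for large \<open>k\<close>.
\<close>

section \<open>Common multiples of initial segments\<close>

text \<open>The parameters look circular: the digits must hold moduli as large as the logarithm of
  \<open>M ^ (q ^ 2)\<close>, while \<open>M = P ^ L\<close> is itself a power of the base
  \<open>P\<close>. The circle closes because \<open>log P\<close> is only
  \<open>2 * k * log q\<close>: the moduli needed are about \<open>q ^ (k + 2)\<close>, up to
  factors polynomial in \<open>k\<close> and \<open>log q\<close>, and
  \<open>P = q ^ (2 * k)\<close> leaves room for them. The exponent \<open>1 / k\<close> of the gap
  originates in the number \<open>q ^ k\<close> of colour tuples. Each tuple needs a block of digits
  of its own, so that a vertex can spoil all tuples independently, and up to factors in
  \<open>k\<close> and \<open>log q\<close> this number of blocks is \<open>log M\<close>. As a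
  program, the reduction simply tabulates the adjacency matrix. A crude bound of order
  \<open>n ^ 16\<close> on its running time is enough, since the exponent in the k-SUM hypothesis is
  at least 20 for \<open>k \<ge> 40\<close>.\<close>

text \<open>The harmonic triangle of Leibniz: \<open>1 / (m C(m + r, m))\<close> is an \<open>r\<close>-fold difference of the
  sequence \<open>1 / m\<close>, so multiplying by a common multiple of \<open>m, \<dots>, m + r\<close> gives an integer.\<close>

lemma leibniz_triangle_int:
  fixes m r :: nat and D :: int
  assumes "m \<ge> 1" "\<And>i. i \<in> {m..m + r} \<Longrightarrow> int i dvd D"
  shows "real_of_int D / (real m * real ((m + r) choose m)) \<in> \<int>"
  using assms
proof (induction r arbitrary: m)
  case 0
  then have "int m dvd D" by auto
  then show ?case using 0 by (auto elim!: dvdE)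
next
  case (Suc r)
  have 1: "real_of_int D / (real m * real ((m + r) choose m)) \<in> \<int>"
    by (rule Suc.IH) (use Suc.prems in auto)
  have 2: "real_of_int D / (real (Suc m) * real ((Suc m + r) choose Suc m)) \<in> \<int>"
    by (rule Suc.IH) (use Suc.prems in auto)
  have a: "real ((m + r) choose m) = fact (m + r) / (fact m * fact r)"
    and b: "real ((Suc m + r) choose Suc m) = fact (Suc (m + r)) / (fact (Suc m) * fact r)"
    and c: "real ((m + Suc r) choose m) = fact (Suc (m + r)) / (fact m * fact (Suc r))"
    using binomial_fact[of m "m + r", where ?'a = real] binomial_fact[of "Suc m" "Suc m + r", where ?'a = real]
      binomial_fact[of m "m + Suc r", where ?'a = real] by auto
  have "real_of_int D / (real m * real ((m + Suc r) choose m)) =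
      real_of_int D / (real m * real ((m + r) choose m)) - real_of_int D / (real (Suc m) * real ((Suc m + r) choose Suc m))"
    unfolding a b c using Suc.prems(1)
    by (simp add: divide_simps) (simp add: algebra_simps)
  then show ?case using 1 2 by (metis Ints_diff)
qed

text \<open>Nair's argument: for \<open>r = m\<close> the triangle makes \<open>D\<close> divided by
  \<open>m\<close> times the central binomial coefficient an integer. Being positive it is at least
  1, and the coefficient is at least \<open>(2 * m / m) ^ m\<close>.\<close>

lemma common_multiple_ge:
  fixes D :: nat
  assumes "D > 0" "\<And>i. 1 \<le> i \<Longrightarrow> i \<le> 2 * m \<Longrightarrow> i dvd D"
  shows "2 ^ m \<le> D"
proof (cases "m = 0")
  case False
  have "real_of_int (int D) / (real m * real ((m + m) choose m)) \<in> \<int>"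
    by (rule leibniz_triangle_int) (use assms False in auto)
  then obtain z where z: "real D / (real m * real ((m + m) choose m)) = real_of_int z"
    by (auto elim: Ints_cases)
  have "real D / (real m * real ((m + m) choose m)) > 0" using assms(1) False by simp
  then have "real D / (real m * real ((m + m) choose m)) \<ge> 1" unfolding z by simp
  then have "real m * real ((m + m) choose m) \<le> real D" using False by (simp add: field_simps)
  then have "m * ((m + m) choose m) \<le> D" by (metis of_nat_le_iff of_nat_mult)
  moreover have "2 ^ m \<le> (m + m) choose m"
  proof -
    have "(real (m + m) / real m) ^ m \<le> real ((m + m) choose m)"
      by (rule binomial_ge_n_over_k_pow_k) simp
    moreover have "real (m + m) / real m = 2" using False by simp
    ultimately have "real (2 ^ m) \<le> real ((m + m) choose m)" by simp
    then show ?thesis unfolding of_nat_le_iff .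
  qed
  moreover have "(m + m) choose m \<le> m * ((m + m) choose m)" using False by simp
  ultimately show ?thesis by linarith
qed (use assms in auto)

text \<open>A nonzero number is thus detected by a modulus that is only logarithmic in it. This
  serves both for separating indices and for exposing nonzero sums.\<close>

lemma exists_non_divisor:
  fixes D :: nat
  assumes "D > 0" "D < 2 ^ m"
  shows "\<exists>i. 1 \<le> i \<and> i \<le> 2 * m \<and> \<not> i dvd D"
  using common_multiple_ge[of D m] assms by (metis not_le)

text \<open>A modulus that does not divide the product of all differences divides none of them.
  There are at most \<open>q ^ 2\<close> differences, each at most \<open>M\<close>, whence the
  hypothesis on \<open>M ^ (q ^ 2)\<close>.\<close>

lemma exists_separating_modulus:
  fixes Y :: "nat set"
  assumes "finite Y" "card Y \<le> q" "Y \<subseteq> {..<M}" "M ^ (q ^ 2) < 2 ^ m" "1 \<le> M"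
  shows "\<exists>i. 1 \<le> i \<and> i \<le> 2 * m \<and> inj_on (\<lambda>y. y mod i) Y"
proof -
  define Z where "Z = {(a, b). a \<in> Y \<and> b \<in> Y \<and> a < b}"
  define D where "D = (\<Prod>(a, b)\<in>Z. b - a)"
  have sub: "Z \<subseteq> Y \<times> Y" by (auto simp: Z_def)
  then have fin: "finite Z" using assms(1) finite_subset by blast
  have "card Z \<le> card (Y \<times> Y)" using sub assms(1) by (intro card_mono) auto
  also have "\<dots> \<le> q ^ 2" using assms(2) by (simp add: card_cartesian_product power2_eq_square mult_mono)
  finally have card: "card Z \<le> q ^ 2" .
  have "D \<le> (\<Prod>z\<in>Z. M)" unfolding D_def
    using assms(3) by (intro prod_mono) (auto simp: Z_def)
  also have "\<dots> = M ^ card Z" by simp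
  also have "\<dots> \<le> M ^ (q ^ 2)" using card assms(5) by (intro power_increasing) auto
  finally have "D < 2 ^ m" using assms(4) by simp
  moreover have "D > 0" unfolding D_def using fin by (intro prod_pos) (auto simp: Z_def)
  ultimately obtain i where i: "1 \<le> i" "i \<le> 2 * m" "\<not> i dvd D" using exists_non_divisor by blast
  have "\<not> i dvd b - a" if "a \<in> Y" "b \<in> Y" "a < b" for a b
  proof
    assume "i dvd b - a"
    moreover have "b - a dvd D" unfolding D_def
      using dvd_prodI[OF fin, of "(a, b)" "\<lambda>(a, b). b - a"] that by (auto simp: Z_def)
    ultimately show False using i(3) dvd_trans by blast
  qed
  then have "inj_on (\<lambda>y. y mod i) Y"
    by (intro linorder_inj_onI') (metis less_imp_le_nat mod_eq_dvd_iff_nat)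
  with i show ?thesis by blast
qed

section \<open>The gap gadget\<close>

definition digit :: "nat \<Rightarrow> nat \<Rightarrow> nat \<Rightarrow> nat" where
  "digit P e p = e div P ^ p mod P"

lemma digit_less: "0 < P \<Longrightarrow> digit P e p < P"
  by (simp add: digit_def)

text \<open>Free choice of digits is the whole power of the adversary. In base \<open>q\<close> the
  lemma also turns a tuple of \<open>k\<close> colour indices into its number
  \<open>a < q ^ k\<close>.\<close>

lemma number_with_digits:
  assumes "\<And>p. p < L \<Longrightarrow> d p < P"
  shows "\<exists>e<P ^ L. \<forall>p<L. digit P e p = d p"
  using assms
proof (induction L arbitrary: d)
  case (Suc L)
  obtain e where e: "e < P ^ L" "\<forall>p<L. digit P e p = d (Suc p)"
    using Suc.IH[of "\<lambda>p. d (Suc p)"] Suc.prems by auto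
  have d0: "d 0 < P" using Suc.prems by auto
  have "e * P + d 0 < (e + 1) * P" using d0 by simp
  also have "\<dots> \<le> P ^ L * P" using e(1) by (intro mult_right_mono) auto
  finally have "e * P + d 0 < P ^ Suc L" by (simp add: mult.commute)
  moreover have "digit P (e * P + d 0) p = d p" if "p < Suc L" for p
  proof (cases p)
    case 0 then show ?thesis using d0 by (simp add: digit_def)
  next
    case (Suc p')
    have "(e * P + d 0) div P ^ p = (e * P + d 0) div P div P ^ p'"
      unfolding Suc by (simp add: div_mult2_eq)
    also have "(e * P + d 0) div P = e" using d0 by simp
    finally show ?thesis using e(2) that Suc by (simp add: digit_def)
  qed
  ultimately show ?case by blast
qed auto

locale gadget =
  fixes q P k :: nat and x :: "nat \<Rightarrow> nat \<Rightarrow> int"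
begin

text \<open>A vertex \<open>e\<close> to be covered is read as the sequence of its digits: a modulus, then \<open>q\<close> residues
  (the colours), then for each of the \<open>q ^ k\<close> colour tuples \<open>a\<close> a modulus and \<open>k\<close> residues.\<close>

definition ndigits :: nat where
  "ndigits = 1 + q + (k + 1) * q ^ k"

definition block :: "nat \<Rightarrow> nat" where
  "block a = 1 + q + a * (k + 1)"

text \<open>The second disjunct disarms blocks whose residues are consistent with a zero sum;
  without it a solution would miss the vertices that guess all its residues correctly. The modulus
  may be 0, and then \<open>x mod 0 = x\<close>.\<close>

definition separated :: "nat \<Rightarrow> nat \<Rightarrow> nat \<Rightarrow> nat \<Rightarrow> bool" where
  "separated j i e a \<longleftrightarrow>
     x j i mod int (digit P e (block a)) \<noteq> int (digit P e (block a + 1 + j)) \<or>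
     (\<Sum>r<k. digit P e (block a + 1 + r)) mod digit P e (block a) = 0"

text \<open>Here \<open>digit q a j\<close> is the position in the colour list that tuple
  \<open>a\<close> assigns to group \<open>j\<close>. By the first disjunct, a vertex missed by some
  elements must list the colours of all of them.\<close>

definition adj :: "nat \<Rightarrow> nat \<Rightarrow> nat \<Rightarrow> bool" where
  "adj j i e \<longleftrightarrow> (\<forall>c<q. digit P e (1 + c) \<noteq> i mod digit P e 0) \<or>
     (\<exists>a<q ^ k. digit P e (1 + digit q a j) = i mod digit P e 0 \<and> separated j i e a)"

text \<open>If no chosen element covered \<open>e\<close>, all their colours would be listed, and in
  the block of the resulting tuple all residues would be guessed correctly. But then the guesses sum
  to 0 modulo the modulus of the block, so that everybody is \<open>separated\<close> there.\<close>

lemma solution_adj: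
  assumes "(\<Sum>j<k. x j (i j)) = 0" "0 < k"
  shows "\<exists>j<k. adj j (i j) e"
proof (rule ccontr)
  assume none: "\<not> ?thesis"
  have "\<exists>c<q. digit P e (1 + c) = i j mod digit P e 0" if "j < k" for j
    using none that unfolding adj_def by blast
  then obtain c where c: "\<And>j. j < k \<Longrightarrow> c j < q \<and> digit P e (1 + c j) = i j mod digit P e 0" by metis
  then obtain a where a: "a < q ^ k" "\<forall>j<k. digit q a j = c j"
    using number_with_digits[of k c q] by auto
  let ?\<mu> = "digit P e (block a)" let ?v = "\<lambda>r. digit P e (block a + 1 + r)"
  have sep: "\<not> separated j (i j) e a" if "j < k" for j
    using none a c that unfolding adj_def by auto
  then have v: "x j (i j) mod int ?\<mu> = int (?v j)" if "j < k" for j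
    using that unfolding separated_def by blast
  have "int ((\<Sum>r<k. ?v r) mod ?\<mu>) = (\<Sum>r<k. x r (i r) mod int ?\<mu>) mod int ?\<mu>"
    using v by (simp add: zmod_int)
  also have "\<dots> = (\<Sum>r<k. x r (i r)) mod int ?\<mu>" by (rule mod_sum_eq)
  finally have "(\<Sum>r<k. ?v r) mod ?\<mu> = 0" using assms(1) by simp
  then show False using sep[of 0] assms(2) unfolding separated_def by simp
qed

text \<open>If the selection misses some group \<open>j0\<close>, then the residue of \<open>j0\<close> is free and the parity of the
  sum can be spoilt.\<close>

lemma exists_bad_block:
  assumes bound: "\<And>y. (\<forall>j<k. y j < M) \<Longrightarrow> (\<Sum>j<k. x j (y j)) \<noteq> 0 \<and> \<bar>\<Sum>j<k. x j (y j)\<bar> < 2 ^ h"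
    and P: "2 * h < P" "1 \<le> h"
    and sel: "\<And>j i. Sel j i \<Longrightarrow> i < M" "\<And>j i i'. j < k \<Longrightarrow> Sel j i \<Longrightarrow> Sel j i' \<Longrightarrow> i = i'"
  shows "\<exists>\<mu> v. \<mu> < P \<and> (\<forall>r. v r < P) \<and> (\<Sum>r<k. v r) mod \<mu> \<noteq> 0 \<and>
    (\<forall>j<k. \<forall>i. Sel j i \<longrightarrow> x j i mod int \<mu> = int (v j))"
proof (cases "\<forall>j<k. \<exists>i. Sel j i")
  case True
  \<comment> \<open>Every group is represented, so all residues are forced; a modulus that does not
    divide the sum makes them inconsistent with zero.\<close>
  then obtain y where y: "\<And>j. j < k \<Longrightarrow> Sel j (y j)" by metis
  let ?s = "\<Sum>j<k. x j (y j)"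
  have s: "?s \<noteq> 0" "\<bar>?s\<bar> < 2 ^ h" using bound[of y] y sel(1) by blast+
  then have "nat \<bar>?s\<bar> > 0" "nat \<bar>?s\<bar> < 2 ^ h" by (auto simp: nat_less_iff)
  then obtain \<mu> where \<mu>: "1 \<le> \<mu>" "\<mu> \<le> 2 * h" "\<not> \<mu> dvd nat \<bar>?s\<bar>" using exists_non_divisor by blast
  define v where "v r = nat (x r (y r) mod int \<mu>)" for r
  have v: "int (v r) = x r (y r) mod int \<mu>" for r using \<mu>(1) by (simp add: v_def)
  have "int ((\<Sum>r<k. v r) mod \<mu>) = ?s mod int \<mu>"
    by (simp add: zmod_int v mod_sum_eq)
  moreover have "\<not> int \<mu> dvd ?s" using \<mu>(3) by (simp add: nat_dvd_iff dvd_nat_abs_iff)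
  ultimately have "(\<Sum>r<k. v r) mod \<mu> \<noteq> 0" by (metis dvd_eq_mod_eq_0 of_nat_0)
  moreover have "v r < P" for r
  proof -
    have "int (v r) < int \<mu>" using v \<mu>(1) by simp
    then show ?thesis using \<mu> P by simp
  qed
  moreover have "x j i mod int \<mu> = int (v j)" if "j < k" "Sel j i" for j i
    using sel(2)[OF that(1) that(2) y[OF that(1)]] v by simp
  ultimately show ?thesis using \<mu> P by (intro exI[of _ \<mu>] exI[of _ v]) auto
next
  case False
  then obtain j0 where j0: "j0 < k" "\<And>i. \<not> Sel j0 i" by auto
  \<comment> \<open>These are the parities of the selected elements; a group without selection gets
    0, which is overwritten for \<open>j0\<close>.\<close>
  define w where "w j = (if \<exists>i. Sel j i then nat (x j (SOME i. Sel j i) mod 2) else 0)" for j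
  define v where "v = w(j0 := (1 + (\<Sum>r\<in>{..<k} - {j0}. w r)) mod 2)"
  have w2: "w j < 2" for j unfolding w_def by (auto simp: nat_less_iff)
  then have v2: "v j < 2" for j unfolding v_def by auto
  have "(\<Sum>r<k. v r) = v j0 + (\<Sum>r\<in>{..<k} - {j0}. v r)"
    using j0(1) by (subst sum.remove[of _ j0]) auto
  also have "(\<Sum>r\<in>{..<k} - {j0}. v r) = (\<Sum>r\<in>{..<k} - {j0}. w r)"
    by (intro sum.cong) (auto simp: v_def)
  finally have "(\<Sum>r<k. v r) mod 2 = 1" unfolding v_def by simp presburger
  moreover have "x j i mod int 2 = int (v j)" if "j < k" "Sel j i" for j i
  proof -
    have "j \<noteq> j0" using j0 that by auto
    moreover have "(SOME i. Sel j i) = i" using sel(2)[OF that(1)] that by (metis someI_ex)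
    ultimately show ?thesis using that(2) unfolding v_def w_def by auto
  qed
  moreover have "v r < P" for r using v2[of r] P by simp
  ultimately show ?thesis using P by (intro exI[of _ 2] exI[of _ v]) auto
qed

text \<open>Distinct indices in \<open>X\<close> get distinct colours, so each block sees at most
  one element of each group and \<open>exists_bad_block\<close> applies to it. Blocks occupy
  disjoint digit positions, hence all the bad choices fit into one vertex.\<close>

lemma small_set_misses:
  assumes bound: "\<And>y. (\<forall>j<k. y j < M) \<Longrightarrow> (\<Sum>j<k. x j (y j)) \<noteq> 0 \<and> \<bar>\<Sum>j<k. x j (y j)\<bar> < 2 ^ h"
    and P: "2 * h < P" "1 \<le> h" and M: "1 \<le> M" "M ^ (q ^ 2) < 2 ^ h"
    and X: "X \<subseteq> {..<k} \<times> {..<M}" "card X \<le> q"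
  shows "\<exists>e<P ^ ndigits. \<forall>(j, i)\<in>X. \<not> adj j i e"
proof -
  have fin: "finite X" using X(1) finite_subset by blast
  \<comment> \<open>Groups are forgotten here: one colouring of at most \<open>q\<close> indices
    serves all \<open>k\<close> groups.\<close>
  define Y where "Y = snd ` X"
  have Y: "finite Y" "card Y \<le> q" "Y \<subseteq> {..<M}"
    unfolding Y_def using fin X card_image_le[OF fin, of snd] by auto
  obtain \<mu>0 where \<mu>0: "1 \<le> \<mu>0" "\<mu>0 \<le> 2 * h" "inj_on (\<lambda>y. y mod \<mu>0) Y"
    using exists_separating_modulus[OF Y M(2,1)] by blast
  obtain f where f: "bij_betw f {0..<card Y} Y" using Y(1) ex_bij_betw_nat_finite by blast
  \<comment> \<open>If \<open>Y\<close> has fewer than \<open>q\<close> elements, the remaining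
    colours are residues of unspecified numbers. They do no harm: they are below \<open>P\<close>,
    and a selection is unique for every colour.\<close>
  define col where "col c = f c mod \<mu>0" for c
  define Sel where "Sel a j i \<longleftrightarrow> (j, i) \<in> X \<and> i mod \<mu>0 = col (digit q a j)" for a j i
  have "\<exists>\<mu> v. \<mu> < P \<and> (\<forall>r. v r < P) \<and> (\<Sum>r<k. v r) mod \<mu> \<noteq> 0 \<and>
    (\<forall>j<k. \<forall>i. Sel a j i \<longrightarrow> x j i mod int \<mu> = int (v j))" for a
  proof (rule exists_bad_block[OF bound P])
    show "i < M" if "Sel a j i" for j i using that X(1) by (auto simp: Sel_def)
    show "i = i'" if "j < k" "Sel a j i" "Sel a j i'" for j i i'
    proof (rule inj_onD[OF \<mu>0(3)])
      show "i \<in> Y" "i' \<in> Y" using that unfolding Sel_def Y_def by force+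
    qed (use that in \<open>simp add: Sel_def\<close>)
  qed
  then obtain \<mu> v where bad: "\<And>a. \<mu> a < P" "\<And>a r. v a r < P" "\<And>a. (\<Sum>r<k. v a r) mod \<mu> a \<noteq> 0"
      "\<And>a j i. j < k \<Longrightarrow> Sel a j i \<Longrightarrow> x j i mod int (\<mu> a) = int (v a j)"
    by metis
  \<comment> \<open>This inverts the digit layout: from position \<open>1 + q\<close> on, the
    quotient by \<open>k + 1\<close> is the block, remainder 0 is its modulus and remainder
    \<open>s > 0\<close> the residue of group \<open>s - 1\<close>.\<close>
  define d where "d p = (if p = 0 then \<mu>0 else if p < 1 + q then col (p - 1)
    else let t = p - (1 + q); a = t div (k + 1); s = t mod (k + 1) in if s = 0 then \<mu> a else v a (s - 1))" for p
  have "col c < P" for c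
  proof -
    have "col c < \<mu>0" unfolding col_def using \<mu>0(1) by simp
    then show ?thesis using \<mu>0(2) P by simp
  qed
  then have "d p < P" for p unfolding d_def using \<mu>0 P bad by (auto simp: Let_def)
  then obtain e where e: "e < P ^ ndigits" "\<And>p. p < ndigits \<Longrightarrow> digit P e p = d p"
    using number_with_digits[of ndigits d P] by blast
  have d0: "digit P e 0 = \<mu>0" using e(2)[of 0] by (simp add: ndigits_def d_def)
  have d1: "digit P e (1 + c) = col c" if "c < q" for c
    using e(2)[of "1 + c"] that by (simp add: ndigits_def d_def)
  have d2: "digit P e (block a) = \<mu> a" "\<And>r. r < k \<Longrightarrow> digit P e (block a + 1 + r) = v a r" if "a < q ^ k" for a
  proof -
    have "(a + 1) * (k + 1) \<le> q ^ k * (k + 1)" using that by (intro mult_right_mono) auto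
    then have w: "block a + 1 + r < ndigits" if "r < k" for r
      using that by (simp add: block_def ndigits_def algebra_simps)
    have w0: "block a < ndigits" using \<open>(a + 1) * (k + 1) \<le> q ^ k * (k + 1)\<close>
      by (simp add: block_def ndigits_def algebra_simps)
    have "(a * c + t) div c = a" "(a * c + t) mod c = t" if "t < c" for c t :: nat
      using that by auto
    then have d: "d (1 + q + (a * (k + 1) + t)) = (if t = 0 then \<mu> a else v a (t - 1))" if "t < k + 1" for t
      using that by (simp only: d_def Let_def diff_add_inverse) simp
    show "digit P e (block a) = \<mu> a" unfolding e(2)[OF w0] using d[of 0] by (simp add: block_def)
    show "digit P e (block a + 1 + r) = v a r" if "r < k" for r
      unfolding e(2)[OF w[OF that]] using d[of "1 + r"] that by (simp add: block_def add.assoc)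
  qed
  have "\<not> adj j i e" if "(j, i) \<in> X" for j i
  proof
    assume "adj j i e"
    \<comment> \<open>The colour of \<open>i\<close> is listed, so only the second disjunct of
      \<open>adj\<close> is left.\<close>
    moreover have "\<exists>c<q. digit P e (1 + c) = i mod digit P e 0"
    proof -
      have "i \<in> Y" using that unfolding Y_def by force
      then have "i \<in> f ` {0..<card Y}" using f by (simp add: bij_betw_def)
      then obtain c where c: "c < card Y" "f c = i" by auto
      then show ?thesis using Y(2) d1[of c] d0 by (intro exI[of _ c]) (auto simp: col_def)
    qed
    ultimately obtain a where a: "a < q ^ k" "digit P e (1 + digit q a j) = i mod \<mu>0" "separated j i e a"
      unfolding adj_def d0 by blast
    have q: "0 < q" using a(1) X that by (cases q) (auto simp: card_eq_0_iff fin)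
    have j: "j < k" using that X(1) by auto
    have "Sel a j i" unfolding Sel_def using that a(2) d1[OF digit_less[OF q]] by simp
    then have "x j i mod int (\<mu> a) = int (v a j)" using bad(4) j by blast
    then show False using a(3) bad(3)[of a] d2[OF a(1)] j unfolding separated_def by simp
  qed
  with e(1) show ?thesis by blast
qed


section \<open>The set cover instance and its optimum\<close>

definition M :: nat where
  "M = P ^ ndigits"

text \<open>The pair \<open>(j, i)\<close> has number \<open>j * M + i\<close>. With
  \<open>M\<close> indices per group as well as \<open>M\<close> vertices to cover, a position in
  the matrix is decoded by divisions by \<open>M\<close> only.\<close>

definition cover :: "(nat, nat) set_cover" where
  "cover = ({..<k * M}, {..<M}, {(s, e). s < k * M \<and> e < M \<and> adj (s div M) (s mod M) e})"

lemma cover_simps: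
  "numbered (k * M) M cover" "num_vertices cover = (k + 1) * M"
  "covers cover C \<longleftrightarrow> C \<subseteq> {..<k * M} \<and> (\<forall>e<M. \<exists>s\<in>C. adj (s div M) (s mod M) e)"
  unfolding cover_def numbered_def set_cover_instance_def num_vertices_def covers_def
  by (auto, blast)

lemma opt_cover_le:
  assumes "(\<Sum>j<k. x j (i j)) = 0" "0 < k" "\<And>j. j < k \<Longrightarrow> i j < M"
  shows "opt cover \<le> enat k"
proof -
  let ?C = "(\<lambda>j. j * M + i j) ` {..<k}"
  have dm: "(j * M + i j) div M = j" "(j * M + i j) mod M = i j" if "j < k" for j
    using assms(3)[OF that] by auto
  have "covers cover ?C"
    unfolding cover_simps
  proof (intro conjI subsetI allI impI)
    fix s assume "s \<in> ?C"
    then obtain j where j: "j < k" "s = j * M + i j" by auto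
    have "s < (j + 1) * M" using assms(3)[OF j(1)] j(2) by simp
    also have "\<dots> \<le> k * M" using j(1) by (intro mult_right_mono) auto
    finally show "s \<in> {..<k * M}" by simp
  next
    fix e
    obtain j where "j < k" "adj j (i j) e" using solution_adj[OF assms(1,2)] by blast
    then show "\<exists>s\<in>?C. adj (s div M) (s mod M) e" using dm by force
  qed
  then have "opt cover \<le> enat (card ?C)" unfolding opt_def by (intro INF_lower) auto
  also have "\<dots> \<le> enat k" using card_image_le[of "{..<k}" "\<lambda>j. j * M + i j"] by simp
  finally show ?thesis .
qed

lemma opt_cover_gt:
  assumes bound: "\<And>y. (\<forall>j<k. y j < M) \<Longrightarrow> (\<Sum>j<k. x j (y j)) \<noteq> 0 \<and> \<bar>\<Sum>j<k. x j (y j)\<bar> < 2 ^ h"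
    and P: "2 * h < P" "1 \<le> h" and M: "M ^ (q ^ 2) < 2 ^ h"
  shows "opt cover > enat q"
proof -
  have M1: "1 \<le> M" unfolding M_def using P by simp
  have "Suc q \<le> card C" if C: "covers cover C" for C
  proof (rule ccontr)
    assume "\<not> Suc q \<le> card C"
    then have le: "card C \<le> q" by simp
    have sub: "C \<subseteq> {..<k * M}" and cov: "\<forall>e<M. \<exists>s\<in>C. adj (s div M) (s mod M) e"
      using C unfolding cover_simps by auto
    have fin: "finite C" using sub finite_subset by blast
    let ?X = "(\<lambda>s. (s div M, s mod M)) ` C"
    have "?X \<subseteq> {..<k} \<times> {..<M}" using sub M1 by (auto simp: less_mult_imp_div_less)
    moreover have "card ?X \<le> q" using card_image_le[OF fin, of "\<lambda>s. (s div M, s mod M)"] le by simp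
    ultimately obtain e where "e < P ^ ndigits" "\<forall>(j, i)\<in>?X. \<not> adj j i e"
      using small_set_misses[OF bound P M1 M] by blast
    then show False using cov unfolding M_def[symmetric] by auto
  qed
  then have "enat (Suc q) \<le> opt cover" unfolding opt_def by (intro INF_greatest) auto
  then show ?thesis by (metis Suc_ile_eq)
qed

end

section \<open>Choice of parameters\<close>

text \<open>This is \<open>M\<close> for \<open>P = q ^ (2 * k)\<close>, as a function of
  \<open>k\<close> and \<open>q\<close> alone, because \<open>q\<close> is chosen from the input
  size before the gadget is built.\<close>

definition gadget_size :: "nat \<Rightarrow> nat \<Rightarrow> nat" where
  "gadget_size k q = (q ^ (2 * k)) ^ (1 + q + (k + 1) * q ^ k)"

lemma gadget_size_powr: "0 < q \<Longrightarrow> real (gadget_size k q) = real q powr (2 * real k * real (1 + q + (k + 1) * q ^ k))"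
proof -
  assume q: "0 < q"
  have "real ((q ^ (2 * k)) ^ L) = real q powr (2 * real k * real L)" for L
  proof -
    have "real ((q ^ (2 * k)) ^ L) = real q ^ (2 * k * L)" by (simp add: power_mult)
    also have "\<dots> = real q powr real (2 * k * L)" using q by (simp only: powr_realpow of_nat_0_less_iff)
    finally show ?thesis by simp
  qed
  then show ?thesis unfolding gadget_size_def .
qed

lemma gadget_size_eq: "gadget_size k q = q ^ (2 * k * (1 + q + (k + 1) * q ^ k))"
  unfolding gadget_size_def by (simp only: power_mult)

lemma gadget_size_mono: "1 \<le> q \<Longrightarrow> q \<le> q' \<Longrightarrow> gadget_size k q \<le> gadget_size k q'"
proof -
  assume q: "1 \<le> q" "q \<le> q'"
  have "q ^ (2 * k * (1 + q + (k + 1) * q ^ k)) \<le> q' ^ (2 * k * (1 + q + (k + 1) * q ^ k))"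
    using q by (intro power_mono) auto
  also have "\<dots> \<le> q' ^ (2 * k * (1 + q' + (k + 1) * q' ^ k))"
    using q by (intro power_increasing mult_left_mono add_mono power_mono) auto
  finally show ?thesis unfolding gadget_size_eq .
qed

text \<open>Even the exponent of \<open>q\<close> in \<open>gadget_size_eq\<close> is smaller than
  the power, so whatever arises in computing the size fits into words that hold the size.\<close>

lemma gadget_size_gt:
  assumes "2 \<le> q"
  shows "2 * k * (1 + q + (k + 1) * q ^ k) < gadget_size k q"
proof -
  have "2 * k * (1 + q + (k + 1) * q ^ k) < 2 ^ (2 * k * (1 + q + (k + 1) * q ^ k))" by (rule less_exp)
  also have "\<dots> \<le> gadget_size k q" unfolding gadget_size_eq using assms by (intro power_mono) auto
  finally show ?thesis .
qed

lemma ndigits_le: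
  assumes "2 \<le> q" "2 \<le> k"
  shows "1 + q + (k + 1) * q ^ k \<le> (k + 2) * q ^ k"
proof -
  have "q ^ 2 \<le> q ^ k" using assms by (intro power_increasing) auto
  moreover have "2 * q \<le> q ^ 2" using assms by (simp add: power2_eq_square)
  ultimately have "1 + q \<le> q ^ k" using assms(1) by linarith
  then show ?thesis by (simp add: algebra_simps)
qed

text \<open>The choice of \<open>h\<close> comes from \<open>M = q ^ (2 * k * L)\<close> and
  \<open>q < 2 ^ q\<close>. Then \<open>2 * h\<close> is below a constant times
  \<open>q ^ (k + 3)\<close>; the lower bound on \<open>q\<close> absorbs that constant, and
  \<open>k \<ge> 4\<close> gives \<open>k + 4 \<le> 2 * k\<close>. The last conjunct will bound a
  sum of \<open>k\<close> integers of absolute value at most \<open>n ^ (2 * k)\<close> with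
  \<open>n \<le> M\<close>.\<close>

lemma modulus_range:
  assumes k: "4 \<le> k" and q: "4 * k * (k + 2) + 2 \<le> q"
  shows "\<exists>h\<ge>1. 2 * h < q ^ (2 * k) \<and> gadget_size k q ^ (q ^ 2) < 2 ^ h \<and> k * gadget_size k q ^ (2 * k) < 2 ^ h"
proof -
  define L where "L = 1 + q + (k + 1) * q ^ k"
  define h where "h = 2 * k * L * q ^ 3"
  have kq: "2 * k + 1 \<le> q" using q by simp
  have q2: "2 \<le> q" using q by simp
  have L: "1 \<le> L" "L \<le> (k + 2) * q ^ k" using ndigits_le[of q k] q2 k by (auto simp: L_def)
  have "2 * h + 1 \<le> 2 * (2 * k * ((k + 2) * q ^ k) * q ^ 3) + 2 * q ^ (k + 3)"
    unfolding h_def using L(2) q2 by (intro add_mono mult_mono) auto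
  also have "\<dots> = (4 * k * (k + 2) + 2) * q ^ (k + 3)" by (simp add: power_add algebra_simps)
  also have "\<dots> \<le> q * q ^ (k + 3)" using q by (intro mult_right_mono) auto
  also have "\<dots> = q ^ (k + 4)" by (simp add: power_add numeral_eq_Suc)
  also have "\<dots> \<le> q ^ (2 * k)" using k q2 by (intro power_increasing) auto
  finally have 1: "2 * h < q ^ (2 * k)" by simp
  have M: "gadget_size k q = q ^ (2 * k * L)" unfolding gadget_size_def L_def[symmetric] by (simp add: power_mult)
  have "gadget_size k q ^ (q ^ 2) = q ^ (2 * k * L * q ^ 2)" unfolding M by (simp add: power_mult)
  also have "\<dots> < (2 ^ q) ^ (2 * k * L * q ^ 2)"
    using k L q2 by (intro power_strict_mono) auto
  also have "\<dots> = 2 ^ h" unfolding h_def by (simp add: power_mult[symmetric] numeral_eq_Suc algebra_simps)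
  finally have 2: "gadget_size k q ^ (q ^ 2) < 2 ^ h" .
  have "q ^ 1 \<le> gadget_size k q" unfolding M using k L q2 by (intro power_increasing) auto
  then have kM: "k \<le> gadget_size k q" using kq by simp
  have "k * gadget_size k q ^ (2 * k) \<le> gadget_size k q * gadget_size k q ^ (2 * k)" using kM by (intro mult_right_mono) auto
  also have "\<dots> = gadget_size k q ^ (2 * k + 1)" by simp
  also have "\<dots> \<le> gadget_size k q ^ (q ^ 2)"
  proof (rule power_increasing)
    have "q * 1 \<le> q * q" using q2 by (intro mult_left_mono) auto
    then have "2 * k + 1 \<le> q * q" using kq(1) by linarith
    then show "2 * k + 1 \<le> q ^ 2" by (simp add: power2_eq_square)
    show "1 \<le> gadget_size k q" using kM k by simp
  qed
  finally have "k * gadget_size k q ^ (2 * k) < 2 ^ h" using 2 by simp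
  moreover have "1 \<le> h" unfolding h_def using k L q2 by simp
  ultimately show ?thesis using 1 2 by blast
qed

text \<open>With \<open>A = log N\<close> and \<open>l = log q\<close>, \<open>A\<close> lies
  between \<open>2 * k * (k + 1) * q ^ k * l\<close> and \<open>2 * k * (k + 3) * q ^ k * l\<close>,
  and \<open>log A\<close> between \<open>k * l\<close> and \<open>2 * k * l\<close>. So
  \<open>A / log A\<close> is between \<open>q ^ k\<close> and \<open>2 * (k + 3) * q ^ k\<close>.
  In the upper bound, \<open>k + 2\<close> comes from the number of digits and one more from the
  factor \<open>k + 1\<close> of \<open>N\<close>.\<close>

lemma gap_threshold_bounds:
  assumes d: "0 < \<delta>" "\<delta> < 1" and k: "4 \<le> k" "2 * (real k + 3) \<le> (1 + \<delta>) ^ k"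
    and q: "4 * k * (k + 2) + 2 \<le> q"
  shows "real k \<le> gap_threshold \<delta> k ((k + 1) * gadget_size k q)"
    and "gap_threshold \<delta> k ((k + 1) * gadget_size k q) \<le> real q"
proof -
  define L where "L = 1 + q + (k + 1) * q ^ k"
  define l where "l = log 2 (real q)"
  define A where "A = log 2 (real ((k + 1) * gadget_size k q))"
  have kq: "2 * k + 1 \<le> q" "2 \<le> q" "k + 1 \<le> q" using q by auto
  have l: "1 \<le> l" "l \<le> real q"
  proof -
    show "1 \<le> l" using kq unfolding l_def by (simp add: le_log_iff)
    have "real q \<le> 2 powr real q" using less_exp[of q] by (simp add: powr_realpow less_imp_le)
    then show "l \<le> real q" using kq unfolding l_def by (simp add: log_le_iff)
  qed
  have L: "(real k + 1) * real q ^ k \<le> real L" "real L \<le> (real k + 2) * real q ^ k"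
  proof -
    have "real L \<le> real ((k + 2) * q ^ k)" unfolding L_def using ndigits_le[of q k] kq k by (intro of_nat_mono) auto
    then show "real L \<le> (real k + 2) * real q ^ k" by (simp add: algebra_simps)
    have "real ((k + 1) * q ^ k) \<le> real L" unfolding L_def by (intro of_nat_mono) auto
    then show "(real k + 1) * real q ^ k \<le> real L" by (simp add: algebra_simps)
  qed
  have logM: "log 2 (real (gadget_size k q)) = 2 * real k * real L * l"
    using gadget_size_powr[of q k] kq unfolding L_def l_def by (simp add: log_powr)
  have Mpos: "0 < real (gadget_size k q)" using kq by (simp add: gadget_size_def)
  have A: "A = log 2 (real k + 1) + 2 * real k * real L * l"
  proof -
    have "real ((k + 1) * gadget_size k q) = (real k + 1) * real (gadget_size k q)" by (simp add: algebra_simps)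
    then show ?thesis unfolding A_def logM[symmetric] using Mpos by (simp add: log_mult_pos)
  qed
  have lk: "0 \<le> log 2 (real k + 1)" "log 2 (real k + 1) \<le> l"
    unfolding l_def using kq by auto
  have qk1: "1 \<le> real q ^ k" using kq by simp
  have low: "2 * real k * ((real k + 1) * real q ^ k) * l \<le> A"
  proof -
    have "2 * real k * ((real k + 1) * real q ^ k) * l \<le> 2 * real k * real L * l"
      using L l by (intro mult_right_mono mult_left_mono) auto
    then show ?thesis using A lk(1) by linarith
  qed
  have up: "A \<le> 2 * real k * (real k + 3) * real q ^ k * l"
  proof -
    have "2 * real k * real L * l \<le> 2 * real k * ((real k + 2) * real q ^ k) * l"
      using L l by (intro mult_right_mono mult_left_mono) auto
    moreover have "l * 1 \<le> l * (2 * real k * real q ^ k)"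
    proof (rule mult_left_mono)
      have "1 * 1 \<le> (2 * real k) * real q ^ k" using k qk1 by (intro mult_mono) auto
      then show "1 \<le> 2 * real k * real q ^ k" by simp
    qed (use l in simp)
    ultimately show ?thesis using A lk by (simp add: algebra_simps)
  qed
  have qA: "real q ^ k \<le> A"
  proof -
    have "1 * 1 \<le> (2 * real k) * (real k + 1)" using k by (intro mult_mono) auto
    then have "1 * real q ^ k * 1 \<le> (2 * real k * (real k + 1)) * real q ^ k * l"
      using l qk1 by (intro mult_mono) auto
    then show ?thesis using low by (simp add: algebra_simps)
  qed
  have Apos: "0 < A" using qA qk1 by linarith
  \<comment> \<open>A rough bound suffices, as \<open>A\<close> enters here only through its
    logarithm.\<close>
  have Aq: "A \<le> real q ^ (2 * k)"
  proof -
    have "A \<le> 2 * real k * (real k + 3) * real q ^ k * real q"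
      using up mult_left_mono[OF l(2), of "2 * real k * (real k + 3) * real q ^ k"] by simp
    also have "\<dots> = real (2 * k * (k + 3)) * real q ^ (k + 1)" by simp
    also have "\<dots> \<le> real q * real q ^ (k + 1)"
      using q k by (intro mult_right_mono of_nat_mono) (auto simp: algebra_simps)
    also have "\<dots> = real q ^ (k + 2)" by simp
    also have "\<dots> \<le> real q ^ (2 * k)" using k kq by (intro power_increasing) auto
    finally show ?thesis .
  qed
  have ll: "real k * l \<le> log 2 A" "log 2 A \<le> 2 * real k * l"
  proof -
    have "log 2 (real q ^ k) \<le> log 2 A" using qA qk1 Apos kq by (subst log_le_cancel_iff) auto
    then show "real k * l \<le> log 2 A" using kq unfolding l_def by (simp add: log_nat_power)
    have "log 2 A \<le> log 2 (real q ^ (2 * k))" using Aq Apos kq by (subst log_le_cancel_iff) auto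
    then show "log 2 A \<le> 2 * real k * l" using kq unfolding l_def by (simp add: log_nat_power)
  qed
  have kl: "0 < real k * l" using k l by simp
  have r1: "real q ^ k \<le> A / log 2 A"
  proof -
    have "real q ^ k * log 2 A \<le> real q ^ k * (2 * real k * l)" using ll qk1 by (intro mult_left_mono) auto
    also have "\<dots> \<le> 2 * real k * ((real k + 1) * real q ^ k) * l"
      using k l qk1 by (simp add: algebra_simps)
    finally show ?thesis using low ll(1) kl by (simp add: le_divide_eq)
  qed
  have r2: "A / log 2 A \<le> 2 * (real k + 3) * real q ^ k"
  proof -
    have "A \<le> 2 * (real k + 3) * real q ^ k * (real k * l)" using up by (simp add: algebra_simps)
    also have "\<dots> \<le> 2 * (real k + 3) * real q ^ k * log 2 A" using ll(1) by (intro mult_left_mono) auto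
    finally show ?thesis using ll(1) kl by (simp add: divide_le_eq)
  qed
  have root: "(y ^ k) powr (1 / real k) = y" if "0 < y" for y :: real
    using that k by (simp add: powr_realpow[symmetric] powr_powr)
  have gap: "gap_threshold \<delta> k ((k + 1) * gadget_size k q) = 1 / (1 + \<delta>) * (A / log 2 A) powr (1 / real k)"
    unfolding gap_threshold_def A_def ..
  have "real q \<le> (A / log 2 A) powr (1 / real k)"
    using powr_mono2[of "1 / real k" "real q ^ k", OF _ _ r1] root[of "real q"] kq by simp
  \<comment> \<open>\<open>\<delta> < 1\<close> makes the factor at least 1/2, and \<open>q\<close>
    is at least \<open>2 * k\<close>.\<close>
  then have "1 / 2 * (2 * real k) \<le> 1 / (1 + \<delta>) * (A / log 2 A) powr (1 / real k)"
    using d kq by (intro mult_mono) (auto simp: field_simps)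
  then show "real k \<le> gap_threshold \<delta> k ((k + 1) * gadget_size k q)" unfolding gap by simp
  have "0 \<le> A / log 2 A" using r1 qk1 by linarith
  moreover have "A / log 2 A \<le> (1 + \<delta>) ^ k * real q ^ k"
    using r2 k(2) qk1 mult_right_mono[OF k(2), of "real q ^ k"] by simp
  ultimately have "(A / log 2 A) powr (1 / real k) \<le> (((1 + \<delta>) * real q) ^ k) powr (1 / real k)"
    by (intro powr_mono2) (auto simp: power_mult_distrib)
  also have "\<dots> = (1 + \<delta>) * real q" using d kq by (intro root) auto
  finally show "gap_threshold \<delta> k ((k + 1) * gadget_size k q) \<le> real q" unfolding gap using d by (simp add: field_simps)
qed

section \<open>The cost of padding to a gadget size\<close>

text \<open>The logarithm of the size is \<open>2 * k * L * ln q\<close>. When \<open>q\<close>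
  grows by one, \<open>L\<close> grows at most by the factor \<open>(1 + 1 / q) ^ k\<close> and
  \<open>ln q\<close> at most by \<open>1 + 1 / q\<close>, and the product of both factors tends to
  1.\<close>

lemma gadget_size_growth:
  assumes "0 < \<eta>"
  shows "\<exists>q0. \<forall>q\<ge>q0. real (gadget_size k (Suc q)) \<le> real (gadget_size k q) powr (1 + \<eta>)"
proof -
  have "(\<lambda>q. (1 + 1 / real q) ^ (k + 1)) \<longlonglongrightarrow> (1 + 0) ^ (k + 1)"
    by (intro tendsto_intros lim_1_over_n)
  then have "\<forall>\<^sub>F q in sequentially. (1 + 1 / real q) ^ (k + 1) < 1 + \<eta>"
    using assms by (intro order_tendstoD(2)) auto
  then obtain q1 where q1: "\<And>q. q \<ge> q1 \<Longrightarrow> (1 + 1 / real q) ^ (k + 1) < 1 + \<eta>"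
    unfolding eventually_sequentially by blast
  show ?thesis
  \<comment> \<open>From 3 on \<open>ln q \<ge> 1\<close>, so the increment \<open>1 / q\<close> of
    the logarithm is at most \<open>ln q / q\<close>.\<close>
  proof (intro exI[of _ "max q1 3"] allI impI)
    fix q assume "max q1 3 \<le> q"
    then have q: "q1 \<le> q" "3 \<le> q" by auto
    let ?t = "1 + 1 / real q"
    have t: "1 \<le> ?t" by simp
    have S: "real (Suc q) = real q * ?t" using q by (simp add: field_simps)
    have tk: "1 \<le> ?t ^ k" "?t \<le> ?t ^ k \<or> k = 0" by (auto simp: self_le_power)
    have L: "real (1 + Suc q + (k + 1) * Suc q ^ k) \<le> ?t ^ k * real (1 + q + (k + 1) * q ^ k)" if "k > 0"
    proof -
      have "?t \<le> ?t ^ k" using tk that by auto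
      have a: "real (Suc q ^ k) = ?t ^ k * real (q ^ k)" by (simp only: of_nat_power S power_mult_distrib mult.commute)
      have b: "real (Suc q) \<le> ?t ^ k * real q" unfolding S using \<open>?t \<le> ?t ^ k\<close> by (simp add: mult.commute mult_left_mono)
      have "real (1 + Suc q + (k + 1) * Suc q ^ k) = 1 + real (Suc q) + (real k + 1) * real (Suc q ^ k)"
        by (simp add: algebra_simps)
      also have "\<dots> \<le> ?t ^ k * 1 + ?t ^ k * real q + (real k + 1) * (?t ^ k * real (q ^ k))"
        unfolding a using b tk(1) by (intro add_mono) auto
      also have "\<dots> = ?t ^ k * real (1 + q + (k + 1) * q ^ k)" by (simp add: algebra_simps)
      finally show ?thesis .
    qed
    have lnq: "1 \<le> ln (real q)"
    proof -
      have "exp 1 \<le> real q" using exp_le q by linarith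
      then show ?thesis using q by (simp add: ln_ge_iff)
    qed
    have "ln (real (Suc q)) = ln (real q) + ln ?t" unfolding S by (intro ln_mult_pos) (use q t in linarith)+
    also have "ln ?t \<le> 1 / real q" using ln_add_one_self_le_self[of "1 / real q"] by simp
    also have "1 / real q \<le> ln (real q) / real q" using lnq q by (simp add: divide_right_mono)
    finally have lnS: "ln (real (Suc q)) \<le> ?t * ln (real q)" by (simp add: algebra_simps)
    show "real (gadget_size k (Suc q)) \<le> real (gadget_size k q) powr (1 + \<eta>)"
    proof (cases "k = 0")
      case True then show ?thesis by (simp add: gadget_size_def)
    next
      case False
      have "ln (real (gadget_size k (Suc q))) = 2 * real k * real (1 + Suc q + (k + 1) * Suc q ^ k) * ln (real (Suc q))"
        unfolding gadget_size_powr[of "Suc q" k, simplified of_nat_Suc] gadget_size_powr[OF zero_less_Suc] by (simp add: ln_powr del: of_nat_add of_nat_Suc)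
      also have "\<dots> \<le> 2 * real k * (?t ^ k * real (1 + q + (k + 1) * q ^ k)) * (?t * ln (real q))"
        using L lnS False t by (intro mult_mono mult_left_mono) auto
      also have "\<dots> = ?t ^ (k + 1) * (2 * real k * real (1 + q + (k + 1) * q ^ k) * ln (real q))" by simp
      also have "\<dots> \<le> (1 + \<eta>) * (2 * real k * real (1 + q + (k + 1) * q ^ k) * ln (real q))"
        using q1[OF q(1)] lnq by (intro mult_right_mono) auto
      also have "\<dots> = (1 + \<eta>) * ln (real (gadget_size k q))"
        using gadget_size_powr[of q k] q by (simp add: ln_powr del: of_nat_add of_nat_Suc)
      also have "\<dots> = ln (real (gadget_size k q) powr (1 + \<eta>))" using q by (simp add: gadget_size_def ln_powr)
      finally show ?thesis
        by (subst (asm) ln_le_cancel_iff) (use q in \<open>auto simp: gadget_size_def\<close>)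
    qed
  qed
qed

text \<open>The threshold \<open>q0\<close> from which all estimates hold is a constant of the
  reduction program; only small inputs are padded because of it.\<close>

definition least_param :: "nat \<Rightarrow> nat \<Rightarrow> nat \<Rightarrow> nat" where
  "least_param k q0 n = (LEAST q. q0 \<le> q \<and> n \<le> gadget_size k q)"

lemma least_param:
  assumes "1 \<le> k" "2 \<le> q0"
  shows "q0 \<le> least_param k q0 n" "n \<le> gadget_size k (least_param k q0 n)" "\<And>q. q0 \<le> q \<Longrightarrow> q < least_param k q0 n \<Longrightarrow> gadget_size k q < n"
proof -
  have "n \<le> gadget_size k (q0 + n)"
  proof -
    have "(q0 + n) ^ 1 \<le> (q0 + n) ^ (2 * k * (1 + (q0 + n) + (k + 1) * (q0 + n) ^ k))"
      using assms by (intro power_increasing) auto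
    then have "q0 + n \<le> gadget_size k (q0 + n)" unfolding gadget_size_eq by (simp only: power_one_right)
    then show ?thesis by linarith
  qed
  then have ex: "q0 \<le> q0 + n \<and> n \<le> gadget_size k (q0 + n)" by simp
  show "q0 \<le> least_param k q0 n" "n \<le> gadget_size k (least_param k q0 n)"
    unfolding least_param_def using LeastI[of "\<lambda>q. q0 \<le> q \<and> n \<le> gadget_size k q", OF ex] by auto
  show "\<And>q. q0 \<le> q \<Longrightarrow> q < least_param k q0 n \<Longrightarrow> gadget_size k q < n"
    unfolding least_param_def using not_less_Least by (metis (mono_tags, lifting) not_le)
qed

text \<open>By minimality the size for the preceding parameter is below \<open>n\<close>, and one
  step of growth costs the exponent \<open>1 + \<eta>\<close>. If the parameter is \<open>q0\<close>
  itself, the size is constant; the product covers both cases.\<close>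

lemma gadget_size_least_param_le:
  assumes "1 \<le> k" "2 \<le> q0" "0 < \<eta>" and n: "1 \<le> n"
    and growth: "\<And>q. q0 \<le> q \<Longrightarrow> real (gadget_size k (Suc q)) \<le> real (gadget_size k q) powr (1 + \<eta>)"
  shows "real (gadget_size k (least_param k q0 n)) \<le> real (gadget_size k q0) * real n powr (1 + \<eta>)"
proof -
  let ?q = "least_param k q0 n"
  note g = least_param(1)[OF assms(1,2), of n]
  have "1 \<le> gadget_size k q0" using assms(2) unfolding gadget_size_eq by (intro one_le_power) simp
  then have G: "1 \<le> real (gadget_size k q0)" by simp
  have N: "1 \<le> real n powr (1 + \<eta>)" using n assms(3) by (simp add: ge_one_powr_ge_zero)
  show ?thesis
  proof (cases "?q = q0")
    case True
    then show ?thesis using mult_left_mono[OF N, of "real (gadget_size k q0)"] by simp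
  next
    case False
    then have q: "q0 \<le> ?q - 1" "Suc (?q - 1) = ?q" using g by auto
    have "real (gadget_size k ?q) \<le> real (gadget_size k (?q - 1)) powr (1 + \<eta>)" using growth[OF q(1)] unfolding q(2) .
    also have "\<dots> \<le> real n powr (1 + \<eta>)"
      using least_param(3)[OF assms(1,2) q(1), of n] q assms(3) by (intro powr_mono2) auto
    also have "\<dots> \<le> real (gadget_size k q0) * real n powr (1 + \<eta>)"
      using mult_right_mono[OF G, of "real n powr (1 + \<eta>)"] by simp
    finally show ?thesis .
  qed
qed

lemma exists_large_k:
  assumes "0 < (\<delta>::real)"
  shows "\<exists>k0. \<forall>k\<ge>k0. 2 * (real k + 3) \<le> (1 + \<delta>) ^ k"
proof -
  have "\<forall>\<^sub>F k in sequentially. 2 * (real k + 3) \<le> (1 + \<delta>) ^ k"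
    using assms by real_asymp
  then show ?thesis unfolding eventually_sequentially .
qed

text \<open>The reduction contributes the fourth power of a loop bound quadratic in
  \<open>S n\<close>, hence order \<open>n powr (8 * (1 + \<eta>))\<close>, at most order
  \<open>n ^ 16\<close>; this is where \<open>20 \<le> K\<close> enters. In the other term padding
  raises the exponent to \<open>(1 + \<eta>) * (K - \<epsilon>)\<close>, and the bound on
  \<open>\<eta>\<close> keeps half of the saving \<open>\<epsilon>\<close>.\<close>

lemma time_bound:
  fixes K \<epsilon> \<eta> F w G :: real and C k :: nat and S cst :: "nat \<Rightarrow> nat"
  assumes K: "20 \<le> K" and eps: "0 < \<epsilon>" "\<epsilon> < 1" and eta: "0 < \<eta>" "\<eta> \<le> 1" "\<eta> \<le> \<epsilon> / (2 * K)"
    and F: "0 \<le> F" "0 \<le> w" and G: "1 \<le> G"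
    and S: "\<And>n. 1 \<le> n \<Longrightarrow> 2 \<le> S n" "\<And>n. 1 \<le> n \<Longrightarrow> real (S n) \<le> G * real n powr (1 + \<eta>)"
    and cst: "\<And>B. cst B \<le> C * (B + 1) ^ 4"
  shows "(\<lambda>n. real (cst ((k + 4) * (S n + 2) ^ 2)) + w + F * real ((k + 1) * S n) powr (K - \<epsilon>))
    \<in> O(\<lambda>n. real n powr (K - \<epsilon> / 2))"
proof (rule bigoI[where c = "real C * (real (k + 5) * 4) ^ 4 * G ^ 8 + w + F * (real (k + 1) * G) powr (K - \<epsilon>)"])
  show "\<forall>\<^sub>F n in at_top. norm (real (cst ((k + 4) * (S n + 2) ^ 2)) + w + F * real ((k + 1) * S n) powr (K - \<epsilon>))
      \<le> (real C * (real (k + 5) * 4) ^ 4 * G ^ 8 + w + F * (real (k + 1) * G) powr (K - \<epsilon>)) * norm (real n powr (K - \<epsilon> / 2))"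
    using eventually_ge_at_top[of 1]
  proof eventually_elim
    case (elim n)
    let ?E = "real n powr (K - \<epsilon> / 2)"
    have n1: "1 \<le> real n" using elim by simp
    have mono: "real n powr a \<le> ?E" if "a \<le> K - \<epsilon> / 2" for a
      using powr_mono[OF that n1] .
    have E1: "1 \<le> ?E" using mono[of 0] K eps elim by simp
    note S1 = S(1)[OF elim] and S2 = S(2)[OF elim]
    have "S n + 2 \<le> 2 * S n" using S1 by simp
    then have "(S n + 2) ^ 2 \<le> (2 * S n) ^ 2" by (intro power_mono) auto
    then have "(S n + 2) ^ 2 \<le> 4 * S n ^ 2" by (simp add: power_mult_distrib)
    then have "(k + 4) * (S n + 2) ^ 2 \<le> (k + 4) * (4 * S n ^ 2)" by (rule mult_left_mono) simp
    moreover have "1 \<le> 4 * S n ^ 2" using S1 by simp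
    ultimately have "(k + 4) * (S n + 2) ^ 2 + 1 \<le> (k + 5) * 4 * S n ^ 2" by (simp add: algebra_simps)
    then have "C * ((k + 4) * (S n + 2) ^ 2 + 1) ^ 4 \<le> C * ((k + 5) * 4 * S n ^ 2) ^ 4"
      by (intro mult_left_mono power_mono) auto
    with cst have "cst ((k + 4) * (S n + 2) ^ 2) \<le> C * ((k + 5) * 4 * S n ^ 2) ^ 4" by (rule le_trans)
    also have "\<dots> = C * ((k + 5) * 4) ^ 4 * S n ^ 8" by (simp add: power_mult_distrib flip: power_mult)
    finally have "cst ((k + 4) * (S n + 2) ^ 2) \<le> C * ((k + 5) * 4) ^ 4 * S n ^ 8" .
    then have "real (cst ((k + 4) * (S n + 2) ^ 2)) \<le> real (C * ((k + 5) * 4) ^ 4 * S n ^ 8)" by (rule of_nat_mono)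
    also have "\<dots> = real C * (real (k + 5) * 4) ^ 4 * real (S n) ^ 8" by simp
    also have "\<dots> \<le> real C * (real (k + 5) * 4) ^ 4 * (G ^ 8 * ?E)"
    proof (rule mult_left_mono)
      have "real (S n) ^ 8 \<le> (G * real n powr (1 + \<eta>)) ^ 8" using S2 by (intro power_mono) auto
      also have "\<dots> = G ^ 8 * real n powr ((1 + \<eta>) * 8)"
        using n1 by (simp add: power_mult_distrib powr_realpow[symmetric] powr_powr)
      also have "\<dots> \<le> G ^ 8 * ?E"
        using eta K eps G by (intro mult_left_mono mono) auto
      finally show "real (S n) ^ 8 \<le> G ^ 8 * ?E" .
    qed auto
    finally have 1: "real (cst ((k + 4) * (S n + 2) ^ 2)) \<le> real C * (real (k + 5) * 4) ^ 4 * G ^ 8 * ?E"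
      by (simp add: mult.assoc)
    have 2: "w \<le> w * ?E" using mult_left_mono[OF E1 F(2)] by simp
    have "real ((k + 1) * S n) powr (K - \<epsilon>) \<le> (real (k + 1) * (G * real n powr (1 + \<eta>))) powr (K - \<epsilon>)"
      unfolding of_nat_mult using S2 K eps by (intro powr_mono2 mult_left_mono) auto
    also have "\<dots> = (real (k + 1) * G) powr (K - \<epsilon>) * real n powr ((1 + \<eta>) * (K - \<epsilon>))"
      using G by (simp add: powr_mult powr_powr mult.assoc)
    also have "\<dots> \<le> (real (k + 1) * G) powr (K - \<epsilon>) * ?E"
    proof (intro mult_left_mono mono)
      have "\<eta> * K \<le> \<epsilon> / 2" using eta(3) K by (simp add: field_simps)
      moreover have "0 \<le> \<eta> * \<epsilon>" using eta eps by simp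
      ultimately show "(1 + \<eta>) * (K - \<epsilon>) \<le> K - \<epsilon> / 2" by (simp add: algebra_simps)
    qed auto
    finally have 3: "F * real ((k + 1) * S n) powr (K - \<epsilon>) \<le> F * (real (k + 1) * G) powr (K - \<epsilon>) * ?E"
      using F(1) by (simp add: mult.assoc mult_left_mono)
    have "0 \<le> F * real ((k + 1) * S n) powr (K - \<epsilon>)" using F by simp
    then show ?case using 1 2 3 F by (simp add: algebra_simps)
  qed
qed

section \<open>Compiling expressions to the word RAM\<close>

definition reach :: "program \<Rightarrow> nat \<Rightarrow> config \<Rightarrow> nat \<Rightarrow> config \<Rightarrow> bool" where
  "reach Q W s T s' \<longleftrightarrow> (\<exists>t\<le>T. (step Q ^^ t) s = s' \<and> (\<forall>t'\<le>t. fits W ((step Q ^^ t') s)))"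

lemma reach_refl: "fits W s \<Longrightarrow> reach Q W s T s"
  unfolding reach_def by (intro exI[of _ 0]) auto

lemma reach_fits: "reach Q W s T s' \<Longrightarrow> fits W s'"
  unfolding reach_def by auto

lemma reach_mono: "reach Q W s T s' \<Longrightarrow> T \<le> T' \<Longrightarrow> reach Q W s T' s'"
  unfolding reach_def using order_trans by blast

lemma reach_trans:
  assumes "reach Q W s T s'" "reach Q W s' T' s''"
  shows "reach Q W s (T + T') s''"
proof -
  obtain t where t: "t \<le> T" "(step Q ^^ t) s = s'" "\<forall>t'\<le>t. fits W ((step Q ^^ t') s)"
    using assms(1) unfolding reach_def by blast
  obtain u where u: "u \<le> T'" "(step Q ^^ u) s' = s''" "\<forall>t'\<le>u. fits W ((step Q ^^ t') s')"
    using assms(2) unfolding reach_def by blast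
  have split: "(step Q ^^ (v + t)) s = (step Q ^^ v) s'" for v
    using t(2) by (simp add: funpow_add)
  have "fits W ((step Q ^^ v) s)" if "v \<le> u + t" for v
  proof (cases "v \<le> t")
    case False
    then have "v = (v - t) + t" "v - t \<le> u" using that by auto
    then show ?thesis using split u(3) by metis
  qed (use t in auto)
  then show ?thesis
    unfolding reach_def using t u split by (intro exI[of _ "u + t"]) auto
qed

definition code_at :: "program \<Rightarrow> nat \<Rightarrow> program \<Rightarrow> bool" where
  "code_at Q p C \<longleftrightarrow> (\<exists>A B. Q = A @ C @ B \<and> length A = p)"

lemma code_at_append:
  "code_at Q p (C @ D) \<longleftrightarrow> code_at Q p C \<and> code_at Q (p + length C) D"
proof
  assume "code_at Q p (C @ D)"
  then obtain A B where "Q = A @ C @ D @ B" "length A = p"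
    unfolding code_at_def by auto
  then show "code_at Q p C \<and> code_at Q (p + length C) D"
    unfolding code_at_def
    by (intro conjI exI[of _ A] exI[of _ "D @ B"] exI[of _ "A @ C"] exI[of _ B]) auto
next
  assume *: "code_at Q p C \<and> code_at Q (p + length C) D"
  then obtain A B where 1: "Q = A @ C @ B" "length A = p"
    unfolding code_at_def by blast
  from * obtain A' B' where 2: "Q = A' @ D @ B'" "length A' = p + length C"
    unfolding code_at_def by blast
  note h = 1 2
  have "B = drop (p + length C) Q" using h(1,2) by auto
  also have "\<dots> = D @ B'" using h(3,4) by auto
  finally show "code_at Q p (C @ D)"
    unfolding code_at_def using h by (intro exI[of _ A] exI[of _ B']) auto
qed

lemma code_at_Cons:
  "code_at Q p (i # C) \<longleftrightarrow> code_at Q p [i] \<and> code_at Q (Suc p) C"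
  using code_at_append[of Q p "[i]" C] by simp

lemma reach_step:
  assumes "code_at Q (pc s) [i]" "fits W s" "exec i s = s'" "fits W s'"
  shows "reach Q W s (Suc 0) s'"
proof -
  obtain A B where "Q = A @ i # B" "length A = pc s" using assms(1) unfolding code_at_def by auto
  then have "Q ! pc s = i" "pc s < length Q" by (auto simp: nth_append)
  then have "step Q s = s'" unfolding step_def halted_def using assms(3) by auto
  then show ?thesis unfolding reach_def
    by (intro exI[of _ 1]) (use assms in \<open>auto simp: le_Suc_eq\<close>)
qed

text \<open>There is no conditional: decisions are arithmetic on 0/1 values produced by
  \<open>Nz\<close>. The running time is therefore bounded in terms of the expression and the loop
  bound alone.\<close>

datatype exp = Num int | Var nat | Bin binop exp exp | Nz exp | Ld exp | Let_in exp exp | Fold exp exp exp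

fun len :: "exp \<Rightarrow> nat" where
  "len (Num c) = 1"
| "len (Var i) = 1"
| "len (Bin f a b) = len a + len b + 1"
| "len (Nz a) = len a + 1"
| "len (Ld a) = len a + 1"
| "len (Let_in a b) = len a + len b + 1"
| "len (Fold a b c) = len a + len b + len c + 6"

text \<open>
  The code leaves the value in register \<open>r\<close>, uses the registers from \<open>r\<close> on as a stack and reads
  variables from registers below. In \<open>Fold a b c\<close> at level \<open>r\<close>, the registers \<open>r\<close>, \<open>r + 1\<close>, \<open>r + 2\<close>
  hold the accumulator, the number of iterations and the loop counter while \<open>c\<close> is evaluated.
  The argument \<open>p\<close> is the address of the code.
\<close>

fun code :: "exp \<Rightarrow> nat \<Rightarrow> nat \<Rightarrow> instr list" where
  "code (Num c) r p = [Const r c]"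
| "code (Var i) r p = [Op Or r i i]"
| "code (Bin f a b) r p = code a r p @ code b (Suc r) (p + len a) @ [Op f r r (Suc r)]"
| "code (Nz a) r p = code a r p @ [Op Div r r r]"
| "code (Ld a) r p = code a r p @ [Load r r]"
| "code (Let_in a b) r p = code a r p @ code b (Suc r) (p + len a) @ [Op Or r (Suc r) (Suc r)]"
| "code (Fold a b c) r p = code a r p @ code b (Suc r) (p + len a) @
     [Const (r + 2) 0, Jump (p + len a + len b + len c + 5)] @
     code c (r + 3) (p + len a + len b + 2) @
     [Op Or r (r + 3) (r + 3), Const (r + 3) 1, Op Add (r + 2) (r + 2) (r + 3),
      JumpLess (r + 2) (Suc r) (p + len a + len b + 2)]"

lemma length_code [simp]: "length (code e r p) = len e"
  by (induction e arbitrary: r p) auto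

fun cost :: "nat \<Rightarrow> exp \<Rightarrow> nat" where
  "cost B (Num c) = 1"
| "cost B (Var i) = 1"
| "cost B (Bin f a b) = cost B a + cost B b + 1"
| "cost B (Nz a) = cost B a + 1"
| "cost B (Ld a) = cost B a + 1"
| "cost B (Let_in a b) = cost B a + cost B b + 1"
| "cost B (Fold a b c) = cost B a + cost B b + B * (cost B c + 4) + 3"

fun width :: "exp \<Rightarrow> nat" where
  "width (Num c) = 1"
| "width (Var i) = 1"
| "width (Bin f a b) = max (width a) (Suc (width b))"
| "width (Nz a) = width a"
| "width (Ld a) = width a"
| "width (Let_in a b) = max (width a) (Suc (width b))"
| "width (Fold a b c) = max (width a) (max (Suc (width b)) (width c + 3))"

lemma width_pos: "0 < width e"
  by (induction e) auto

text \<open>Evaluation at level \<open>r\<close> with all words bounded by \<open>W\<close> and all numbers of iterations by \<open>B\<close>.\<close>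

inductive ev :: "nat \<Rightarrow> nat \<Rightarrow> exp \<Rightarrow> nat \<Rightarrow> (nat \<Rightarrow> int) \<Rightarrow> (int \<Rightarrow> int) \<Rightarrow> int \<Rightarrow> bool" for W B where
  ev_Num: "\<bar>c\<bar> \<le> int W \<Longrightarrow> ev W B (Num c) r \<rho> m c"
| ev_Var: "i < r \<Longrightarrow> \<rho> i = x \<Longrightarrow> ev W B (Var i) r \<rho> m x"
| ev_Bin: "ev W B a r \<rho> m x \<Longrightarrow> ev W B b (Suc r) (\<rho>(r := x)) m y \<Longrightarrow> apply_op f x y = z \<Longrightarrow>
    \<bar>z\<bar> \<le> int W \<Longrightarrow> ev W B (Bin f a b) r \<rho> m z"
| ev_Nz: "ev W B a r \<rho> m x \<Longrightarrow> y = of_bool (x \<noteq> 0) \<Longrightarrow> ev W B (Nz a) r \<rho> m y"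
| ev_Ld: "ev W B a r \<rho> m x \<Longrightarrow> m x = y \<Longrightarrow> ev W B (Ld a) r \<rho> m y"
| ev_Let: "ev W B a r \<rho> m x \<Longrightarrow> ev W B b (Suc r) (\<rho>(r := x)) m y \<Longrightarrow> ev W B (Let_in a b) r \<rho> m y"
| ev_Fold: "ev W B a r \<rho> m (g 0) \<Longrightarrow> ev W B b (Suc r) (\<rho>(r := g 0)) m (int l) \<Longrightarrow> l \<le> B \<Longrightarrow>
    (\<And>i. i < l \<Longrightarrow>
      ev W B c (r + 3) (\<rho>(r := g i, r + 1 := int l, r + 2 := int i)) m (g (Suc i))) \<Longrightarrow>
    g l = y \<Longrightarrow> ev W B (Fold a b c) r \<rho> m y"

lemma fits_reg: "fits W s \<Longrightarrow> \<bar>reg s i\<bar> \<le> int W"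
  and fits_mem: "fits W s \<Longrightarrow> \<bar>mem s a\<bar> \<le> int W"
  unfolding fits_def by auto

lemma fits_upd:
  "fits W s \<Longrightarrow> \<bar>x\<bar> \<le> int W \<Longrightarrow> fits W (s\<lparr>pc := p, reg := (reg s)(i := x)\<rparr>)"
  unfolding fits_def by auto

text \<open>The lower half protects the variables and the stack below; the upper half tells which
  registers have to be reset in the end.\<close>

definition same_off :: "nat \<Rightarrow> nat \<Rightarrow> (nat \<Rightarrow> int) \<Rightarrow> (nat \<Rightarrow> int) \<Rightarrow> bool" where
  "same_off r w \<rho> \<rho>' \<longleftrightarrow> (\<forall>i. i < r \<or> r + w \<le> i \<longrightarrow> \<rho>' i = \<rho> i)"

definition comp_ok :: "nat \<Rightarrow> nat \<Rightarrow> exp \<Rightarrow> nat \<Rightarrow> (nat \<Rightarrow> int) \<Rightarrow> (int \<Rightarrow> int) \<Rightarrow> int \<Rightarrow> bool" where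
  "comp_ok W B e r \<rho> m x \<longleftrightarrow> (\<forall>Q s. code_at Q (pc s) (code e r (pc s)) \<longrightarrow> fits W s \<longrightarrow>
     mem s = m \<longrightarrow> (\<forall>i<r. reg s i = \<rho> i) \<longrightarrow>
     (\<exists>\<rho>'. reach Q W s (cost B e) (s\<lparr>pc := pc s + len e, reg := \<rho>'\<rparr>) \<and>
           same_off r (width e) (reg s) \<rho>' \<and> \<rho>' r = x))"

lemma comp_okD:
  assumes "comp_ok W B e r \<rho> m x" "code_at Q p (code e r p)" "fits W s" "pc s = p"
    "mem s = m" "\<And>i. i < r \<Longrightarrow> reg s i = \<rho> i"
  obtains \<rho>' where "reach Q W s (cost B e) (s\<lparr>pc := p + len e, reg := \<rho>'\<rparr>)"
    "same_off r (width e) (reg s) \<rho>'" "\<rho>' r = x"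
  using assms unfolding comp_ok_def by metis

lemma reach_Op:
  assumes "code_at Q (pc s) [Op f i j l]" "fits W s" "apply_op f (reg s j) (reg s l) = x" "\<bar>x\<bar> \<le> int W"
  shows "reach Q W s (Suc 0) (s\<lparr>pc := Suc (pc s), reg := (reg s)(i := x)\<rparr>)"
  by (rule reach_step[OF assms(1,2)]) (use assms in \<open>auto intro: fits_upd\<close>)

lemma reach_Const:
  assumes "code_at Q (pc s) [Const i x]" "fits W s" "\<bar>x\<bar> \<le> int W"
  shows "reach Q W s (Suc 0) (s\<lparr>pc := Suc (pc s), reg := (reg s)(i := x)\<rparr>)"
  by (rule reach_step[OF assms(1,2)]) (use assms in \<open>auto intro: fits_upd\<close>)

lemma reach_Op_mem:
  assumes "code_at Q p [Op f i j l]" "fits W (s\<lparr>pc := p, reg := \<rho>, mem := m\<rparr>)"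
    "apply_op f (\<rho> j) (\<rho> l) = x" "\<bar>x\<bar> \<le> int W"
  shows "reach Q W (s\<lparr>pc := p, reg := \<rho>, mem := m\<rparr>) (Suc 0) (s\<lparr>pc := Suc p, reg := \<rho>(i := x), mem := m\<rparr>)"
  by (rule reach_step[OF _ assms(2), where i = "Op f i j l"]) (use assms in \<open>auto simp: fits_def\<close>)

lemma reach_Const_mem:
  assumes "code_at Q p [Const i x]" "fits W (s\<lparr>pc := p, reg := \<rho>, mem := m\<rparr>)" "\<bar>x\<bar> \<le> int W"
  shows "reach Q W (s\<lparr>pc := p, reg := \<rho>, mem := m\<rparr>) (Suc 0) (s\<lparr>pc := Suc p, reg := \<rho>(i := x), mem := m\<rparr>)"
  by (rule reach_step[OF _ assms(2), where i = "Const i x"]) (use assms in \<open>auto simp: fits_def\<close>)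

text \<open>Division by zero gives 0, which makes \<open>Div\<close> the test behind
  \<open>Nz\<close>.\<close>

lemma div_self_of_bool: "(x::int) div x = of_bool (x \<noteq> 0)"
  by simp

lemma comp_ok_two:
  assumes a: "comp_ok W B a r \<rho> m x" and b: "comp_ok W B b (Suc r) (\<rho>(r := x)) m y"
    and "code_at Q p (code a r p)" "code_at Q (p + len a) (code b (Suc r) (p + len a))"
    and "fits W s" "pc s = p" "mem s = m" "\<And>i. i < r \<Longrightarrow> reg s i = \<rho> i"
  obtains \<rho>' where "reach Q W s (cost B a + cost B b) (s\<lparr>pc := p + len a + len b, reg := \<rho>'\<rparr>)"
    "same_off r (max (width a) (Suc (width b))) (reg s) \<rho>'" "\<rho>' r = x" "\<rho>' (Suc r) = y"
proof -
  obtain \<rho>1 where 1: "reach Q W s (cost B a) (s\<lparr>pc := p + len a, reg := \<rho>1\<rparr>)"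
    "same_off r (width a) (reg s) \<rho>1" "\<rho>1 r = x"
    by (rule comp_okD[OF a assms(3,5-8)])
  let ?s = "s\<lparr>pc := p + len a, reg := \<rho>1\<rparr>"
  have "reg ?s i = (\<rho>(r := x)) i" if "i < Suc r" for i
    using that 1 assms(8) by (auto simp: same_off_def less_Suc_eq)
  note agree = this
  obtain \<rho>2 where 2: "reach Q W ?s (cost B b) (?s\<lparr>pc := p + len a + len b, reg := \<rho>2\<rparr>)"
    "same_off (Suc r) (width b) (reg ?s) \<rho>2" "\<rho>2 (Suc r) = y"
    by (rule comp_okD[OF b assms(4) reach_fits[OF 1(1)]]) (use assms(7) agree in auto)
  show thesis
  proof (rule that)
    show "reach Q W s (cost B a + cost B b) (s\<lparr>pc := p + len a + len b, reg := \<rho>2\<rparr>)"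
      using reach_trans[OF 1(1) 2(1)] by simp
    show "same_off r (max (width a) (Suc (width b))) (reg s) \<rho>2"
      using 1 2 unfolding same_off_def by auto
    show "\<rho>2 r = x" "\<rho>2 (Suc r) = y" using 1 2 by (auto simp: same_off_def)
  qed
qed


text \<open>\<open>ev\<close> does not bound the auxiliary words of a loop: \<open>B \<le> W\<close>
  is for the counters, \<open>1 \<le> W\<close> for the increment and for the values of
  \<open>Nz\<close>.\<close>

lemma ev_comp_ok:
  assumes "ev W B e r \<rho> m x" and "1 \<le> W" and "B \<le> W"
  shows "comp_ok W B e r \<rho> m x"
  using assms(1)
proof (induction rule: ev.induct)
  case (ev_Num c r \<rho> m)
  show ?case unfolding comp_ok_def
  proof (intro allI impI)
    fix Q s assume h: "code_at Q (pc s) (code (Num c) r (pc s))" "fits W s"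
    then show "\<exists>\<rho>'. reach Q W s (cost B (Num c)) (s\<lparr>pc := pc s + len (Num c), reg := \<rho>'\<rparr>) \<and>
        same_off r (width (Num c)) (reg s) \<rho>' \<and> \<rho>' r = c"
      using reach_Const[of Q s r c] ev_Num
      by (intro exI[of _ "(reg s)(r := c)"]) (auto simp: same_off_def)
  qed
next
  case (ev_Var i r \<rho> x m)
  show ?case unfolding comp_ok_def
  proof (intro allI impI)
    fix Q s assume h: "code_at Q (pc s) (code (Var i) r (pc s))" "fits W s" "\<forall>i<r. reg s i = \<rho> i"
    then show "\<exists>\<rho>'. reach Q W s (cost B (Var i)) (s\<lparr>pc := pc s + len (Var i), reg := \<rho>'\<rparr>) \<and>
        same_off r (width (Var i)) (reg s) \<rho>' \<and> \<rho>' r = x"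
      using reach_Op[of Q s Or r i i W x] ev_Var fits_reg[OF h(2), of i]
      by (intro exI[of _ "(reg s)(r := x)"]) (auto simp: same_off_def)
  qed
next
  case (ev_Bin a r \<rho> m x b y f z)
  show ?case unfolding comp_ok_def
  proof (intro allI impI)
    fix Q s
    assume h: "code_at Q (pc s) (code (Bin f a b) r (pc s))" "fits W s" "mem s = m" "\<forall>i<r. reg s i = \<rho> i"
    have c: "code_at Q (pc s) (code a r (pc s))" "code_at Q (pc s + len a) (code b (Suc r) (pc s + len a))"
      "code_at Q (pc s + len a + len b) [Op f r r (Suc r)]"
      using h(1) by (auto simp: code_at_append)
    obtain \<rho>' where 1: "reach Q W s (cost B a + cost B b) (s\<lparr>pc := pc s + len a + len b, reg := \<rho>'\<rparr>)"
      "same_off r (max (width a) (Suc (width b))) (reg s) \<rho>'" "\<rho>' r = x" "\<rho>' (Suc r) = y"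
      by (rule comp_ok_two[OF ev_Bin.IH c(1,2) h(2) refl h(3)]) (use h(4) in auto)
    have 2: "reach Q W (s\<lparr>pc := pc s + len a + len b, reg := \<rho>'\<rparr>) (Suc 0)
        (s\<lparr>pc := Suc (pc s + len a + len b), reg := \<rho>'(r := z)\<rparr>)"
      using reach_Op[OF _ reach_fits[OF 1(1)], where ?x = z and ?i = r] c(3) 1 ev_Bin.hyps by simp
    show "\<exists>\<rho>'. reach Q W s (cost B (Bin f a b)) (s\<lparr>pc := pc s + len (Bin f a b), reg := \<rho>'\<rparr>) \<and>
        same_off r (width (Bin f a b)) (reg s) \<rho>' \<and> \<rho>' r = z"
      using reach_trans[OF 1(1) 2] 1(2) width_pos[of a]
      by (intro exI[of _ "\<rho>'(r := z)"]) (auto simp: same_off_def add.assoc)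
  qed
next
  case (ev_Let a r \<rho> m x b y)
  show ?case unfolding comp_ok_def
  proof (intro allI impI)
    fix Q s
    assume h: "code_at Q (pc s) (code (Let_in a b) r (pc s))" "fits W s" "mem s = m" "\<forall>i<r. reg s i = \<rho> i"
    have c: "code_at Q (pc s) (code a r (pc s))" "code_at Q (pc s + len a) (code b (Suc r) (pc s + len a))"
      "code_at Q (pc s + len a + len b) [Op Or r (Suc r) (Suc r)]"
      using h(1) by (auto simp: code_at_append)
    obtain \<rho>' where 1: "reach Q W s (cost B a + cost B b) (s\<lparr>pc := pc s + len a + len b, reg := \<rho>'\<rparr>)"
      "same_off r (max (width a) (Suc (width b))) (reg s) \<rho>'" "\<rho>' r = x" "\<rho>' (Suc r) = y"
      by (rule comp_ok_two[OF ev_Let.IH c(1,2) h(2) refl h(3)]) (use h(4) in auto)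
    have 2: "reach Q W (s\<lparr>pc := pc s + len a + len b, reg := \<rho>'\<rparr>) (Suc 0)
        (s\<lparr>pc := Suc (pc s + len a + len b), reg := \<rho>'(r := y)\<rparr>)"
      using reach_Op[OF _ reach_fits[OF 1(1)], where ?x = y and ?i = r] c(3) 1
        fits_reg[OF reach_fits[OF 1(1)], of "Suc r"] by simp
    show "\<exists>\<rho>'. reach Q W s (cost B (Let_in a b)) (s\<lparr>pc := pc s + len (Let_in a b), reg := \<rho>'\<rparr>) \<and>
        same_off r (width (Let_in a b)) (reg s) \<rho>' \<and> \<rho>' r = y"
      using reach_trans[OF 1(1) 2] 1(2) width_pos[of a]
      by (intro exI[of _ "\<rho>'(r := y)"]) (auto simp: same_off_def add.assoc)
  qed
next
  case (ev_Nz a r \<rho> m x y)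
  show ?case unfolding comp_ok_def
  proof (intro allI impI)
    fix Q s
    assume h: "code_at Q (pc s) (code (Nz a) r (pc s))" "fits W s" "mem s = m" "\<forall>i<r. reg s i = \<rho> i"
    have c: "code_at Q (pc s) (code a r (pc s))" "code_at Q (pc s + len a) [Op Div r r r]"
      using h(1) by (auto simp: code_at_append)
    obtain \<rho>' where 1: "reach Q W s (cost B a) (s\<lparr>pc := pc s + len a, reg := \<rho>'\<rparr>)"
      "same_off r (width a) (reg s) \<rho>'" "\<rho>' r = x"
      by (rule comp_okD[OF ev_Nz.IH c(1) h(2) refl h(3)]) (use h(4) in auto)
    have 2: "reach Q W (s\<lparr>pc := pc s + len a, reg := \<rho>'\<rparr>) (Suc 0)
        (s\<lparr>pc := Suc (pc s + len a), reg := \<rho>'(r := y)\<rparr>)"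
      using reach_Op[OF _ reach_fits[OF 1(1)], where ?x = y and ?i = r] c(2) 1 ev_Nz.hyps assms(2)
      by (simp add: div_self_of_bool)
    show "\<exists>\<rho>'. reach Q W s (cost B (Nz a)) (s\<lparr>pc := pc s + len (Nz a), reg := \<rho>'\<rparr>) \<and>
        same_off r (width (Nz a)) (reg s) \<rho>' \<and> \<rho>' r = y"
      using reach_trans[OF 1(1) 2] 1(2) width_pos[of a]
      by (intro exI[of _ "\<rho>'(r := y)"]) (auto simp: same_off_def)
  qed
next
  case (ev_Ld a r \<rho> m x y)
  show ?case unfolding comp_ok_def
  proof (intro allI impI)
    fix Q s
    assume h: "code_at Q (pc s) (code (Ld a) r (pc s))" "fits W s" "mem s = m" "\<forall>i<r. reg s i = \<rho> i"
    have c: "code_at Q (pc s) (code a r (pc s))" "code_at Q (pc s + len a) [Load r r]"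
      using h(1) by (auto simp: code_at_append)
    obtain \<rho>' where 1: "reach Q W s (cost B a) (s\<lparr>pc := pc s + len a, reg := \<rho>'\<rparr>)"
      "same_off r (width a) (reg s) \<rho>'" "\<rho>' r = x"
      by (rule comp_okD[OF ev_Ld.IH c(1) h(2) refl h(3)]) (use h(4) in auto)
    have 2: "reach Q W (s\<lparr>pc := pc s + len a, reg := \<rho>'\<rparr>) (Suc 0)
        (s\<lparr>pc := Suc (pc s + len a), reg := \<rho>'(r := y)\<rparr>)"
    proof (rule reach_step[OF _ reach_fits[OF 1(1)]])
      show "fits W (s\<lparr>pc := Suc (pc s + len a), reg := \<rho>'(r := y)\<rparr>)"
        using fits_upd[OF reach_fits[OF 1(1)], where x = y and i = r and p = "Suc (pc s + len a)"]
          fits_mem[OF h(2), of x] h(3) ev_Ld.hyps by simp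
    qed (use c(2) 1(3) h(3) ev_Ld.hyps in auto)
    show "\<exists>\<rho>'. reach Q W s (cost B (Ld a)) (s\<lparr>pc := pc s + len (Ld a), reg := \<rho>'\<rparr>) \<and>
        same_off r (width (Ld a)) (reg s) \<rho>' \<and> \<rho>' r = y"
      using reach_trans[OF 1(1) 2] 1(2) width_pos[of a]
      by (intro exI[of _ "\<rho>'(r := y)"]) (auto simp: same_off_def)
  qed
next
  case (ev_Fold a r \<rho> m g b l c y)
  show ?case unfolding comp_ok_def
  proof (intro allI impI)
    fix Q and s :: config
    let ?e = "Fold a b c"
    define p where "p = pc s + len a + len b"
    assume h: "code_at Q (pc s) (code ?e r (pc s))" "fits W s" "mem s = m" "\<forall>i<r. reg s i = \<rho> i"
    have c: "code_at Q (pc s) (code a r (pc s))" "code_at Q (pc s + len a) (code b (Suc r) (pc s + len a))"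
      "code_at Q p [Const (r + 2) 0]" "code_at Q (Suc p) [Jump (p + len c + 5)]"
      "code_at Q (p + 2) (code c (r + 3) (p + 2))"
      "code_at Q (p + len c + 2) [Op Or r (r + 3) (r + 3)]"
      "code_at Q (p + len c + 3) [Const (r + 3) 1]"
      "code_at Q (p + len c + 4) [Op Add (r + 2) (r + 2) (r + 3)]"
      "code_at Q (p + len c + 5) [JumpLess (r + 2) (Suc r) (p + 2)]"
      using h(1)
      by (auto simp: code_at_append code_at_Cons[of Q _ _ "_ # _"] code_at_Cons[of Q _ _ "_ @ _"]
          p_def add_ac numeral_eq_Suc)
    obtain \<rho>1 where 1: "reach Q W s (cost B a + cost B b) (s\<lparr>pc := p, reg := \<rho>1\<rparr>)"
      "same_off r (max (width a) (Suc (width b))) (reg s) \<rho>1" "\<rho>1 r = g 0" "\<rho>1 (Suc r) = int l"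
      unfolding p_def
      by (rule comp_ok_two[OF ev_Fold.IH(1,2) c(1,2) h(2) refl h(3)]) (use h(4) in auto)
    have 2: "reach Q W (s\<lparr>pc := p, reg := \<rho>1\<rparr>) (Suc 0) (s\<lparr>pc := Suc p, reg := \<rho>1(r + 2 := 0)\<rparr>)"
      using reach_Const[OF _ reach_fits[OF 1(1)], where ?x = 0 and ?i = "r + 2"] c(3) by simp
    have 3: "reach Q W (s\<lparr>pc := Suc p, reg := \<rho>1(r + 2 := 0)\<rparr>) (Suc 0)
        (s\<lparr>pc := p + len c + 5, reg := \<rho>1(r + 2 := 0)\<rparr>)"
      by (rule reach_step[OF _ reach_fits[OF 2]])
        (use c(4) reach_fits[OF 2] in \<open>auto simp: fits_def\<close>)
    note start = reach_trans[OF 1(1) reach_trans[OF 2 3]]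
    \<comment> \<open>The invariant is stated at the test closing the loop, which the initial jump
      enters directly; so zero iterations need no separate treatment.\<close>
    have loop: "\<exists>\<rho>'. reach Q W s (cost B a + cost B b + 2 + i * (cost B c + 4))
          (s\<lparr>pc := p + len c + 5, reg := \<rho>'\<rparr>) \<and> same_off r (width ?e) (reg s) \<rho>' \<and>
          \<rho>' r = g i \<and> \<rho>' (Suc r) = int l \<and> \<rho>' (r + 2) = int i" if "i \<le> l" for i
      using that
    proof (induction i)
      case 0
      define \<rho>2 where "\<rho>2 = \<rho>1(r + 2 := 0)"
      have "same_off r (width ?e) (reg s) \<rho>2" "\<rho>2 r = g 0" "\<rho>2 (Suc r) = int l" "\<rho>2 (r + 2) = 0"
        using 1(2-) width_pos[of c] by (auto simp: same_off_def \<rho>2_def)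
      then show ?case using start unfolding \<rho>2_def[symmetric] by (intro exI[of _ \<rho>2]) simp
    next
      case (Suc i)
      then obtain \<rho>' where I: "reach Q W s (cost B a + cost B b + 2 + i * (cost B c + 4))
          (s\<lparr>pc := p + len c + 5, reg := \<rho>'\<rparr>)" "same_off r (width ?e) (reg s) \<rho>'"
          "\<rho>' r = g i" "\<rho>' (Suc r) = int l" "\<rho>' (r + 2) = int i" by auto
      have 4: "reach Q W (s\<lparr>pc := p + len c + 5, reg := \<rho>'\<rparr>) (Suc 0) (s\<lparr>pc := p + 2, reg := \<rho>'\<rparr>)"
        by (rule reach_step[OF _ reach_fits[OF I(1)]])
          (use c(9) reach_fits[OF I(1)] I Suc.prems in \<open>auto simp: fits_def\<close>)
      obtain \<rho>2 where 5: "reach Q W (s\<lparr>pc := p + 2, reg := \<rho>'\<rparr>) (cost B c) (s\<lparr>pc := p + 2 + len c, reg := \<rho>2\<rparr>)"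
        "same_off (r + 3) (width c) \<rho>' \<rho>2" "\<rho>2 (r + 3) = g (Suc i)"
        by (rule comp_okD[OF ev_Fold.IH(3) c(5) reach_fits[OF 4]])
          (use Suc.prems h(3,4) I in \<open>auto simp: same_off_def less_Suc_eq numeral_eq_Suc\<close>)
      have regs: "\<rho>2 (Suc r) = int l" "\<rho>2 (r + 2) = int i" "same_off r (width ?e) (reg s) \<rho>2"
        using 5(2) I(2-) by (auto simp: same_off_def)
      let ?A = "\<rho>2(r := g (Suc i))" let ?B = "?A(r + 3 := 1)" let ?C = "?B(r + 2 := int (Suc i))"
      have 6: "reach Q W (s\<lparr>pc := p + 2 + len c, reg := \<rho>2\<rparr>) (Suc 0) (s\<lparr>pc := p + len c + 3, reg := ?A\<rparr>)"
        using reach_Op[OF _ reach_fits[OF 5(1)], where ?x = "g (Suc i)" and ?i = r] c(6) 5(3)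
          fits_reg[OF reach_fits[OF 5(1)], of "r + 3"] by (simp add: numeral_eq_Suc)
      have 7: "reach Q W (s\<lparr>pc := p + len c + 3, reg := ?A\<rparr>) (Suc 0) (s\<lparr>pc := p + len c + 4, reg := ?B\<rparr>)"
        using reach_Const[OF _ reach_fits[OF 6], where ?x = 1 and ?i = "r + 3"] c(7) assms(2)
        by (simp add: numeral_eq_Suc)
      have "\<bar>1 + int i\<bar> \<le> int W" using Suc.prems ev_Fold.hyps assms by simp
      then have 8: "reach Q W (s\<lparr>pc := p + len c + 4, reg := ?B\<rparr>) (Suc 0) (s\<lparr>pc := p + len c + 5, reg := ?C\<rparr>)"
        using reach_Op[OF _ reach_fits[OF 7], where ?x = "int (Suc i)" and ?i = "r + 2"] c(8) regs
        by (simp add: numeral_eq_Suc)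
      have "?C r = g (Suc i) \<and> ?C (Suc r) = int l \<and> ?C (r + 2) = int (Suc i) \<and> same_off r (width ?e) (reg s) ?C"
        using regs width_pos[of c] by (auto simp: same_off_def)
      moreover define \<rho>3 where "\<rho>3 = ?C"
      ultimately show ?case
        using reach_trans[OF I(1) reach_trans[OF 4 reach_trans[OF 5(1) reach_trans[OF 6 reach_trans[OF 7 8]]]]]
        unfolding \<rho>3_def[symmetric] by (intro exI[of _ \<rho>3]) (simp add: numeral_eq_Suc algebra_simps)
    qed
    obtain \<rho>' where I: "reach Q W s (cost B a + cost B b + 2 + l * (cost B c + 4))
          (s\<lparr>pc := p + len c + 5, reg := \<rho>'\<rparr>)" "same_off r (width ?e) (reg s) \<rho>'"
          "\<rho>' r = g l" "\<rho>' (Suc r) = int l" "\<rho>' (r + 2) = int l" using loop[of l] by auto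
    have 4: "reach Q W (s\<lparr>pc := p + len c + 5, reg := \<rho>'\<rparr>) (Suc 0) (s\<lparr>pc := p + len c + 6, reg := \<rho>'\<rparr>)"
      by (rule reach_step[OF _ reach_fits[OF I(1)]])
        (use c(9) reach_fits[OF I(1)] I in \<open>auto simp: fits_def\<close>)
    have "reach Q W s (cost B ?e) (s\<lparr>pc := p + len c + 6, reg := \<rho>'\<rparr>)"
      by (rule reach_mono[OF reach_trans[OF I(1) 4]]) (use ev_Fold.hyps in auto)
    then show "\<exists>\<rho>'. reach Q W s (cost B ?e) (s\<lparr>pc := pc s + len ?e, reg := \<rho>'\<rparr>) \<and>
        same_off r (width ?e) (reg s) \<rho>' \<and> \<rho>' r = y"
      using I ev_Fold.hyps by (intro exI[of _ \<rho>']) (auto simp: p_def add_ac)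
  qed
qed


section \<open>Statements that extend the stack or write memory\<close>

datatype stm = Set exp | Fill exp exp exp

fun slen :: "stm \<Rightarrow> nat" where
  "slen (Set e) = len e"
| "slen (Fill l a v) = len l + len a + len v + 6"

fun scode :: "stm \<Rightarrow> nat \<Rightarrow> nat \<Rightarrow> instr list" where
  "scode (Set e) r p = code e r p"
| "scode (Fill l a v) r p = code l r p @
     [Const (r + 1) 0, Jump (p + len l + len a + len v + 5)] @
     code a (r + 2) (p + len l + 2) @ code v (r + 3) (p + len l + len a + 2) @
     [Store (r + 2) (r + 3), Const (r + 2) 1, Op Add (r + 1) (r + 1) (r + 2),
      JumpLess (r + 1) r (p + len l + 2)]"

fun level :: "stm \<Rightarrow> nat \<Rightarrow> nat" where
  "level (Set e) r = Suc r"
| "level (Fill l a v) r = r"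

fun codes :: "stm list \<Rightarrow> nat \<Rightarrow> nat \<Rightarrow> instr list" where
  "codes [] r p = []"
| "codes (c # cs) r p = scode c r p @ codes cs (level c r) (p + slen c)"

fun costs :: "nat \<Rightarrow> stm list \<Rightarrow> nat" where
  "costs B [] = 0"
| "costs B (Set e # cs) = cost B e + costs B cs"
| "costs B (Fill l a v # cs) = cost B l + B * (cost B a + cost B v + 4) + 3 + costs B cs"

fun widths :: "stm list \<Rightarrow> nat" where
  "widths [] = 0"
| "widths (Set e # cs) = max (width e) (Suc (widths cs))"
| "widths (Fill l a v # cs) = max (width l) (max (2 + width a) (max (3 + width v) (widths cs)))"

lemma length_scode [simp]: "length (scode c r p) = slen c"
  by (cases c) auto

lemma length_codes [simp]: "length (codes cs r p) = sum_list (map slen cs)"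
  by (induction cs arbitrary: r p) auto

inductive evs :: "nat \<Rightarrow> nat \<Rightarrow> stm list \<Rightarrow> nat \<Rightarrow> (nat \<Rightarrow> int) \<Rightarrow> (int \<Rightarrow> int) \<Rightarrow> (int \<Rightarrow> int) \<Rightarrow> bool" for W B where
  evs_Nil: "evs W B [] r \<rho> m m"
| evs_Set: "ev W B e r \<rho> m x \<Longrightarrow> evs W B cs (Suc r) (\<rho>(r := x)) m m' \<Longrightarrow> evs W B (Set e # cs) r \<rho> m m'"
| evs_Fill: "ev W B l r \<rho> m (int n) \<Longrightarrow> n \<le> B \<Longrightarrow> M 0 = m \<Longrightarrow>
    (\<And>i. i < n \<Longrightarrow> ev W B a (r + 2) (\<rho>(r := int n, r + 1 := int i)) (M i) (\<alpha> i)) \<Longrightarrow>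
    (\<And>i. i < n \<Longrightarrow> ev W B v (r + 3) (\<rho>(r := int n, r + 1 := int i, r + 2 := \<alpha> i)) (M i) (\<beta> i)) \<Longrightarrow>
    (\<And>i. i < n \<Longrightarrow> M (Suc i) = (M i)(\<alpha> i := \<beta> i)) \<Longrightarrow>
    evs W B cs r \<rho> (M n) m' \<Longrightarrow> evs W B (Fill l a v # cs) r \<rho> m m'"

lemma evs_reach:
  assumes "evs W B cs r \<rho> m m'" and W: "1 \<le> W" "B \<le> W"
    and "code_at Q (pc s) (codes cs r (pc s))" "fits W s" "mem s = m" "\<And>i. i < r \<Longrightarrow> reg s i = \<rho> i"
  shows "\<exists>\<rho>'. reach Q W s (costs B cs) (s\<lparr>pc := pc s + sum_list (map slen cs), reg := \<rho>', mem := m'\<rparr>) \<and>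
    (\<forall>i\<ge>r + widths cs. \<rho>' i = reg s i)"
  using assms(1,4-)
proof (induction arbitrary: s rule: evs.induct)
  case (evs_Nil r \<rho> m)
  then show ?case using reach_refl[of W s Q 0] by (intro exI[of _ "reg s"]) auto
next
  case (evs_Set e r \<rho> m x cs m')
  have c: "code_at Q (pc s) (code e r (pc s))" "code_at Q (pc s + len e) (codes cs (Suc r) (pc s + len e))"
    using evs_Set.prems(1) by (auto simp: code_at_append)
  obtain \<rho>1 where 1: "reach Q W s (cost B e) (s\<lparr>pc := pc s + len e, reg := \<rho>1\<rparr>)"
    "same_off r (width e) (reg s) \<rho>1" "\<rho>1 r = x"
    by (rule comp_okD[OF ev_comp_ok[OF evs_Set.hyps(1) W] c(1) evs_Set.prems(2) refl evs_Set.prems(3)])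
      (use evs_Set.prems in auto)
  have agree: "\<rho>1 i = (\<rho>(r := x)) i" if "i < Suc r" for i
    using that 1(2,3) evs_Set.prems(4) by (cases "i = r") (auto simp: same_off_def)
  obtain \<rho>2 where 2: "reach Q W (s\<lparr>pc := pc s + len e, reg := \<rho>1\<rparr>) (costs B cs)
      (s\<lparr>pc := pc s + len e + sum_list (map slen cs), reg := \<rho>2, mem := m'\<rparr>)"
      "\<forall>i\<ge>Suc r + widths cs. \<rho>2 i = \<rho>1 i"
    using evs_Set.IH[of "s\<lparr>pc := pc s + len e, reg := \<rho>1\<rparr>"] c(2) reach_fits[OF 1(1)] agree evs_Set.prems
    by auto
  show ?case using reach_trans[OF 1(1) 2(1)] 1(2) 2(2)
    by (intro exI[of _ \<rho>2]) (auto simp: same_off_def add_ac)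
next
  case (evs_Fill l r \<rho> m n M a \<alpha> v \<beta> cs m')
  define p where "p = pc s + len l"
  define w where "w = max (width l) (max (2 + width a) (3 + width v))"
  have c: "code_at Q (pc s) (code l r (pc s))"
      "code_at Q p [Const (r + 1) 0]" "code_at Q (Suc p) [Jump (p + len a + len v + 5)]"
      "code_at Q (p + 2) (code a (r + 2) (p + 2))"
      "code_at Q (p + 2 + len a) (code v (r + 3) (p + 2 + len a))"
      "code_at Q (p + len a + len v + 2) [Store (r + 2) (r + 3)]"
      "code_at Q (p + len a + len v + 3) [Const (r + 2) 1]"
      "code_at Q (p + len a + len v + 4) [Op Add (r + 1) (r + 1) (r + 2)]"
      "code_at Q (p + len a + len v + 5) [JumpLess (r + 1) r (p + 2)]"
      "code_at Q (p + len a + len v + 6) (codes cs r (p + len a + len v + 6))"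
    using evs_Fill.prems(1)
    by (auto simp: code_at_append code_at_Cons[of Q _ _ "_ # _"] code_at_Cons[of Q _ _ "_ @ _"] code_at_Cons[of Q _ _ "codes _ _ _"]
        p_def add_ac numeral_eq_Suc)
  obtain \<rho>1 where 1: "reach Q W s (cost B l) (s\<lparr>pc := p, reg := \<rho>1\<rparr>)"
    "same_off r (width l) (reg s) \<rho>1" "\<rho>1 r = int n"
    unfolding p_def
    by (rule comp_okD[OF ev_comp_ok[OF evs_Fill.hyps(1) W] c(1) evs_Fill.prems(2) refl evs_Fill.prems(3)])
      (use evs_Fill.prems in auto)
  have 2: "reach Q W (s\<lparr>pc := p, reg := \<rho>1\<rparr>) (Suc 0) (s\<lparr>pc := Suc p, reg := \<rho>1(r + 1 := 0)\<rparr>)"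
    using reach_Const[OF _ reach_fits[OF 1(1)], where ?x = 0 and ?i = "r + 1"] c(2) by simp
  have 3: "reach Q W (s\<lparr>pc := Suc p, reg := \<rho>1(r + 1 := 0)\<rparr>) (Suc 0)
      (s\<lparr>pc := p + len a + len v + 5, reg := \<rho>1(r + 1 := 0)\<rparr>)"
    by (rule reach_step[OF _ reach_fits[OF 2]])
      (use c(3) reach_fits[OF 2] in \<open>auto simp: fits_def\<close>)
  note start = reach_trans[OF 1(1) reach_trans[OF 2 3]]
  have loop: "\<exists>\<rho>'. reach Q W s (cost B l + 2 + i * (cost B a + cost B v + 4))
        (s\<lparr>pc := p + len a + len v + 5, reg := \<rho>', mem := M i\<rparr>) \<and> same_off r w (reg s) \<rho>' \<and>
        \<rho>' r = int n \<and> \<rho>' (r + 1) = int i" if "i \<le> n" for i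
    using that
  proof (induction i)
    case 0
    define \<rho>2 where "\<rho>2 = \<rho>1(r + 1 := 0)"
    have "same_off r w (reg s) \<rho>2" "\<rho>2 r = int n" "\<rho>2 (r + 1) = 0"
      using 1(2-) by (auto simp: same_off_def \<rho>2_def w_def)
    moreover have "s\<lparr>pc := p + len a + len v + 5, reg := \<rho>2, mem := M 0\<rparr> =
        s\<lparr>pc := p + len a + len v + 5, reg := \<rho>2\<rparr>"
      using evs_Fill.prems(3) evs_Fill.hyps by simp
    ultimately show ?case using start unfolding \<rho>2_def[symmetric] by (intro exI[of _ \<rho>2]) simp
  next
    case (Suc i)
    then obtain \<rho>' where I: "reach Q W s (cost B l + 2 + i * (cost B a + cost B v + 4))
        (s\<lparr>pc := p + len a + len v + 5, reg := \<rho>', mem := M i\<rparr>)" "same_off r w (reg s) \<rho>'"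
        "\<rho>' r = int n" "\<rho>' (r + 1) = int i" by auto
    have i: "i < n" using Suc.prems by simp
    let ?s = "s\<lparr>pc := p + 2, reg := \<rho>', mem := M i\<rparr>"
    have 4: "reach Q W (s\<lparr>pc := p + len a + len v + 5, reg := \<rho>', mem := M i\<rparr>) (Suc 0) ?s"
      by (rule reach_step[OF _ reach_fits[OF I(1)]])
        (use c(9) reach_fits[OF I(1)] I i in \<open>auto simp: fits_def\<close>)
    have IH1: "comp_ok W B a (r + 2) (\<rho>(r := int n, r + 1 := int i)) (M i) (\<alpha> i)"
      by (rule ev_comp_ok[OF evs_Fill.hyps(4)[OF i] W])
    obtain \<rho>2 where 5: "reach Q W ?s (cost B a) (?s\<lparr>pc := p + 2 + len a, reg := \<rho>2\<rparr>)"
      "same_off (r + 2) (width a) (reg ?s) \<rho>2" "\<rho>2 (r + 2) = \<alpha> i"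
      by (rule comp_okD[OF IH1 c(4) reach_fits[OF 4]])
        (use evs_Fill.prems(4) I in \<open>auto simp: same_off_def less_Suc_eq numeral_eq_Suc\<close>)
    let ?t = "s\<lparr>pc := p + 2 + len a, reg := \<rho>2, mem := M i\<rparr>"
    have "?s\<lparr>pc := p + 2 + len a, reg := \<rho>2\<rparr> = ?t" by simp
    with 5(1) have a5: "reach Q W ?s (cost B a) ?t" by (simp only:)
    have IH2: "comp_ok W B v (r + 3) (\<rho>(r := int n, r + 1 := int i, r + 2 := \<alpha> i)) (M i) (\<beta> i)"
      by (rule ev_comp_ok[OF evs_Fill.hyps(5)[OF i] W])
    obtain \<rho>3 where 6: "reach Q W ?t (cost B v) (?t\<lparr>pc := p + 2 + len a + len v, reg := \<rho>3\<rparr>)"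
      "same_off (r + 3) (width v) (reg ?t) \<rho>3" "\<rho>3 (r + 3) = \<beta> i"
      by (rule comp_okD[OF IH2 c(5) reach_fits[OF a5]])
        (use evs_Fill.prems(4) I 5(2,3) in \<open>auto simp: same_off_def less_Suc_eq numeral_eq_Suc\<close>)
    let ?u = "s\<lparr>pc := p + len a + len v + 2, reg := \<rho>3, mem := M i\<rparr>"
    have "?t\<lparr>pc := p + 2 + len a + len v, reg := \<rho>3\<rparr> = ?u" by simp
    with 6(1) have a6: "reach Q W ?t (cost B v) ?u" by (simp only:)
    have regs: "\<rho>3 r = int n" "\<rho>3 (r + 1) = int i" "\<rho>3 (r + 2) = \<alpha> i" "same_off r w (reg s) \<rho>3"
      using 5(2,3) 6(2) I(2-) by (auto simp: same_off_def w_def)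
    let ?A = "\<rho>3(r + 2 := 1)" let ?B = "?A(r + 1 := int (Suc i))"
    have 7: "reach Q W ?u (Suc 0) (s\<lparr>pc := p + len a + len v + 3, reg := \<rho>3, mem := M (Suc i)\<rparr>)"
      by (rule reach_step[OF _ reach_fits[OF a6], where i = "Store (r + 2) (r + 3)"])
        (use c(6) regs 6(3) evs_Fill.hyps(6)[OF i] reach_fits[OF a6]
          fits_reg[OF reach_fits[OF a6], of "r + 3"] in \<open>auto simp: numeral_eq_Suc fits_def\<close>)
    have 8: "reach Q W (s\<lparr>pc := p + len a + len v + 3, reg := \<rho>3, mem := M (Suc i)\<rparr>) (Suc 0)
        (s\<lparr>pc := p + len a + len v + 4, reg := ?A, mem := M (Suc i)\<rparr>)"
      using reach_Const_mem[OF c(7) reach_fits[OF 7]] assms(2)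
      by (simp add: numeral_eq_Suc)
    have "\<bar>1 + int i\<bar> \<le> int W" using i evs_Fill.hyps(2) assms by simp
    then have 9: "reach Q W (s\<lparr>pc := p + len a + len v + 4, reg := ?A, mem := M (Suc i)\<rparr>) (Suc 0)
        (s\<lparr>pc := p + len a + len v + 5, reg := ?B, mem := M (Suc i)\<rparr>)"
      using reach_Op_mem[OF c(8) reach_fits[OF 8], where ?x = "int (Suc i)"] regs
      by (simp add: numeral_eq_Suc)
    have "?B r = int n \<and> ?B (r + 1) = int (Suc i) \<and> same_off r w (reg s) ?B"
      using regs by (auto simp: same_off_def w_def)
    moreover define \<rho>4 where "\<rho>4 = ?B"
    ultimately show ?case
      using reach_trans[OF I(1) reach_trans[OF 4 reach_trans[OF a5 reach_trans[OF a6 reach_trans[OF 7 reach_trans[OF 8 9]]]]]]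
      unfolding \<rho>4_def[symmetric] by (intro exI[of _ \<rho>4]) (simp add: numeral_eq_Suc algebra_simps)
  qed
  obtain \<rho>' where I: "reach Q W s (cost B l + 2 + n * (cost B a + cost B v + 4))
      (s\<lparr>pc := p + len a + len v + 5, reg := \<rho>', mem := M n\<rparr>)" "same_off r w (reg s) \<rho>'"
      "\<rho>' r = int n" "\<rho>' (r + 1) = int n" using loop[of n] by auto
  let ?s = "s\<lparr>pc := p + len a + len v + 6, reg := \<rho>', mem := M n\<rparr>"
  have 4: "reach Q W (s\<lparr>pc := p + len a + len v + 5, reg := \<rho>', mem := M n\<rparr>) (Suc 0) ?s"
    by (rule reach_step[OF _ reach_fits[OF I(1)]])
      (use c(9) reach_fits[OF I(1)] I in \<open>auto simp: fits_def\<close>)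
  have 5: "reach Q W s (cost B l + B * (cost B a + cost B v + 4) + 3) ?s"
    by (rule reach_mono[OF reach_trans[OF I(1) 4]]) (use evs_Fill.hyps in auto)
  obtain \<rho>2 where 6: "reach Q W ?s (costs B cs) (s\<lparr>pc := p + len a + len v + 6 + sum_list (map slen cs), reg := \<rho>2, mem := m'\<rparr>)"
      "\<forall>i\<ge>r + widths cs. \<rho>2 i = \<rho>' i"
    using evs_Fill.IH[of ?s] c(10) reach_fits[OF 5] I(2) evs_Fill.prems(4)
    by (auto simp: same_off_def)
  show ?case using reach_trans[OF 5 6(1)] I(2) 6(2)
    by (intro exI[of _ \<rho>2]) (auto simp: same_off_def w_def p_def add_ac)
qed

text \<open>A run starts with all registers 0, so the reduction must erase its own before handing
  over.\<close>

lemma reach_clear: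
  assumes "code_at Q (pc s) (map (\<lambda>i. Const i 0) [0..<w])" "fits W s"
  shows "reach Q W s w (s\<lparr>pc := pc s + w, reg := \<lambda>i. if i < w then 0 else reg s i\<rparr>)"
  using assms
proof (induction w)
  case 0
  then show ?case using reach_refl[of W s Q 0] by simp
next
  case (Suc w)
  then have c: "code_at Q (pc s) (map (\<lambda>i. Const i 0) [0..<w])" "code_at Q (pc s + w) [Const w 0]"
    by (auto simp: code_at_append)
  let ?s = "s\<lparr>pc := pc s + w, reg := \<lambda>i. if i < w then 0 else reg s i\<rparr>"
  have 1: "reach Q W s w ?s" using Suc c by simp
  have "reach Q W ?s (Suc 0) (?s\<lparr>pc := Suc (pc ?s), reg := (reg ?s)(w := 0)\<rparr>)"
    by (rule reach_Const) (use c(2) reach_fits[OF 1] in auto)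
  also have "(reg ?s)(w := 0) = (\<lambda>i. if i < Suc w then 0 else reg s i)"
    by auto
  finally show ?case using reach_trans[OF 1, of "Suc 0"] by simp
qed

section \<open>Relocation and composition of programs\<close>

fun shift :: "nat \<Rightarrow> instr \<Rightarrow> instr" where
  "shift d (Jump q) = Jump (q + d)"
| "shift d (JumpLess i j q) = JumpLess i j (q + d)"
| "shift d i = i"

lemma exec_shift: "exec (shift d i) (s\<lparr>pc := pc s + d\<rparr>) = (exec i s)\<lparr>pc := pc (exec i s) + d\<rparr>"
  by (cases i) auto

lemma step_shift:
  assumes "length A = d"
  shows "step (A @ map (shift d) P) (s\<lparr>pc := pc s + d\<rparr>) = (step P s)\<lparr>pc := pc (step P s) + d\<rparr>"
proof (cases "halted P s")
  case True
  then show ?thesis using assms by (auto simp: step_def halted_def)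
next
  case False
  then have "(A @ map (shift d) P) ! (pc s + d) = shift d (P ! pc s)"
    using assms by (auto simp: nth_append halted_def)
  with False show ?thesis using assms exec_shift[of d "P ! pc s" s] by (auto simp: step_def halted_def)
qed

lemma steps_shift:
  assumes "length A = d"
  shows "(step (A @ map (shift d) P) ^^ t) (s\<lparr>pc := pc s + d\<rparr>) =
    ((step P ^^ t) s)\<lparr>pc := pc ((step P ^^ t) s) + d\<rparr>"
  by (induction t) (use step_shift[OF assms] in auto)

definition prepend :: "stm list \<Rightarrow> program \<Rightarrow> program" where
  "prepend cs P = (let A = codes cs 0 0 @ map (\<lambda>i. Const i 0) [0..<widths cs] in A @ map (shift (length A)) P)"

text \<open>After the reduction, memory and registers are exactly those of an initial configuration
  on \<open>ys\<close>; only the program counter is displaced. From there on each step commutes with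
  the displacement.\<close>

lemma answers_prepend:
  assumes ev: "evs W B cs 0 (\<lambda>_. 0) (mem (init xs)) (mem (init ys))"
    and W: "1 \<le> W" "B \<le> W" "W' \<le> W" "fits W (init xs)"
    and ans: "answers P W' T ys b"
  shows "answers (prepend cs P) W (real (costs B cs + widths cs) + T) xs b"
proof -
  define A where "A = codes cs 0 0 @ map (\<lambda>i. Const i 0) [0..<widths cs]"
  let ?Q = "prepend cs P" and ?d = "length A"
  have Q: "?Q = A @ map (shift ?d) P" unfolding prepend_def A_def Let_def ..
  have "code_at ?Q 0 A" unfolding code_at_def Q by auto
  then have c: "code_at ?Q 0 (codes cs 0 0)"
    "code_at ?Q (sum_list (map slen cs)) (map (\<lambda>i. Const i 0) [0..<widths cs])"
    unfolding A_def by (auto simp: code_at_append)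
  have [simp]: "pc (init xs) = 0" "reg (init xs) = (\<lambda>_. 0)" for xs by (auto simp: init_def)
  obtain \<rho> where 1: "reach ?Q W (init xs) (costs B cs)
      ((init xs)\<lparr>pc := sum_list (map slen cs), reg := \<rho>, mem := mem (init ys)\<rparr>)"
      "\<forall>i\<ge>widths cs. \<rho> i = 0"
    using evs_reach[OF ev W(1,2), of ?Q "init xs"] c(1) W(4) by auto
  have "(\<lambda>i. if i < widths cs then 0 else \<rho> i) = (\<lambda>_. 0)" using 1(2) by auto
  then have 2: "reach ?Q W ((init xs)\<lparr>pc := sum_list (map slen cs), reg := \<rho>, mem := mem (init ys)\<rparr>) (widths cs)
      ((init ys)\<lparr>pc := ?d\<rparr>)"
    using reach_clear[OF _ reach_fits[OF 1(1)], of ?Q "widths cs"] c(2)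
    by (simp add: A_def init_def cong: if_cong)
  obtain t1 where t1: "t1 \<le> costs B cs + widths cs" "(step ?Q ^^ t1) (init xs) = (init ys)\<lparr>pc := ?d\<rparr>"
      "\<forall>t'\<le>t1. fits W ((step ?Q ^^ t') (init xs))"
    using reach_trans[OF 1(1) 2] unfolding reach_def by auto
  obtain t2 where t2: "real t2 \<le> T" "halted P (run P ys t2)" "\<forall>t'\<le>t2. fits W' (run P ys t')"
      "reg (run P ys t2) 0 \<noteq> 0 \<longleftrightarrow> b"
    using ans unfolding answers_def by auto
  have later: "run ?Q xs (t + t1) = (run P ys t)\<lparr>pc := pc (run P ys t) + ?d\<rparr>" for t
    using steps_shift[where A = A and d = ?d and P = P and t = t and s = "init ys"] t1(2) by (simp add: run_def funpow_add Q)
  have fits_later: "fits W ((run P ys t)\<lparr>pc := p\<rparr>)" if "t \<le> t2" for t p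
    using t2(3) that W(3) unfolding fits_def by simp (meson of_nat_mono order_trans)
  show ?thesis unfolding answers_def
  proof (intro exI[of _ "t2 + t1"] conjI allI impI)
    show "real (t2 + t1) \<le> real (costs B cs + widths cs) + T" using t1(1) t2(1) by simp
    show "halted ?Q (run ?Q xs (t2 + t1))" using t2(2) unfolding later by (simp add: halted_def Q)
    show "(reg (run ?Q xs (t2 + t1)) 0 \<noteq> 0) = b" using t2(4) by (simp add: later)
    fix t assume t: "t \<le> t2 + t1"
    show "fits W (run ?Q xs t)"
    proof (cases "t \<le> t1")
      case True then show ?thesis using t1(3) by (simp add: run_def)
    next
      case False
      then have "run ?Q xs t = run ?Q xs ((t - t1) + t1)" by simp
      then show ?thesis using later fits_later t by (metis add.commute le_diff_conv)
    qed
  qed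
qed

section \<open>The adjacency matrix as an expression\<close>

lemma ev_Let': "ev W B a r \<rho> m x \<Longrightarrow> r' = Suc r \<Longrightarrow> ev W B b r' (\<rho>(r := x)) m y \<Longrightarrow> ev W B (Let_in a b) r \<rho> m y"
  by (auto intro: ev_Let)

text \<open>For expressions without \<open>Let_in\<close> and \<open>Fold\<close>, evaluation
  becomes a computation by simplification. The default 0 is harmless because
  \<open>simple_ok\<close> rejects the other constructors.\<close>

fun simple_val :: "exp \<Rightarrow> (nat \<Rightarrow> int) \<Rightarrow> (int \<Rightarrow> int) \<Rightarrow> int" where
  "simple_val (Num c) \<rho> m = c"
| "simple_val (Var i) \<rho> m = \<rho> i"
| "simple_val (Bin f a b) \<rho> m = apply_op f (simple_val a \<rho> m) (simple_val b \<rho> m)"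
| "simple_val (Nz a) \<rho> m = of_bool (simple_val a \<rho> m \<noteq> 0)"
| "simple_val (Ld a) \<rho> m = m (simple_val a \<rho> m)"
| "simple_val _ \<rho> m = 0"

fun simple_ok :: "nat \<Rightarrow> exp \<Rightarrow> nat \<Rightarrow> (nat \<Rightarrow> int) \<Rightarrow> (int \<Rightarrow> int) \<Rightarrow> bool" where
  "simple_ok W (Num c) r \<rho> m \<longleftrightarrow> \<bar>c\<bar> \<le> int W"
| "simple_ok W (Var i) r \<rho> m \<longleftrightarrow> i < r"
| "simple_ok W (Bin f a b) r \<rho> m \<longleftrightarrow> simple_ok W a r \<rho> m \<and> simple_ok W b r \<rho> m \<and> \<bar>apply_op f (simple_val a \<rho> m) (simple_val b \<rho> m)\<bar> \<le> int W"
| "simple_ok W (Nz a) r \<rho> m \<longleftrightarrow> simple_ok W a r \<rho> m"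
| "simple_ok W (Ld a) r \<rho> m \<longleftrightarrow> simple_ok W a r \<rho> m"
| "simple_ok W _ r \<rho> m \<longleftrightarrow> False"

text \<open>A right operand is evaluated one level higher, above the value of the left one; hence
  the induction allows any level from \<open>r0\<close> on and any contents of the registers
  above.\<close>

lemma ev_simple_val:
  assumes "simple_ok W e r0 \<rho> m" "r0 \<le> r" "\<And>i. i < r0 \<Longrightarrow> \<rho>' i = \<rho> i"
  shows "ev W B e r \<rho>' m (simple_val e \<rho> m)"
  using assms
proof (induction e arbitrary: r \<rho>')
  case (Bin f a b)
  have "ev W B b (Suc r) (\<rho>'(r := simple_val a \<rho> m)) m (simple_val b \<rho> m)"
    using Bin.prems by (intro Bin.IH(2)) auto
  then show ?case using Bin by (intro ev_Bin[where x = "simple_val a \<rho> m" and y = "simple_val b \<rho> m"]) auto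
next
  case (Nz a)
  then show ?case by (intro ev_Nz[where x = "simple_val a \<rho> m"]) auto
qed (auto intro: ev.intros)

lemma ev_simple: "simple_ok W e r \<rho> m \<Longrightarrow> simple_val e \<rho> m = y \<Longrightarrow> ev W B e r \<rho> m y"
  using ev_simple_val[of W e r \<rho> m r \<rho> B] by simp

section \<open>Comparison, powers, sums and digits\<close>

definition eq_exp :: "exp \<Rightarrow> exp \<Rightarrow> exp" where
  "eq_exp a b = Bin Sub (Num 1) (Nz (Bin Sub a b))"

lemma ev_eq_exp:
  assumes "ev W B a (Suc r) (\<rho>(r := 1)) m x" "ev W B b (r + 2) (\<rho>(r := 1, Suc r := x)) m y" "\<bar>x - y\<bar> \<le> int W" "1 \<le> W"
  shows "ev W B (eq_exp a b) r \<rho> m (of_bool (x = y))"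
  unfolding eq_exp_def
proof (rule ev_Bin)
  show "ev W B (Num 1) r \<rho> m 1" using assms(4) by (intro ev_Num) simp
  have "ev W B (Bin Sub a b) (Suc r) (\<rho>(r := 1)) m (x - y)"
    using assms by (intro ev_Bin[where x = x and y = y]) auto
  then show "ev W B (Nz (Bin Sub a b)) (Suc r) (\<rho>(r := 1)) m (of_bool (x \<noteq> y))"
    by (rule ev_Nz) auto
qed (use assms in auto)

text \<open>The parameter \<open>s\<close> is the level at which the expression will run; it is
  fixed in advance because the body refers to the accumulator by its register.\<close>

definition power_exp :: "nat \<Rightarrow> nat \<Rightarrow> exp \<Rightarrow> exp" where
  "power_exp s i e = Fold (Num 1) e (Bin Mul (Var s) (Var i))"

lemma ev_power_exp:
  assumes "s = r" "i < r" "\<rho> i = int b" "ev W B e (Suc r) (\<rho>(r := 1)) m (int l)" "l \<le> B" "b ^ l \<le> W" "1 \<le> b"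
  shows "ev W B (power_exp s i e) r \<rho> m (int (b ^ l))"
  unfolding power_exp_def
proof (rule ev_Fold[where g = "\<lambda>i. int (b ^ i)"])
  have "1 \<le> b ^ l" using assms(7) by simp
  then have "1 \<le> W" using assms(6) by linarith
  then show "ev W B (Num 1) r \<rho> m (int (b ^ 0))" by (simp add: ev_Num)
  show "ev W B e (Suc r) (\<rho>(r := int (b ^ 0))) m (int l)" using assms(4) by simp
  fix t assume t: "t < l"
  have "b ^ Suc t \<le> b ^ l" using t assms(7) by (intro power_increasing) auto
  then have "b ^ Suc t \<le> W" using assms(6) by simp
  then have "int b ^ Suc t \<le> int W" by (metis of_nat_le_iff of_nat_power)
  then show "ev W B (Bin Mul (Var s) (Var i)) (r + 3) (\<rho>(r := int (b ^ t), r + 1 := int l, r + 2 := int t)) m (int (b ^ Suc t))"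
    by (intro ev_simple) (use assms(1-3) in \<open>auto simp: mult.commute\<close>)
qed (use assms in auto)

text \<open>The index of summation is \<open>Var (s + 2)\<close>, and the summand runs at level
  \<open>s + 4\<close>, above a copy of the accumulator.\<close>

definition sum_exp :: "nat \<Rightarrow> exp \<Rightarrow> exp \<Rightarrow> exp" where
  "sum_exp s b c = Fold (Num 0) b (Bin Add (Var s) c)"

lemma ev_sum_exp:
  fixes g :: "nat \<Rightarrow> int"
  assumes "s = r" "ev W B b (Suc r) (\<rho>(r := 0)) m (int l)" "l \<le> B"
    and c: "\<And>y i. i < l \<Longrightarrow> ev W B c (r + 4) (\<rho>(r := y, Suc r := int l, r + 2 := int i, r + 3 := y)) m (g i)"
    and g: "\<And>i. i < l \<Longrightarrow> 0 \<le> g i" "(\<Sum>i<l. g i) \<le> int W"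
  shows "ev W B (sum_exp s b c) r \<rho> m (\<Sum>i<l. g i)"
  unfolding sum_exp_def
proof (rule ev_Fold[where g = "\<lambda>i. \<Sum>t<i. g t"])
  show "ev W B (Num 0) r \<rho> m (\<Sum>t<0. g t)" by (simp add: ev_Num)
  show "ev W B b (Suc r) (\<rho>(r := \<Sum>t<0. g t)) m (int l)" using assms(2) by simp
  fix i assume i: "i < l"
  have "(\<Sum>t<Suc i. g t) \<le> (\<Sum>t<l. g t)" using i g(1) by (intro sum_mono2) auto
  moreover have "0 \<le> (\<Sum>t<Suc i. g t)" using i g(1) by (intro sum_nonneg) auto
  ultimately have "\<bar>\<Sum>t<Suc i. g t\<bar> \<le> int W" using g(2) by linarith
  moreover have "ev W B c (Suc (r + 3)) (\<rho>(r := \<Sum>t<i. g t, r + 1 := int l, r + 2 := int i, r + 3 := \<Sum>t<i. g t)) m (g i)"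
    using c[OF i, of "\<Sum>t<i. g t"] by (simp add: numeral_eq_Suc)
  ultimately show "ev W B (Bin Add (Var s) c) (r + 3) (\<rho>(r := \<Sum>t<i. g t, r + 1 := int l, r + 2 := int i)) m (\<Sum>t<Suc i. g t)"
    by (intro ev_Bin[where x = "\<Sum>t<i. g t" and y = "g i"] ev_Var) (use assms(1) in auto)
qed (use assms in auto)

definition digit_exp :: "nat \<Rightarrow> nat \<Rightarrow> nat \<Rightarrow> exp \<Rightarrow> exp" where
  "digit_exp s b v e = Bin Mod (Bin Div (Var v) (power_exp (Suc s) b e)) (Var b)"

lemma ev_digit_exp:
  assumes "s = r" "b < r" "v < r" "\<rho> b = int P" "\<rho> v = int x"
    and e: "ev W B e (r + 2) (\<rho>(r := int x, Suc r := 1)) m (int p)"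
    and bd: "p \<le> B" "P ^ p \<le> W" "1 \<le> P" "x \<le> W"
  shows "ev W B (digit_exp s b v e) r \<rho> m (int (digit P x p))"
  unfolding digit_exp_def
proof (rule ev_Bin)
  have "ev W B (power_exp (Suc s) b e) (Suc r) (\<rho>(r := int x)) m (int (P ^ p))"
    by (rule ev_power_exp) (use assms in auto)
  moreover have xd: "x div P ^ p \<le> W" using bd(4) div_le_dividend[of x "P ^ p"] by linarith
  moreover have "\<bar>int x div int P ^ p\<bar> \<le> int W" using xd by (metis abs_of_nat of_nat_le_iff of_nat_power zdiv_int)
  ultimately show "ev W B (Bin Div (Var v) (power_exp (Suc s) b e)) r \<rho> m (int (x div P ^ p))"
    by (intro ev_Bin[where x = "int x" and y = "int (P ^ p)"] ev_Var) (use assms in \<open>auto simp: zdiv_int\<close>)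
  show "ev W B (Var b) (Suc r) (\<rho>(r := int (x div P ^ p))) m (int P)"
    by (rule ev_Var) (use assms in auto)
  show "apply_op Mod (int (x div P ^ p)) (int P) = int (digit P x p)" by (simp add: digit_def zmod_int)
  have "digit P x p \<le> x" unfolding digit_def by (meson div_le_dividend le_trans mod_less_eq_dividend)
  then show "\<bar>int (digit P x p)\<bar> \<le> int W" using bd(4) by simp
qed

text \<open>
  Register allocation: 0 to 5 hold \<open>n\<close>, \<open>q\<close>, \<open>P\<close>, \<open>q ^ k\<close>, \<open>L\<close> and \<open>M = P ^ L\<close>; 6 to 8 hold the bound,
  the counter and the address of the current loop over memory cells; 9 to 13 hold \<open>e\<close>, \<open>i\<close>, \<open>j\<close>,
  \<open>x j i\<close> and the residue of \<open>i\<close> that determines its colour; the tuple \<open>a\<close> of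
  colours runs in 17. Cell \<open>t\<close> of the input has been moved to address \<open>- 1 - t\<close>. For \<open>n = 0\<close> the
  missing entries are replaced by 1, so that there is no solution.
\<close>

definition inner_exp :: "nat \<Rightarrow> exp" where
  "inner_exp k =
     Let_in (Bin Add (Bin Add (Num 1) (Var 1)) (Bin Mul (Var 17) (Num (int k + 1))))
     (Let_in (digit_exp 21 2 9 (Var 20))
     (Let_in (digit_exp 22 2 9 (Bin Add (Var 20) (Bin Add (Num 1) (Var 11))))
     (Let_in (sum_exp 23 (Num (int k)) (digit_exp 27 2 9 (Bin Add (Var 20) (Bin Add (Num 1) (Var 25)))))
     (Bin Add (Nz (Bin Sub (Bin Mod (Var 12) (Var 21)) (Var 22)))
              (Bin Sub (Num 1) (Nz (Bin Mod (Var 23) (Var 21))))))))"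

text \<open>Disjunctions and bounded existential quantifiers become sums of nonnegative terms,
  conjunctions become products, and \<open>Nz\<close> reads off the truth value.\<close>

definition cover_exp :: "nat \<Rightarrow> exp" where
  "cover_exp k = Nz (Bin Add
     (Bin Sub (Num 1) (Nz (sum_exp 15 (Var 1) (eq_exp (digit_exp 20 2 9 (Bin Add (Num 1) (Var 17))) (Var 13)))))
     (sum_exp 15 (Var 3) (Bin Mul (eq_exp (digit_exp 20 2 9 (Bin Add (Num 1) (digit_exp 23 1 17 (Var 11)))) (Var 13)) (inner_exp k))))"

text \<open>The position \<open>Var 7\<close> in the matrix has the base \<open>M\<close> digits
  \<open>e\<close>, \<open>i\<close> and finally \<open>j\<close>. Element \<open>i mod n\<close> of
  set \<open>j\<close> is input cell \<open>1 + j * n + i mod n\<close>, moved to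
  \<open>- 2 - j * n - i mod n\<close>; the term with \<open>Nz (Var 0)\<close> supplies the 1 for
  \<open>n = 0\<close>.\<close>

definition bit_exp :: "nat \<Rightarrow> exp" where
  "bit_exp k =
     Let_in (Bin Mod (Var 7) (Var 5))
     (Let_in (Bin Mod (Bin Div (Var 7) (Var 5)) (Var 5))
     (Let_in (Bin Div (Bin Div (Var 7) (Var 5)) (Var 5))
     (Let_in (Bin Add (Ld (Bin Sub (Bin Sub (Num (- 2)) (Bin Mul (Var 11) (Var 0))) (Bin Mod (Var 10) (Var 0))))
                      (Bin Sub (Num 1) (Nz (Var 0))))
     (Let_in (Bin Mod (Var 10) (digit_exp 14 2 9 (Num 0)))
     (cover_exp k)))))"

locale ram_gadget = gadget +
  fixes W B X :: nat
  assumes q: "2 \<le> q" and k: "1 \<le> k" and P: "P = q ^ (2 * k)"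
    and B: "(k + 4) * (M + 2) ^ 2 \<le> B" and W: "B + X \<le> W" and X: "1 \<le> X" "\<And>j i. \<bar>x j i\<bar> \<le> int X"
begin

lemma P2: "2 \<le> P"
proof -
  have "q ^ 1 \<le> q ^ (2 * k)" using q k by (intro power_increasing) auto
  then show ?thesis using q P by simp
qed

lemma power_le_M: "p \<le> ndigits \<Longrightarrow> P ^ p \<le> M"
  unfolding M_def using P2 by (intro power_increasing) auto

lemma parameters_le_M: "P \<le> M" "q \<le> M" "q ^ k \<le> M" "ndigits \<le> M" "2 \<le> M"
proof -
  show 1: "P \<le> M" using power_le_M[of 1] by (simp add: ndigits_def)
  have "q ^ 1 \<le> q ^ (2 * k)" using q k by (intro power_increasing) auto
  then show "q \<le> M" using 1 P by simp
  have "q ^ k \<le> q ^ (2 * k)" using q by (intro power_increasing) auto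
  then show "q ^ k \<le> M" using 1 P by simp
  have "2 ^ ndigits \<le> M" unfolding M_def using P2 by (intro power_mono) auto
  then show "ndigits \<le> M" using less_exp[of ndigits] by linarith
  show "2 \<le> M" using 1 P2 by simp
qed

lemma B_ge: "k * M * M + 4 * (k * M) + 4 * M + 4 * k + 16 \<le> B" "M \<le> B" "k \<le> B"
  using B by (simp_all add: power2_eq_square algebra_simps)

lemma W_ge: "M \<le> W" "1 \<le> W" "B \<le> W" "3 * M + X + 10 \<le> W" "3 * M + 10 \<le> W"
  using B_ge W X parameters_le_M(5) by simp_all

lemma block_le: "a < q ^ k \<Longrightarrow> block a + k + 1 \<le> ndigits"
proof -
  assume "a < q ^ k"
  then have "(a + 1) * (k + 1) \<le> q ^ k * (k + 1)" by (intro mult_right_mono) auto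
  then show ?thesis by (simp add: block_def ndigits_def algebra_simps)
qed

lemma ev_digit:
  assumes "s = r" "2 < r" "9 < r" "\<rho> 2 = int P" "\<rho> 9 = int e" "e < M"
    and "ev W B pos (r + 2) (\<rho>(r := int e, Suc r := 1)) m (int p)" and p: "p \<le> ndigits"
  shows "ev W B (digit_exp s 2 9 pos) r \<rho> m (int (digit P e p))"
proof (rule ev_digit_exp)
  show "p \<le> B" using p parameters_le_M(4) B_ge(2) by linarith
  show "P ^ p \<le> W" using power_le_M[OF p] W_ge(1) by linarith
  show "e \<le> W" using assms(6) W_ge(1) by linarith
  show "1 \<le> P" using P2 by simp
qed (use assms in auto)

lemma ev_inner_exp:
  assumes r: "\<rho> 1 = int q" "\<rho> 2 = int P" "\<rho> 9 = int e" "\<rho> 11 = int j" "\<rho> 12 = x j i" "\<rho> 17 = int a"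
    and b: "j < k" "a < q ^ k" "e < M"
  defines "\<mu> \<equiv> digit P e (block a)" and "v \<equiv> \<lambda>r. digit P e (block a + 1 + r)"
  shows "ev W B (inner_exp k) 20 \<rho> m
    (of_bool (x j i mod int \<mu> \<noteq> int (v j)) + of_bool ((\<Sum>r<k. v r) mod \<mu> = 0))"
  unfolding inner_exp_def
proof -
  note bl = block_le[OF b(2)]
  have blM: "block a + k + 1 \<le> M" using bl parameters_le_M(4) by simp
  have "a * (k + 1) \<le> block a" by (simp add: block_def)
  then have bl2: "a * (k + 1) \<le> W" using blM W_ge by linarith
  have kW: "k + 1 \<le> W" using blM W_ge by linarith
  have 1: "ev W B (Bin Add (Bin Add (Num 1) (Var 1)) (Bin Mul (Var 17) (Num (int k + 1)))) 20 \<rho> m (int (block a))"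
    by (rule ev_simple)
      (use r blM W_ge parameters_le_M bl2 kW in \<open>auto simp: block_def algebra_simps simp flip: of_nat_mult of_nat_add of_nat_Suc\<close>)
  let ?\<rho>1 = "\<rho>(20 := int (block a))"
  have 2: "ev W B (digit_exp 21 2 9 (Var 20)) 21 ?\<rho>1 m (int \<mu>)"
    unfolding \<mu>_def by (rule ev_digit, simp_all add: r b, rule ev_Var) (use bl in auto)
  let ?\<rho>2 = "?\<rho>1(21 := int \<mu>)"
  have 3: "ev W B (digit_exp 22 2 9 (Bin Add (Var 20) (Bin Add (Num 1) (Var 11)))) 22 ?\<rho>2 m (int (v j))"
    unfolding v_def
    by (rule ev_digit, simp_all add: r b, rule ev_simple) (use bl b blM r W_ge in auto)
  let ?\<rho>3 = "?\<rho>2(22 := int (v j))"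
  have vP: "v r < P" for r unfolding v_def using P2 by (simp add: digit_less)
  have muP: "\<mu> < P" unfolding \<mu>_def using P2 by (simp add: digit_less)
  have "v r \<le> M" for r using vP[of r] parameters_le_M(1) by simp
  then have "(\<Sum>r<k. v r) \<le> k * M" using sum_bounded_above[of "{..<k}" v M] by simp
  then have sumW: "(\<Sum>r<k. int (v r)) \<le> int W" using B_ge(1) W by (simp flip: of_nat_sum)
  have 4: "ev W B (sum_exp 23 (Num (int k)) (digit_exp 27 2 9 (Bin Add (Var 20) (Bin Add (Num 1) (Var 25))))) 23 ?\<rho>3 m (\<Sum>r<k. int (v r))"
  proof (rule ev_sum_exp)
    show "ev W B (Num (int k)) (Suc 23) (?\<rho>3(23 := 0)) m (int k)" by (rule ev_Num) (use kW in auto)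
    fix y t assume t: "t < k"
    show "ev W B (digit_exp 27 2 9 (Bin Add (Var 20) (Bin Add (Num 1) (Var 25)))) (23 + 4)
         (?\<rho>3(23 := y, Suc 23 := int k, 23 + 2 := int t, 23 + 3 := y)) m (int (v t))"
      unfolding v_def
      by (rule ev_digit, simp_all add: r b, rule ev_simple) (use bl t blM r W_ge in auto)
  qed (use B_ge sumW in auto)
  let ?\<rho>4 = "?\<rho>3(23 := \<Sum>r<k. int (v r))"
  \<comment> \<open>For modulus 0 the residue is \<open>x j i\<close> itself, bounded only by
    \<open>X\<close>.\<close>
  have xm: "\<bar>x j i mod int \<mu>\<bar> \<le> int X + int P"
  proof (cases "\<mu> = 0")
    case False
    then have "0 \<le> x j i mod int \<mu>" "x j i mod int \<mu> < int \<mu>" by auto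
    then show ?thesis using muP by linarith
  qed (use X(2)[of j i] in auto)
  then have xm1: "\<bar>x j i mod int \<mu>\<bar> \<le> int W" using W_ge parameters_le_M(1) by linarith
  have xm2: "\<bar>x j i mod int \<mu> - int (v j)\<bar> \<le> int W" using xm vP[of j] W_ge parameters_le_M(1) by linarith
  have s: "(\<Sum>r<k. int (v r)) mod int \<mu> = int ((\<Sum>r<k. v r) mod \<mu>)" by (simp add: zmod_int)
  have "(\<Sum>r<k. v r) \<le> W" using sumW by (simp flip: of_nat_sum)
  then have "(\<Sum>r<k. v r) mod \<mu> \<le> W" using mod_less_eq_dividend le_trans by blast
  then have s2: "\<bar>(\<Sum>r<k. int (v r)) mod int \<mu>\<bar> \<le> int W" unfolding s by simp
  have 5: "ev W B (Bin Add (Nz (Bin Sub (Bin Mod (Var 12) (Var 21)) (Var 22)))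
              (Bin Sub (Num 1) (Nz (Bin Mod (Var 23) (Var 21))))) 24 ?\<rho>4 m
        (of_bool (x j i mod int \<mu> \<noteq> int (v j)) + of_bool ((\<Sum>r<k. v r) mod \<mu> = 0))"
    by (rule ev_simple) (use xm1 xm2 s2 s r W_ge in auto)
  show "ev W B (Let_in (Bin Add (Bin Add (Num 1) (Var 1)) (Bin Mul (Var 17) (Num (int k + 1))))
     (Let_in (digit_exp 21 2 9 (Var 20))
     (Let_in (digit_exp 22 2 9 (Bin Add (Var 20) (Bin Add (Num 1) (Var 11))))
     (Let_in (sum_exp 23 (Num (int k)) (digit_exp 27 2 9 (Bin Add (Var 20) (Bin Add (Num 1) (Var 25)))))
     (Bin Add (Nz (Bin Sub (Bin Mod (Var 12) (Var 21)) (Var 22)))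
              (Bin Sub (Num 1) (Nz (Bin Mod (Var 23) (Var 21))))))))) 20 \<rho> m
     (of_bool (x j i mod int \<mu> \<noteq> int (v j)) + of_bool ((\<Sum>r<k. v r) mod \<mu> = 0))"
    by (rule ev_Let'[OF 1 _ ev_Let'[OF 2 _ ev_Let'[OF 3 _ ev_Let'[OF 4 _ 5]]]]) auto
qed


lemma ev_cover_exp:
  assumes r: "\<rho> 1 = int q" "\<rho> 2 = int P" "\<rho> 3 = int (q ^ k)" "\<rho> 9 = int e" "\<rho> 11 = int j" "\<rho> 12 = x j i"
      "\<rho> 13 = int (i mod digit P e 0)"
    and b: "j < k" "i < M" "e < M"
  shows "ev W B (cover_exp k) 14 \<rho> m (of_bool (adj j i e))"
  unfolding cover_exp_def
proof (rule ev_Nz)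
  let ?c = "\<lambda>c. of_bool (int (digit P e (1 + c)) = int (i mod digit P e 0)) :: int"
  let ?t = "\<lambda>a. of_bool (x j i mod int (digit P e (block a)) \<noteq> int (digit P e (block a + 1 + j))) +
      of_bool ((\<Sum>r<k. digit P e (block a + 1 + r)) mod digit P e (block a) = 0) :: int"
  let ?a = "\<lambda>a. of_bool (int (digit P e (1 + digit q a j)) = int (i mod digit P e 0)) * ?t a"
  have imod: "i mod digit P e 0 \<le> M" using b(2) by (meson le_trans less_imp_le mod_less_eq_dividend)
  have digM: "digit P e p \<le> M" for p using digit_less[of P e p] P2 parameters_le_M(1) by simp
  have diff: "\<bar>int (digit P e p) - int (i mod digit P e 0)\<bar> \<le> int W" for p
    using imod digM[of p] W_ge(1) by linarith
  have qW: "q + 1 \<le> ndigits" by (simp add: ndigits_def)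
  then have qW': "q + 1 \<le> W" using parameters_le_M(4) W_ge by linarith
  have 1: "ev W B (sum_exp 15 (Var 1) (eq_exp (digit_exp 20 2 9 (Bin Add (Num 1) (Var 17))) (Var 13))) 15 (\<rho>(14 := 1)) m (\<Sum>c<q. ?c c)"
  proof (rule ev_sum_exp)
    show "ev W B (Var 1) (Suc 15) (\<rho>(14 := 1, 15 := 0)) m (int q)" by (rule ev_Var) (use r in auto)
    show "q \<le> B" using parameters_le_M(2) B_ge by linarith
    have "(\<Sum>c<q. ?c c) \<le> (\<Sum>c<q. 1)" by (intro sum_mono) auto
    then show "(\<Sum>c<q. ?c c) \<le> int W" using qW' by simp
    fix y t assume t: "t < q"
    show "ev W B (eq_exp (digit_exp 20 2 9 (Bin Add (Num 1) (Var 17))) (Var 13)) (15 + 4)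
        (\<rho>(14 := 1, 15 := y, Suc 15 := int q, 15 + 2 := int t, 15 + 3 := y)) m (?c t)"
    proof (rule ev_eq_exp)
      show "ev W B (digit_exp 20 2 9 (Bin Add (Num 1) (Var 17))) (Suc (15 + 4))
        ((\<rho>(14 := 1, 15 := y, Suc 15 := int q, 15 + 2 := int t, 15 + 3 := y))(15 + 4 := 1)) m (int (digit P e (1 + t)))"
        by (rule ev_digit, simp_all add: r b, rule ev_simple) (use qW qW' t W_ge in auto)
    qed (use diff W_ge r in \<open>auto intro!: ev_Var\<close>)
  qed auto
  let ?d = "of_bool ((\<Sum>c<q. ?c c) \<noteq> 0) :: int"
  have 2: "ev W B (Bin Sub (Num 1) (Nz (sum_exp 15 (Var 1) (eq_exp (digit_exp 20 2 9 (Bin Add (Num 1) (Var 17))) (Var 13))))) 14 \<rho> m (1 - ?d)"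
  proof (rule ev_Bin)
    show "ev W B (Nz (sum_exp 15 (Var 1) (eq_exp (digit_exp 20 2 9 (Bin Add (Num 1) (Var 17))) (Var 13)))) (Suc 14) (\<rho>(14 := 1)) m ?d"
      using ev_Nz[OF 1 refl] by simp
  qed (use W_ge in \<open>auto intro!: ev_Num\<close>)
  let ?\<rho> = "\<rho>(14 := 1 - ?d)"
  have sumW: "(\<Sum>a<q ^ k. ?a a) \<le> int W"
  proof -
    have "(\<Sum>a<q ^ k. ?a a) \<le> (\<Sum>a<q ^ k. 2)" by (intro sum_mono) auto
    also have "\<dots> = 2 * int (q ^ k)" by simp
    also have "\<dots> \<le> int W" using parameters_le_M(3) W_ge(5) by linarith
    finally show ?thesis .
  qed
  have 3: "ev W B (sum_exp 15 (Var 3) (Bin Mul (eq_exp (digit_exp 20 2 9 (Bin Add (Num 1) (digit_exp 23 1 17 (Var 11)))) (Var 13)) (inner_exp k)))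
      15 ?\<rho> m (\<Sum>a<q ^ k. ?a a)"
  proof (rule ev_sum_exp)
    show "ev W B (Var 3) (Suc 15) (?\<rho>(15 := 0)) m (int (q ^ k))" by (rule ev_Var) (use r in auto)
    show "q ^ k \<le> B" using parameters_le_M(3) B_ge by linarith
    fix y t assume t: "t < q ^ k"
    let ?\<rho>1 = "?\<rho>(15 := y, Suc 15 := int (q ^ k), 15 + 2 := int t, 15 + 3 := y)"
    show "ev W B (Bin Mul (eq_exp (digit_exp 20 2 9 (Bin Add (Num 1) (digit_exp 23 1 17 (Var 11)))) (Var 13)) (inner_exp k)) (15 + 4) ?\<rho>1 m (?a t)"
    proof (rule ev_Bin)
      have dq: "digit q t j < q" using q by (intro digit_less) simp
      have "q ^ j \<le> q ^ k" using b(1) q by (intro power_increasing) auto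
      then have qj: "q ^ j \<le> W" using parameters_le_M(3) W_ge(1) by linarith
      have jk: "j \<le> B" using b(1) B_ge(3) by linarith
      have tW: "t \<le> W" using t parameters_le_M(3) W_ge(1) by linarith
      show "ev W B (eq_exp (digit_exp 20 2 9 (Bin Add (Num 1) (digit_exp 23 1 17 (Var 11)))) (Var 13)) (15 + 4) ?\<rho>1 m
          (of_bool (int (digit P e (1 + digit q t j)) = int (i mod digit P e 0)))"
      proof (rule ev_eq_exp)
        show "ev W B (digit_exp 20 2 9 (Bin Add (Num 1) (digit_exp 23 1 17 (Var 11)))) (Suc (15 + 4)) (?\<rho>1(15 + 4 := 1)) m
          (int (digit P e (1 + digit q t j)))"
        proof (rule ev_digit)
          show "ev W B (Bin Add (Num 1) (digit_exp 23 1 17 (Var 11))) (Suc (15 + 4) + 2)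
              (?\<rho>1(15 + 4 := 1, Suc (15 + 4) := int e, Suc (Suc (15 + 4)) := 1)) m (int (1 + digit q t j))"
          proof (rule ev_Bin)
            show "ev W B (digit_exp 23 1 17 (Var 11)) (Suc (Suc (15 + 4) + 2))
                ((?\<rho>1(15 + 4 := 1, Suc (15 + 4) := int e, Suc (Suc (15 + 4)) := 1))(Suc (15 + 4) + 2 := 1)) m
                (int (digit q t j))"
              by (rule ev_digit_exp) (use r qj jk q tW in \<open>auto intro!: ev_Var\<close>)
          qed (use dq qW' W_ge in \<open>auto intro!: ev_Num\<close>)
        qed (use r b dq qW in auto)
      qed (use diff W_ge r in \<open>auto intro!: ev_Var\<close>)
      show "ev W B (inner_exp k) (Suc (15 + 4))
          (?\<rho>1(15 + 4 := of_bool (int (digit P e (1 + digit q t j)) = int (i mod digit P e 0)))) m (?t t)"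
      proof -
        have "Suc (15 + 4) = 20" by simp
        then show ?thesis by (simp only:) (rule ev_inner_exp, use r b t in auto)
      qed
      have "\<bar>?a t\<bar> \<le> 2" by auto
      then show "\<bar>?a t\<bar> \<le> int W" using W_ge(5) by linarith
    qed auto
  qed (use sumW in auto)
  let ?S = "\<Sum>a<q ^ k. ?a a"
  have S0: "0 \<le> ?S" by (intro sum_nonneg) auto
  have "q ^ k \<le> M" by (rule parameters_le_M(3))
  have SW: "\<bar>1 - ?d + ?S\<bar> \<le> int W"
  proof -
    have "?S \<le> (\<Sum>a<q ^ k. 2)" by (intro sum_mono) auto
    also have "\<dots> = 2 * int (q ^ k)" by simp
    finally have "?S \<le> 2 * int M" using parameters_le_M(3) by linarith
    moreover have "0 \<le> 1 - ?d" "1 - ?d \<le> 1" by auto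
    ultimately show ?thesis using S0 W_ge(5) by linarith
  qed
  show "ev W B (Bin Add (Bin Sub (Num 1) (Nz (sum_exp 15 (Var 1) (eq_exp (digit_exp 20 2 9 (Bin Add (Num 1) (Var 17))) (Var 13)))))
     (sum_exp 15 (Var 3) (Bin Mul (eq_exp (digit_exp 20 2 9 (Bin Add (Num 1) (digit_exp 23 1 17 (Var 11)))) (Var 13)) (inner_exp k)))) 14 \<rho> m
     (1 - ?d + ?S)"
  proof (rule ev_Bin[OF 2])
    show "ev W B (sum_exp 15 (Var 3) (Bin Mul (eq_exp (digit_exp 20 2 9 (Bin Add (Num 1) (digit_exp 23 1 17 (Var 11)))) (Var 13)) (inner_exp k)))
      (Suc 14) ?\<rho> m ?S" using 3 by simp
  qed (use SW in auto)
  have d: "?d = of_bool (\<exists>c<q. digit P e (1 + c) = i mod digit P e 0)"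
    by (auto simp: sum_nonneg_eq_0_iff)
  have "?S = 0 \<longleftrightarrow> (\<forall>a\<in>{..<q ^ k}. ?a a = 0)"
    by (intro sum_nonneg_eq_0_iff) auto
  also have "\<dots> \<longleftrightarrow> \<not> (\<exists>a<q ^ k. digit P e (1 + digit q a j) = i mod digit P e 0 \<and> separated j i e a)"
    by (auto simp: separated_def add_eq_0_iff)
  finally have "?S \<noteq> 0 \<longleftrightarrow> (\<exists>a<q ^ k. digit P e (1 + digit q a j) = i mod digit P e 0 \<and> separated j i e a)" by blast
  then have "1 - ?d + ?S \<noteq> 0 \<longleftrightarrow> adj j i e"
    unfolding adj_def d using S0 by (auto simp: of_bool_def)
  then show "of_bool (adj j i e) = (of_bool (1 - ?d + ?S \<noteq> 0) :: int)" by simp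
qed

lemma ev_bit_exp:
  assumes r: "\<rho> 0 = int n" "\<rho> 1 = int q" "\<rho> 2 = int P" "\<rho> 3 = int (q ^ k)" "\<rho> 5 = int M" "\<rho> 7 = int l"
    and l: "l < k * M * M" and n: "n \<le> M"
    and m: "\<And>j i. j < k \<Longrightarrow> i < M \<Longrightarrow> m (- 2 - int j * int n - int (i mod n)) + of_bool (n = 0) = x j i"
      "\<And>a. \<bar>m a\<bar> \<le> int X"
  shows "ev W B (bit_exp k) 9 \<rho> m (of_bool (adj (l div M div M) (l div M mod M) (l mod M)))"
proof -
  define e where "e = l mod M"
  define i where "i = l div M mod M"
  define j where "j = l div M div M"
  have M0: "0 < M" using parameters_le_M(5) by simp
  have e: "e < M" and i: "i < M" using M0 by (simp_all add: e_def i_def)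
  have j: "j < k" unfolding j_def using l by (simp add: less_mult_imp_div_less)
  have lW: "l \<le> W" using l B_ge(1) W by linarith
  have lM: "l div M \<le> W" using lW div_le_dividend le_trans by blast
  have jn: "j * n \<le> k * M" using j n by (intro mult_mono) auto
  have dig0: "digit P e 0 < P" using P2 by (intro digit_less) simp
  have 1: "ev W B (Bin Mod (Var 7) (Var 5)) 9 \<rho> m (int e)"
    by (rule ev_simple) (use r W_ge e in \<open>auto simp: e_def zmod_int[symmetric]\<close>)
  let ?\<rho>1 = "\<rho>(9 := int e)"
  have 2: "ev W B (Bin Mod (Bin Div (Var 7) (Var 5)) (Var 5)) 10 ?\<rho>1 m (int i)"
    by (rule ev_simple) (use r W_ge i lM in \<open>auto simp: i_def zmod_int[symmetric] zdiv_int[symmetric]\<close>)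
  let ?\<rho>2 = "?\<rho>1(10 := int i)"
  have 3: "ev W B (Bin Div (Bin Div (Var 7) (Var 5)) (Var 5)) 11 ?\<rho>2 m (int j)"
    by (rule ev_simple) (use r W_ge j lM B_ge(3) in \<open>auto simp: j_def zmod_int[symmetric] zdiv_int[symmetric]\<close>)
  let ?\<rho>3 = "?\<rho>2(11 := int j)"
  have jnW: "int j * int n + int M + 2 \<le> int W"
  proof -
    have "j * n + M + 2 \<le> W"
    proof -
      have "k * M * 1 \<le> k * M * M" using M0 by (intro mult_left_mono) auto
      then show ?thesis using jn B_ge(1) W M0 by linarith
    qed
    then show ?thesis by (metis of_nat_add of_nat_le_iff of_nat_mult of_nat_numeral)
  qed
  have in0: "int i mod int n \<ge> 0" "int i mod int n \<le> int M"
    using i by (auto simp: zmod_int[symmetric]) (meson le_trans less_imp_le mod_less_eq_dividend)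
  have jn0: "0 \<le> int j * int n" by simp
  have mval: "m (- 2 - int j * int n - int i mod int n) + of_bool (n = 0) = x j i"
    using m(1)[OF j i] by (simp add: zmod_int)
  have 4: "ev W B (Bin Add (Ld (Bin Sub (Bin Sub (Num (- 2)) (Bin Mul (Var 11) (Var 0))) (Bin Mod (Var 10) (Var 0))))
                      (Bin Sub (Num 1) (Nz (Var 0)))) 12 ?\<rho>3 m (x j i)"
  proof (rule ev_simple)
    have "\<bar>int j * int n\<bar> \<le> int W" "\<bar>- 2 - int j * int n\<bar> \<le> int W" "\<bar>int i mod int n\<bar> \<le> int W"
       "\<bar>- 2 - int j * int n - int i mod int n\<bar> \<le> int W" using jnW in0 jn0 by linarith+
    moreover have "\<bar>m (- 2 - int j * int n - int i mod int n) + (1 - of_bool (n \<noteq> 0))\<bar> \<le> int W"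
      using m(2)[of "- 2 - int j * int n - int i mod int n"] W_ge(4) by (cases "n = 0") auto
    ultimately show "simple_ok W (Bin Add (Ld (Bin Sub (Bin Sub (Num (- 2)) (Bin Mul (Var 11) (Var 0))) (Bin Mod (Var 10) (Var 0))))
                      (Bin Sub (Num 1) (Nz (Var 0)))) 12 ?\<rho>3 m"
      using r W_ge by simp
  qed (use r mval in \<open>auto split: if_splits\<close>)
  let ?\<rho>4 = "?\<rho>3(12 := x j i)"
  have 5: "ev W B (Bin Mod (Var 10) (digit_exp 14 2 9 (Num 0))) 13 ?\<rho>4 m (int (i mod digit P e 0))"
  proof (rule ev_Bin)
    show "ev W B (Var 10) 13 ?\<rho>4 m (int i)" by (rule ev_Var) auto
    show "ev W B (digit_exp 14 2 9 (Num 0)) (Suc 13) (?\<rho>4(13 := int i)) m (int (digit P e 0))"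
      by (rule ev_digit) (use r e in \<open>auto intro!: ev_Num\<close>)
    have "i mod digit P e 0 \<le> i" by simp
    then show "\<bar>int (i mod digit P e 0)\<bar> \<le> int W" using i W_ge(1) by linarith
  qed (simp add: zmod_int)
  have 6: "ev W B (cover_exp k) 14 (?\<rho>4(13 := int (i mod digit P e 0))) m (of_bool (adj j i e))"
    by (rule ev_cover_exp) (use r e i j in auto)
  show ?thesis unfolding bit_exp_def e_def[symmetric] i_def[symmetric] j_def[symmetric]
    by (rule ev_Let'[OF 1 _ ev_Let'[OF 2 _ ev_Let'[OF 3 _ ev_Let'[OF 4 _ ev_Let'[OF 5 _ 6]]]]]) auto
qed

end

section \<open>The reduction as a program\<close>

text \<open>There is no comparison in expressions, but \<open>n div (1 + gadget_size k q)\<close> is nonzero iff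
  \<open>gadget_size k q < n\<close>.\<close>

definition search_exp :: "nat \<Rightarrow> nat \<Rightarrow> exp" where
  "search_exp k q0 = Fold (Num (int q0)) (Var 0)
     (Bin Add (Var 1) (Nz (Bin Div (Var 0) (Bin Add (Num 1)
       (power_exp 7 1 (Bin Mul (Num (2 * int k)) (Bin Add (Bin Add (Num 1) (Var 1)) (Bin Mul (Num (int k + 1)) (power_exp 11 1 (Num (int k)))))))))))"

text \<open>The input is moved to negative addresses, the encoded instance is written from address 0 on, and
  the negative addresses are cleared, so that the memory is as in the initial configuration of a
  run on the instance.\<close>

definition reduction_prog :: "nat \<Rightarrow> nat \<Rightarrow> stm list" where
  "reduction_prog k q0 =
    [Set (Ld (Num 0)),
     Set (search_exp k q0),
     Set (power_exp 2 1 (Num (2 * int k))),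
     Set (power_exp 3 1 (Num (int k))),
     Set (Bin Add (Bin Add (Num 1) (Var 1)) (Bin Mul (Num (int k + 1)) (Var 3))),
     Set (power_exp 5 2 (Var 4)),
     Fill (Bin Add (Bin Mul (Num (int k)) (Var 0)) (Num 1)) (Bin Sub (Num (- 1)) (Var 7)) (Ld (Var 7)),
     Fill (Bin Mul (Bin Mul (Num (int k)) (Var 5)) (Var 5)) (Bin Add (Num 2) (Var 7)) (bit_exp k),
     Fill (Num 2) (Var 7) (Bin Mul (Var 5) (Bin Add (Num (int k)) (Bin Mul (Num (1 - int k)) (Var 7)))),
     Fill (Bin Add (Bin Mul (Num (int k)) (Var 0)) (Num 1)) (Bin Sub (Num (- 1)) (Var 7)) (Num 0)]"

context ram_gadget
begin

lemma M_eq_gadget_size: "M = gadget_size k q"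
proof -
  have "M = P ^ ndigits" by (rule M_def)
  also have "\<dots> = gadget_size k q" unfolding gadget_size_def ndigits_def by (simp only: P)
  finally show ?thesis .
qed

lemma k_le_M: "2 * k * ndigits \<le> M" "(k + 1) * q ^ k \<le> M" "k + 1 \<le> M"
proof -
  show 1: "2 * k * ndigits \<le> M" using gadget_size_gt[OF q, of k] unfolding M_eq_gadget_size ndigits_def by simp
  have "1 * ndigits \<le> 2 * k * ndigits" using k by (intro mult_right_mono) auto
  then show 2: "(k + 1) * q ^ k \<le> M" using 1 unfolding ndigits_def by simp
  have "(k + 1) * 1 \<le> (k + 1) * q ^ k" using q by (intro mult_left_mono) auto
  then show "k + 1 \<le> M" using 2 by simp
qed

text \<open>The candidate moves up by one per round until it is \<open>q\<close> and then stays.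
  \<open>n\<close> rounds suffice because \<open>q - 1 \<le> gadget_size k (q - 1) < n\<close>
  unless the search starts at \<open>q\<close>.\<close>

lemma ev_search_exp:
  assumes n: "\<rho> 0 = int n" "n \<le> M" and q0: "2 \<le> q0" "q0 \<le> q"
    and least: "\<And>q'. q0 \<le> q' \<Longrightarrow> q' < q \<Longrightarrow> gadget_size k q' < n"
  shows "ev W B (search_exp k q0) 1 \<rho> m (int q)"
  unfolding search_exp_def
proof (rule ev_Fold[where g = "\<lambda>t. int (min q (q0 + t))"])
  show "ev W B (Num (int q0)) 1 \<rho> m (int (min q (q0 + 0)))"
    using q0(2) parameters_le_M(2) W_ge(1) by (auto intro!: ev_Num simp: min_def)
  show "ev W B (Var 0) (Suc 1) (\<rho>(1 := int (min q (q0 + 0)))) m (int n)"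
    by (rule ev_Var) (use n in auto)
  show "n \<le> B" using n B_ge by linarith
  show "int (min q (q0 + n)) = int q"
  proof (cases "q = q0")
    case False
    then have "gadget_size k (q - 1) < n" using q0 by (intro least) auto
    moreover have "(q - 1) * 1 \<le> gadget_size k (q - 1)"
    proof -
      have "2 \<le> q - 1" using q0 False by simp
      then have "2 * k * (1 + (q - 1) + (k + 1) * (q - 1) ^ k) < gadget_size k (q - 1)" by (rule gadget_size_gt)
      moreover have "1 * (q - 1) \<le> 2 * k * (1 + (q - 1) + (k + 1) * (q - 1) ^ k)"
        using k by (intro mult_mono) auto
      ultimately show ?thesis by linarith
    qed
    ultimately show ?thesis by simp
  qed simp
  fix t
  define u where "u = min q (q0 + t)"
  have u: "2 \<le> u" "u \<le> q" using q0 q by (auto simp: u_def)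
  let ?\<rho> = "\<rho>(1 := int u, 1 + 1 := int n, 1 + 2 := int t)"
  let ?l = "1 + u + (k + 1) * u ^ k"
  \<comment> \<open>The search never goes beyond \<open>q\<close>, so all tested sizes stay within
    \<open>M\<close>.\<close>
  have gM: "gadget_size k u \<le> M" using gadget_size_mono[of u q k] u unfolding M_eq_gadget_size by simp
  have lM: "2 * k * ?l \<le> M" using gadget_size_gt[OF u(1), of k] gM by linarith
  have l1: "?l \<le> 2 * k * ?l" using mult_right_mono[of 1 "2 * k" ?l] k by simp
  have lW: "2 * k * ?l \<le> W" "2 * k * ?l \<le> B" "?l \<le> W" "(k + 1) * u ^ k \<le> W" "k + 1 \<le> W" "2 * k \<le> W" "1 + u \<le> W" "u ^ k \<le> W"
  proof -
    show a: "2 * k * ?l \<le> W" "2 * k * ?l \<le> B" using lM W_ge B_ge by linarith+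
    show b: "?l \<le> W" using a l1 by linarith
    then show c: "(k + 1) * u ^ k \<le> W" "1 + u \<le> W" by linarith+
    show "u ^ k \<le> W" using c(1) by simp
    show "k + 1 \<le> W" using k_le_M(3) W_ge by linarith
    show "2 * k \<le> W" using k_le_M(3) W_ge by linarith
  qed
  have 1: "ev W B (power_exp 11 1 (Num (int k))) 11 (?\<rho>(4 := int u, 5 := int n, 6 := 1, 7 := 1, 8 := 2 * int k, 9 := int (1 + u), 10 := int (k + 1))) m (int (u ^ k))"
    by (rule ev_power_exp) (use u lW B_ge in \<open>auto intro!: ev_Num\<close>)
  have 2: "ev W B (Bin Add (Bin Add (Num 1) (Var 1)) (Bin Mul (Num (int k + 1)) (power_exp 11 1 (Num (int k))))) 9
      (?\<rho>(4 := int u, 5 := int n, 6 := 1, 7 := 1, 8 := 2 * int k)) m (int ?l)"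
  proof (rule ev_Bin)
    show "ev W B (Bin Add (Num 1) (Var 1)) 9 (?\<rho>(4 := int u, 5 := int n, 6 := 1, 7 := 1, 8 := 2 * int k)) m (int (1 + u))"
      by (rule ev_simple) (use lW in auto)
    show "ev W B (Bin Mul (Num (int k + 1)) (power_exp 11 1 (Num (int k)))) (Suc 9)
        ((?\<rho>(4 := int u, 5 := int n, 6 := 1, 7 := 1, 8 := 2 * int k))(9 := int (1 + u))) m (int ((k + 1) * u ^ k))"
    proof (rule ev_Bin)
      show "ev W B (Num (int k + 1)) (Suc 9) ((?\<rho>(4 := int u, 5 := int n, 6 := 1, 7 := 1, 8 := 2 * int k))(9 := int (1 + u))) m (int (k + 1))"
        by (rule ev_simple) (use lW in auto)
      show "ev W B (power_exp 11 1 (Num (int k))) (Suc (Suc 9))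
          ((?\<rho>(4 := int u, 5 := int n, 6 := 1, 7 := 1, 8 := 2 * int k))(9 := int (1 + u), Suc 9 := int (k + 1))) m (int (u ^ k))"
        using 1 by (simp add: numeral_eq_Suc)
      show "\<bar>int ((k + 1) * u ^ k)\<bar> \<le> int W" using lW(4) by (simp only: abs_of_nat of_nat_le_iff)
    qed (simp add: algebra_simps)
    show "\<bar>int ?l\<bar> \<le> int W" using lW(3) by (simp only: abs_of_nat of_nat_le_iff)
  qed (simp add: algebra_simps)
  have 3: "ev W B (power_exp 7 1 (Bin Mul (Num (2 * int k)) (Bin Add (Bin Add (Num 1) (Var 1)) (Bin Mul (Num (int k + 1)) (power_exp 11 1 (Num (int k)))))))
      7 (?\<rho>(4 := int u, 5 := int n, 6 := 1)) m (int (gadget_size k u))"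
    unfolding gadget_size_eq
  proof (rule ev_power_exp)
    show "ev W B (Bin Mul (Num (2 * int k)) (Bin Add (Bin Add (Num 1) (Var 1)) (Bin Mul (Num (int k + 1)) (power_exp 11 1 (Num (int k))))))
      (Suc 7) ((?\<rho>(4 := int u, 5 := int n, 6 := 1))(7 := 1)) m (int (2 * k * ?l))"
    proof (rule ev_Bin)
      show "ev W B (Num (2 * int k)) (Suc 7) ((?\<rho>(4 := int u, 5 := int n, 6 := 1))(7 := 1)) m (2 * int k)"
        by (rule ev_simple) (use lW in auto)
      show "ev W B (Bin Add (Bin Add (Num 1) (Var 1)) (Bin Mul (Num (int k + 1)) (power_exp 11 1 (Num (int k))))) (Suc (Suc 7))
         ((?\<rho>(4 := int u, 5 := int n, 6 := 1))(7 := 1, Suc 7 := 2 * int k)) m (int ?l)"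
        using 2 by (simp add: numeral_eq_Suc)
      show "\<bar>int (2 * k * ?l)\<bar> \<le> int W" using lW(1) by (simp only: abs_of_nat of_nat_le_iff)
    qed (simp add: algebra_simps)
    show "u ^ (2 * k * ?l) \<le> W" using gM W_ge(1) unfolding gadget_size_eq by linarith
  qed (use u lW in auto)
  have gW: "1 + gadget_size k u \<le> W" using gM W_ge by linarith
  have 4: "ev W B (Bin Add (Num 1) (power_exp 7 1 (Bin Mul (Num (2 * int k)) (Bin Add (Bin Add (Num 1) (Var 1)) (Bin Mul (Num (int k + 1)) (power_exp 11 1 (Num (int k))))))))
      6 (?\<rho>(4 := int u, 5 := int n)) m (int (1 + gadget_size k u))"
    by (rule ev_Bin[where x = 1 and y = "int (gadget_size k u)"]) (use 3 gW W_ge in \<open>auto intro!: ev_Num simp: numeral_eq_Suc\<close>)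
  have "n \<le> W" using n W_ge by linarith
  then have nW: "n div (1 + gadget_size k u) \<le> W" using div_le_dividend le_trans by blast
  have 5: "ev W B (Bin Div (Var 0) (Bin Add (Num 1) (power_exp 7 1 (Bin Mul (Num (2 * int k)) (Bin Add (Bin Add (Num 1) (Var 1)) (Bin Mul (Num (int k + 1)) (power_exp 11 1 (Num (int k)))))))))
      5 (?\<rho>(4 := int u)) m (int (n div (1 + gadget_size k u)))"
  proof (rule ev_Bin)
    show "ev W B (Var 0) 5 (?\<rho>(4 := int u)) m (int n)" by (rule ev_Var) (use n in auto)
    show "ev W B (Bin Add (Num 1) (power_exp 7 1 (Bin Mul (Num (2 * int k)) (Bin Add (Bin Add (Num 1) (Var 1)) (Bin Mul (Num (int k + 1)) (power_exp 11 1 (Num (int k))))))))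
      (Suc 5) ((?\<rho>(4 := int u))(5 := int n)) m (int (1 + gadget_size k u))" using 4 by (simp add: numeral_eq_Suc)
    show "\<bar>int (n div (1 + gadget_size k u))\<bar> \<le> int W" using nW by (simp only: abs_of_nat of_nat_le_iff)
  qed (simp add: zdiv_int)
  have step: "min q (q0 + Suc t) = u + of_bool (gadget_size k u < n)"
  proof (cases "u < q")
    case True
    then have "gadget_size k u < n" using q0 by (intro least) (auto simp: u_def)
    then show ?thesis using True by (auto simp: u_def)
  next
    case False
    then have "u = q" using u by simp
    then show ?thesis using n unfolding M_eq_gadget_size by (auto simp: u_def)
  qed
  have "int (min q (q0 + Suc t)) = int u + of_bool (int (n div (1 + gadget_size k u)) \<noteq> 0)"
    unfolding step by (auto simp: div_eq_0_iff)
  moreover have "\<bar>int (min q (q0 + Suc t))\<bar> \<le> int W" using parameters_le_M(2) W_ge(1) by simp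
  moreover have "ev W B (Nz (Bin Div (Var 0) (Bin Add (Num 1) (power_exp 7 1 (Bin Mul (Num (2 * int k)) (Bin Add (Bin Add (Num 1) (Var 1)) (Bin Mul (Num (int k + 1)) (power_exp 11 1 (Num (int k))))))))))
      (Suc (1 + 3)) (?\<rho>(1 + 3 := int u)) m (of_bool (int (n div (1 + gadget_size k u)) \<noteq> 0))"
    using ev_Nz[OF 5 refl] by (simp add: numeral_eq_Suc)
  ultimately show "ev W B (Bin Add (Var 1) (Nz (Bin Div (Var 0) (Bin Add (Num 1)
       (power_exp 7 1 (Bin Mul (Num (2 * int k)) (Bin Add (Bin Add (Num 1) (Var 1)) (Bin Mul (Num (int k + 1)) (power_exp 11 1 (Num (int k)))))))))))
       (1 + 3) (\<rho>(1 := int (min q (q0 + t)), 1 + 1 := int n, 1 + 2 := int t)) m (int (min q (q0 + Suc t)))"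
    unfolding u_def[symmetric] by (intro ev_Bin[where x = "int u"] ev_Var) auto
qed

lemma evs_reduction_prog:
  assumes n: "n \<le> M" and q0: "2 \<le> q0" "q0 \<le> q"
    and least: "\<And>q'. q0 \<le> q' \<Longrightarrow> q' < q \<Longrightarrow> gadget_size k q' < n"
    and m0: "m0 0 = int n" "\<And>a. a < 0 \<or> int (k * n) < a \<Longrightarrow> m0 a = 0" "\<And>a. \<bar>m0 a\<bar> \<le> int X"
    and x: "\<And>j i. j < k \<Longrightarrow> i < M \<Longrightarrow> x j i = (if n = 0 then 1 else m0 (1 + int j * int n + int (i mod n)))"
  shows "evs W B (reduction_prog k q0) 0 (\<lambda>_. 0) m0
    (\<lambda>a. if a < 0 then 0 else if a = 0 then int (k * M) else if a = 1 then int M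
      else if a < 2 + int (k * M * M)
        then of_bool (adj (nat (a - 2) div M div M) (nat (a - 2) div M mod M) (nat (a - 2) mod M)) else 0)"
    (is "evs W B _ _ _ _ ?m")
proof -
  define bit where "bit l = (of_bool (adj (l div M div M) (l div M mod M) (l mod M)) :: int)" for l
  \<comment> \<open>\<open>m1\<close> to \<open>m4\<close> follow the memory through the four loops.
    Copying comes before the matrix, which overwrites the input.\<close>
  define m1 where "m1 t a = (if - 1 - int t < a \<and> a < 0 then m0 (- 1 - a) else m0 a)" for t a
  define m2 where "m2 t a = (if 2 \<le> a \<and> a < 2 + int t then bit (nat (a - 2)) else m1 (k * n + 1) a)" for t a
  define m3 where "m3 t a = (if 0 \<le> a \<and> a < int t then (if a = 0 then int (k * M) else int M) else m2 (k * M * M) a)" for t a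
  define m4 where "m4 t a = (if - 1 - int t < a \<and> a < 0 then 0 else m3 2 a)" for t a
  have M0: "0 < M" using parameters_le_M(5) by simp
  have kn: "k * n \<le> k * M" using n by simp
  have kMM: "k * M \<le> k * M * M" using M0 by simp
  have m4: "m4 (k * n + 1) = ?m"
  proof
    fix a
    show "m4 (k * n + 1) a = ?m a"
    proof (cases "a < 0")
      case True
      then show ?thesis using m0(2)[of a] by (auto simp: m4_def m3_def m2_def m1_def)
    next
      case False
      then consider "a = 0" | "a = 1" | "2 \<le> a" "a < 2 + int (k * M * M)" | "2 + int (k * M * M) \<le> a" by linarith
      then show ?thesis
      proof cases
        case 4
        \<comment> \<open>The input ends before the matrix does, so nothing of it survives behind
          the matrix.\<close>
        have "int (k * n) \<le> int (k * M * M)" using kn kMM by linarith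
        then have "int (k * n) < a" using 4 by linarith
        then show ?thesis using 4 m0(2)[of a] by (auto simp: m4_def m3_def m2_def m1_def)
      qed (auto simp: m4_def m3_def m2_def m1_def bit_def)
    qed
  qed
  have nW: "n \<le> W" using n W_ge by linarith
  let ?r1 = "(\<lambda>_. 0)(0 := int n)"
  let ?r2 = "?r1(Suc 0 := int q)"
  let ?r3 = "?r2(Suc (Suc 0) := int P)"
  let ?r4 = "?r3(Suc (Suc (Suc 0)) := int (q ^ k))"
  let ?r5 = "?r4(Suc (Suc (Suc (Suc 0))) := int ndigits)"
  let ?r6 = "?r5(Suc (Suc (Suc (Suc (Suc 0)))) := int M)"
  have W2: "2 * k \<le> W" "2 * k \<le> B" "P \<le> W" "q ^ k \<le> W" "k + 1 \<le> W" "1 + q \<le> W" "(k + 1) * q ^ k \<le> W" "ndigits \<le> W"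
    "ndigits \<le> B" "M \<le> W" "k * M + 1 \<le> W" "k * M + 1 \<le> B" "k * M * M + 2 \<le> W" "k * M * M \<le> B" "2 \<le> B"
    using parameters_le_M k_le_M B_ge W_ge kMM by linarith+
  have s1: "ev W B (Ld (Num 0)) 0 (\<lambda>_. 0) m0 (int n)"
    by (rule ev_simple) (use m0(1) in auto)
  have s2: "ev W B (search_exp k q0) (Suc 0) ?r1 m0 (int q)"
    using ev_search_exp[of ?r1 n q0 m0] n q0 least by simp
  have s3: "ev W B (power_exp 2 1 (Num (2 * int k))) (Suc (Suc 0)) ?r2 m0 (int P)"
    unfolding P by (rule ev_power_exp) (use W2 q P in \<open>auto intro!: ev_Num\<close>)
  have s4: "ev W B (power_exp 3 1 (Num (int k))) (Suc (Suc (Suc 0))) ?r3 m0 (int (q ^ k))"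
    by (rule ev_power_exp) (use W2 q B_ge in \<open>auto intro!: ev_Num\<close>)
  have s5: "ev W B (Bin Add (Bin Add (Num 1) (Var 1)) (Bin Mul (Num (int k + 1)) (Var 3))) (Suc (Suc (Suc (Suc 0)))) ?r4 m0 (int ndigits)"
  proof (rule ev_simple)
    have "\<bar>(int k + 1) * int q ^ k\<bar> \<le> int W" "\<bar>1 + int q + (int k + 1) * int q ^ k\<bar> \<le> int W"
      using W2(7,8) unfolding ndigits_def by (metis abs_of_nat of_nat_1 of_nat_add of_nat_le_iff of_nat_mult of_nat_power)+
    then show "simple_ok W (Bin Add (Bin Add (Num 1) (Var 1)) (Bin Mul (Num (int k + 1)) (Var 3))) (Suc (Suc (Suc (Suc 0)))) ?r4 m0"
      using W2 W_ge by auto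
  qed (simp add: ndigits_def algebra_simps)
  have s6: "ev W B (power_exp 5 2 (Var 4)) (Suc (Suc (Suc (Suc (Suc 0))))) ?r5 m0 (int M)"
    unfolding M_def by (rule ev_power_exp) (use W2 P2 in \<open>auto intro!: ev_Var simp: M_def[symmetric]\<close>)
  have lev: "Suc (Suc (Suc (Suc (Suc (Suc 0))))) = 6" by simp
  have bd: "ev W B (Bin Add (Bin Mul (Num (int k)) (Var 0)) (Num 1)) 6 ?r6 m (int (k * n + 1))" for m
  proof (rule ev_simple)
    have "k * n \<le> W" "k * n + 1 \<le> W" using kn W2(11) by linarith+
    then have "\<bar>int k * int n\<bar> \<le> int W" "\<bar>int k * int n + 1\<bar> \<le> int W"
      by (metis abs_of_nat of_nat_1 of_nat_add of_nat_le_iff of_nat_mult)+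
    then show "simple_ok W (Bin Add (Bin Mul (Num (int k)) (Var 0)) (Num 1)) 6 ?r6 m"
      using W2 W_ge by auto
  qed simp
  have knB: "k * n + 1 \<le> B" "k * n + 1 \<le> W" using kn W2 by linarith+
  have addr: "ev W B (Bin Sub (Num (- 1)) (Var 7)) (6 + 2) (?r6(6 := l, 6 + 1 := int i)) m (- 1 - int i)" if "i < k * n + 1" for i l m
    by (rule ev_simple) (use that knB W_ge in auto)
  have f4: "evs W B [Fill (Bin Add (Bin Mul (Num (int k)) (Var 0)) (Num 1)) (Bin Sub (Num (- 1)) (Var 7)) (Num 0)] 6 ?r6 (m3 2) ?m"
  proof (rule evs_Fill[where M = m4 and \<alpha> = "\<lambda>i. - 1 - int i" and \<beta> = "\<lambda>_. 0", OF bd knB(1)])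
    show "m4 0 = m3 2" by (auto simp: m4_def)
    show "m4 (Suc i) = (m4 i)(- 1 - int i := 0)" for i by (auto simp: m4_def)
    show "evs W B [] 6 ?r6 (m4 (k * n + 1)) ?m" unfolding m4 by (rule evs_Nil)
  qed (use addr in \<open>auto intro!: ev_Num\<close>)
  have f3: "evs W B [Fill (Num 2) (Var 7) (Bin Mul (Var 5) (Bin Add (Num (int k)) (Bin Mul (Num (1 - int k)) (Var 7)))),
     Fill (Bin Add (Bin Mul (Num (int k)) (Var 0)) (Num 1)) (Bin Sub (Num (- 1)) (Var 7)) (Num 0)] 6 ?r6 (m2 (k * M * M)) ?m"
  proof (rule evs_Fill[where n = 2 and M = m3 and \<alpha> = int and \<beta> = "\<lambda>i. if i = 0 then int (k * M) else int M", OF _ _ _ _ _ _ f4])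
    show "ev W B (Num 2) 6 ?r6 (m2 (k * M * M)) (int 2)" by (rule ev_simple) (use W_ge in auto)
    show "2 \<le> B" by (rule W2)
    show "m3 0 = m2 (k * M * M)" by (auto simp: m3_def)
    fix i :: nat assume i: "i < 2"
    show "ev W B (Var 7) (6 + 2) (?r6(6 := int 2, 6 + 1 := int i)) (m3 i) (int i)" by (rule ev_simple) auto
    have "k * M \<le> W" using W2 by linarith
    then have "\<bar>int M * int k\<bar> \<le> int W" by (metis abs_of_nat mult.commute of_nat_le_iff of_nat_mult)
    \<comment> \<open>Linear interpolation replaces a branch: \<open>k + (1 - k) * t\<close> is
      \<open>k\<close> for \<open>t = 0\<close> and 1 for \<open>t = 1\<close>.\<close>
    then show "ev W B (Bin Mul (Var 5) (Bin Add (Num (int k)) (Bin Mul (Num (1 - int k)) (Var 7)))) (6 + 3)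
        (?r6(6 := int 2, 6 + 1 := int i, 6 + 2 := int i)) (m3 i) (if i = 0 then int (k * M) else int M)"
      by (intro ev_simple) (use i k W2 in \<open>auto simp: less_2_cases_iff mult.commute\<close>)
    show "m3 (Suc i) = (m3 i)(int i := if i = 0 then int (k * M) else int M)"
      using i by (auto simp: m3_def less_2_cases_iff)
  qed
  have f2: "evs W B [Fill (Bin Mul (Bin Mul (Num (int k)) (Var 5)) (Var 5)) (Bin Add (Num 2) (Var 7)) (bit_exp k),
     Fill (Num 2) (Var 7) (Bin Mul (Var 5) (Bin Add (Num (int k)) (Bin Mul (Num (1 - int k)) (Var 7)))),
     Fill (Bin Add (Bin Mul (Num (int k)) (Var 0)) (Num 1)) (Bin Sub (Num (- 1)) (Var 7)) (Num 0)] 6 ?r6 (m1 (k * n + 1)) ?m"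
  proof (rule evs_Fill[where n = "k * M * M" and M = m2 and \<alpha> = "\<lambda>i. 2 + int i" and \<beta> = bit, OF _ _ _ _ _ _ f3])
    have "k * M \<le> W" "k * M * M \<le> W" using W2 by linarith+
    then have "\<bar>int k * int M\<bar> \<le> int W" "\<bar>int k * int M * int M\<bar> \<le> int W"
      by (metis abs_of_nat of_nat_le_iff of_nat_mult)+
    then show "ev W B (Bin Mul (Bin Mul (Num (int k)) (Var 5)) (Var 5)) 6 ?r6 (m1 (k * n + 1)) (int (k * M * M))"
      by (intro ev_simple) (use W2 in auto)
    show "k * M * M \<le> B" by (rule W2)
    show "m2 0 = m1 (k * n + 1)" by (auto simp: m2_def)
    fix l assume l: "l < k * M * M"
    show "ev W B (Bin Add (Num 2) (Var 7)) (6 + 2) (?r6(6 := int (k * M * M), 6 + 1 := int l)) (m2 l) (2 + int l)"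
      by (rule ev_simple) (use l W2 in auto)
    have "ev W B (bit_exp k) 9 (?r6(6 := int (k * M * M), 7 := int l, 8 := 2 + int l)) (m2 l) (bit l)"
      unfolding bit_def
    proof (rule ev_bit_exp[where n = n])
      fix j i assume ji: "j < k" "i < M"
      show "m2 l (- 2 - int j * int n - int (i mod n)) + of_bool (n = 0) = x j i"
      proof (cases "n = 0")
        case True
        then show ?thesis using x[OF ji] m0(2) by (simp add: m2_def m1_def)
      next
        case False
        let ?a = "- 2 - int j * int n - int (i mod n)"
        have "i mod n < n" using False by simp
        moreover have "(j + 1) * n \<le> k * n" using ji by (intro mult_right_mono) auto
        ultimately have "j * n + i mod n < k * n" by simp
        then have "int j * int n + int (i mod n) < int (k * n)" by (metis of_nat_add of_nat_less_iff of_nat_mult)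
        moreover have "0 \<le> int j * int n" by simp
        ultimately have "- 1 - int (k * n + 1) < ?a" "?a < 0" by linarith+
        then have "m2 l ?a = m0 (- 1 - ?a)" unfolding m2_def m1_def by simp
        also have "- 1 - ?a = 1 + int j * int n + int (i mod n)" by simp
        finally show ?thesis using x[OF ji] False by simp
      qed
    next
      fix a show "\<bar>m2 l a\<bar> \<le> int X" unfolding m2_def m1_def bit_def using m0(3) X(1) by auto
    qed (use l n in auto)
    then show "ev W B (bit_exp k) (6 + 3) (?r6(6 := int (k * M * M), 6 + 1 := int l, 6 + 2 := 2 + int l)) (m2 l) (bit l)"
      by simp
    show "m2 (Suc l) = (m2 l)(2 + int l := bit l)" by (auto simp: m2_def)
  qed
  have f1: "evs W B [Fill (Bin Add (Bin Mul (Num (int k)) (Var 0)) (Num 1)) (Bin Sub (Num (- 1)) (Var 7)) (Ld (Var 7)),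
     Fill (Bin Mul (Bin Mul (Num (int k)) (Var 5)) (Var 5)) (Bin Add (Num 2) (Var 7)) (bit_exp k),
     Fill (Num 2) (Var 7) (Bin Mul (Var 5) (Bin Add (Num (int k)) (Bin Mul (Num (1 - int k)) (Var 7)))),
     Fill (Bin Add (Bin Mul (Num (int k)) (Var 0)) (Num 1)) (Bin Sub (Num (- 1)) (Var 7)) (Num 0)] 6 ?r6 m0 ?m"
  proof (rule evs_Fill[where M = m1 and \<alpha> = "\<lambda>i. - 1 - int i" and \<beta> = "\<lambda>i. m0 (int i)", OF bd knB(1) _ _ _ _ f2])
    show "m1 0 = m0" by (auto simp: m1_def)
    fix i assume i: "i < k * n + 1"
    show "ev W B (Ld (Var 7)) (6 + 3) (?r6(6 := int (k * n + 1), 6 + 1 := int i, 6 + 2 := - 1 - int i)) (m1 i) (m0 (int i))"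
      by (rule ev_simple) (auto simp: m1_def)
    show "m1 (Suc i) = (m1 i)(- 1 - int i := m0 (int i))" by (auto simp: m1_def)
  qed (use addr in auto)
  show ?thesis unfolding reduction_prog_def
    by (intro evs_Set[OF s1] evs_Set[OF s2] evs_Set[OF s3] evs_Set[OF s4] evs_Set[OF s5] evs_Set[OF s6])
      (use f1 in \<open>simp only: lev\<close>)
qed

end

section \<open>Running time and encodings\<close>

fun csize :: "exp \<Rightarrow> nat" where
  "csize (Num c) = 1"
| "csize (Var i) = 1"
| "csize (Bin f a b) = csize a + csize b + 1"
| "csize (Nz a) = csize a + 1"
| "csize (Ld a) = csize a + 1"
| "csize (Let_in a b) = csize a + csize b + 1"
| "csize (Fold a b c) = csize a + csize b + csize c + 7"

fun depth :: "exp \<Rightarrow> nat" where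
  "depth (Num c) = 0"
| "depth (Var i) = 0"
| "depth (Bin f a b) = max (depth a) (depth b)"
| "depth (Nz a) = depth a"
| "depth (Ld a) = depth a"
| "depth (Let_in a b) = max (depth a) (depth b)"
| "depth (Fold a b c) = max (max (depth a) (depth b)) (Suc (depth c))"

lemma mult_power_mono:
  fixes a n :: nat
  shows "a \<le> s * (B + 1) ^ d \<Longrightarrow> d \<le> d' \<Longrightarrow> a \<le> s * (B + 1) ^ d'"
  by (meson add_leE le_add2 le_trans mult_le_mono2 power_increasing)

lemma loop_cost:
  fixes c :: nat
  assumes "c \<le> s * (B + 1) ^ d"
  shows "B * (c + 4) + 3 \<le> (s + 7) * (B + 1) ^ Suc d"
proof -
  have "B * (c + 4) + 3 \<le> (B + 1) * c + 7 * (B + 1)" by (simp add: algebra_simps)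
  also have "\<dots> \<le> (B + 1) * (s * (B + 1) ^ d) + 7 * (B + 1) ^ Suc d"
  proof (rule add_mono)
    have "1 \<le> (B + 1) ^ d" by simp
    then have "7 * (B + 1) * 1 \<le> 7 * (B + 1) * (B + 1) ^ d" by (rule mult_left_mono) simp
    then show "7 * (B + 1) \<le> 7 * (B + 1) ^ Suc d" by (simp only: power_Suc mult_1_right mult.assoc)
  qed (use assms in \<open>rule mult_left_mono; simp\<close>)
  also have "\<dots> = (s + 7) * (B + 1) ^ Suc d" by (simp add: algebra_simps)
  finally show ?thesis .
qed

text \<open>The cost is polynomial in the loop bound, the degree being the nesting depth of the loop
  bodies.\<close>

lemma cost_le: "cost B e \<le> csize e * (B + 1) ^ depth e"
proof (induction e)
  case (Bin f a b)
  have "cost B a \<le> csize a * (B + 1) ^ max (depth a) (depth b)" "cost B b \<le> csize b * (B + 1) ^ max (depth a) (depth b)"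
    using mult_power_mono[OF Bin.IH(1)] mult_power_mono[OF Bin.IH(2)] by auto
  moreover have "1 \<le> 1 * (B + 1) ^ max (depth a) (depth b)" by simp
  ultimately show ?case unfolding cost.simps csize.simps depth.simps add_mult_distrib by linarith
next
  case (Let_in a b)
  have "cost B a \<le> csize a * (B + 1) ^ max (depth a) (depth b)" "cost B b \<le> csize b * (B + 1) ^ max (depth a) (depth b)"
    using mult_power_mono[OF Let_in.IH(1)] mult_power_mono[OF Let_in.IH(2)] by auto
  moreover have "1 \<le> 1 * (B + 1) ^ max (depth a) (depth b)" by simp
  ultimately show ?case unfolding cost.simps csize.simps depth.simps add_mult_distrib by linarith
next
  case (Nz a)
  moreover have "1 \<le> 1 * (B + 1) ^ depth a" by simp
  ultimately show ?case unfolding cost.simps csize.simps depth.simps add_mult_distrib by linarith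
next
  case (Ld a)
  moreover have "1 \<le> 1 * (B + 1) ^ depth a" by simp
  ultimately show ?case unfolding cost.simps csize.simps depth.simps add_mult_distrib by linarith
next
  case (Fold a b c)
  let ?d = "depth (Fold a b c)"
  have "cost B a \<le> csize a * (B + 1) ^ ?d" "cost B b \<le> csize b * (B + 1) ^ ?d"
    using mult_power_mono[OF Fold.IH(1)] mult_power_mono[OF Fold.IH(2)] by auto
  moreover have "B * (cost B c + 4) + 3 \<le> (csize c + 7) * (B + 1) ^ ?d"
    by (rule mult_power_mono[OF loop_cost[OF Fold.IH(3)]]) simp
  ultimately have "cost B (Fold a b c) \<le> csize a * (B + 1) ^ ?d + csize b * (B + 1) ^ ?d + (csize c + 7) * (B + 1) ^ ?d"
    by simp
  also have "\<dots> = csize (Fold a b c) * (B + 1) ^ ?d" by (simp only: csize.simps add_mult_distrib)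
  finally show ?case .
qed auto

fun sdepth :: "stm \<Rightarrow> nat" where
  "sdepth (Set e) = depth e"
| "sdepth (Fill l a v) = max (depth l) (Suc (max (depth a) (depth v)))"

lemma costs_le:
  assumes "\<And>c. c \<in> set cs \<Longrightarrow> sdepth c \<le> d"
  shows "\<exists>C. \<forall>B. costs B cs \<le> C * (B + 1) ^ d"
  using assms
proof (induction cs)
  case (Cons c cs)
  then obtain C where C: "\<And>B. costs B cs \<le> C * (B + 1) ^ d" by auto
  show ?case
  proof (cases c)
    case (Set e)
    have "costs B (c # cs) \<le> (csize e + C) * (B + 1) ^ d" for B
    proof -
      have "cost B e \<le> csize e * (B + 1) ^ d"
        by (rule mult_power_mono[OF cost_le]) (use Cons.prems[of c] Set in auto)
      then show ?thesis using C[of B] Set by (simp only: costs.simps add_mult_distrib)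
    qed
    then show ?thesis by blast
  next
    case (Fill l a v)
    define m where "m = max (depth a) (depth v)"
    have md: "Suc m \<le> d" "depth l \<le> d" using Cons.prems[of c] Fill by (auto simp: m_def)
    have "costs B (c # cs) \<le> (csize l + (csize a + csize v + 7) + C) * (B + 1) ^ d" for B
    proof -
      have 1: "cost B l \<le> csize l * (B + 1) ^ d"
        by (rule mult_power_mono[OF cost_le md(2)])
      have "cost B a \<le> csize a * (B + 1) ^ m" "cost B v \<le> csize v * (B + 1) ^ m"
        by (rule mult_power_mono[OF cost_le]; simp add: m_def)+
      then have "cost B a + cost B v \<le> (csize a + csize v) * (B + 1) ^ m" by (simp only: add_mult_distrib)
      from mult_power_mono[OF loop_cost[OF this] md(1)]
      have 2: "B * (cost B a + cost B v + 4) + 3 \<le> (csize a + csize v + 7) * (B + 1) ^ d" .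
      show ?thesis using 1 2 C[of B] Fill by (simp only: costs.simps add_mult_distrib)
    qed
    then show ?thesis by blast
  qed
qed auto

text \<open>In \<open>word_bound\<close> one constant is both factor and exponent; hiding it behind
  a quantifier gives closure under sums and products.\<close>

definition poly_bounded :: "(nat \<Rightarrow> nat) \<Rightarrow> bool" where
  "poly_bounded f \<longleftrightarrow> (\<exists>c. \<forall>n. f n \<le> word_bound c n)"

lemma poly_bounded_const: "poly_bounded (\<lambda>_. a)"
  unfolding poly_bounded_def word_bound_def by (intro exI[of _ a]) simp

lemma poly_bounded_id: "poly_bounded (\<lambda>n. n)"
  unfolding poly_bounded_def word_bound_def by (intro exI[of _ 1]) simp

lemma poly_bounded_add: "poly_bounded f \<Longrightarrow> poly_bounded g \<Longrightarrow> poly_bounded (\<lambda>n. f n + g n)"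
proof -
  assume "poly_bounded f" "poly_bounded g"
  then obtain c d where cd: "\<And>n. f n \<le> word_bound c n" "\<And>n. g n \<le> word_bound d n"
    unfolding poly_bounded_def by blast
  have "f n + g n \<le> word_bound (c + d) n" for n
  proof -
    have "f n + g n \<le> c * (n + 1) ^ c + d * (n + 1) ^ d" using cd[of n] by (simp add: word_bound_def)
    also have "\<dots> \<le> c * (n + 1) ^ (c + d) + d * (n + 1) ^ (c + d)"
      by (intro add_mono mult_left_mono power_increasing) auto
    also have "\<dots> = word_bound (c + d) n" by (simp add: word_bound_def add_mult_distrib)
    finally show ?thesis .
  qed
  then show ?thesis unfolding poly_bounded_def by blast
qed

lemma poly_bounded_mult: "poly_bounded f \<Longrightarrow> poly_bounded g \<Longrightarrow> poly_bounded (\<lambda>n. f n * g n)"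
proof -
  assume "poly_bounded f" "poly_bounded g"
  then obtain c d where cd: "\<And>n. f n \<le> word_bound c n" "\<And>n. g n \<le> word_bound d n"
    unfolding poly_bounded_def by blast
  have "f n * g n \<le> word_bound (c * d + c + d) n" for n
  proof -
    have "f n * g n \<le> (c * (n + 1) ^ c) * (d * (n + 1) ^ d)"
      using cd[of n] unfolding word_bound_def by (intro mult_mono) auto
    also have "\<dots> = c * d * (n + 1) ^ (c + d)" by (simp add: power_add)
    also have "\<dots> \<le> (c * d + c + d) * (n + 1) ^ (c * d + c + d)"
      by (intro mult_mono power_increasing) auto
    finally show ?thesis by (simp add: word_bound_def)
  qed
  then show ?thesis unfolding poly_bounded_def by blast
qed

lemma poly_bounded_power: "poly_bounded f \<Longrightarrow> poly_bounded (\<lambda>n. f n ^ d)"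
  by (induction d) (auto intro: poly_bounded_const poly_bounded_mult)

lemma poly_bounded_le: "poly_bounded g \<Longrightarrow> (\<And>n. f n \<le> g n) \<Longrightarrow> poly_bounded f"
  unfolding poly_bounded_def by (meson le_trans)

lemma concat_nth_rect:
  assumes "\<And>S. S \<in> set Ss \<Longrightarrow> length S = n"
  shows "length (concat Ss) = length Ss * n"
    and "j < length Ss \<Longrightarrow> i < n \<Longrightarrow> concat Ss ! (j * n + i) = Ss ! j ! i"
proof -
  have "length (concat Ss) = length Ss * n \<and>
      (\<forall>j i. j < length Ss \<longrightarrow> i < n \<longrightarrow> concat Ss ! (j * n + i) = Ss ! j ! i)"
    using assms
  proof (induction Ss)
    case (Cons S Ss)
    then have S: "length S = n" and IH: "length (concat Ss) = length Ss * n"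
      "\<And>j i. j < length Ss \<Longrightarrow> i < n \<Longrightarrow> concat Ss ! (j * n + i) = Ss ! j ! i" by auto
    have "concat (S # Ss) ! (j * n + i) = (S # Ss) ! j ! i" if "j < Suc (length Ss)" "i < n" for j i
      using that S IH(2)[of "j - 1" i] by (cases j) (auto simp: nth_append)
    then show ?case using S IH(1) by simp
  qed simp
  then show "length (concat Ss) = length Ss * n"
    and "j < length Ss \<Longrightarrow> i < n \<Longrightarrow> concat Ss ! (j * n + i) = Ss ! j ! i" by auto
qed

lemma mem_init_set_cover_encode:
  "mem (init (set_cover_encode s u I)) = (\<lambda>a. if a < 0 then 0 else if a = 0 then int s else if a = 1 then int u
      else if a < 2 + int (s * u)
        then of_bool ((nat (a - 2) div u, nat (a - 2) mod u) \<in> snd (snd I)) else 0)"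
proof
  fix a :: int
  define R where "R = map (\<lambda>i. map (\<lambda>j. if (i, j) \<in> snd (snd I) then 1 else 0 :: int) [0..<u]) [0..<s]"
  have lenR: "length (concat R) = s * u" by (subst concat_nth_rect(1)[of R u]) (auto simp: R_def)
  have nthR: "concat R ! l = of_bool ((l div u, l mod u) \<in> snd (snd I))" if "l < s * u" for l
  proof -
    have u: "0 < u" using that by (cases u) auto
    have ls: "l div u < s" using that by (simp add: less_mult_imp_div_less)
    have "concat R ! (l div u * u + l mod u) = R ! (l div u) ! (l mod u)"
      by (rule concat_nth_rect(2)) (use u ls in \<open>auto simp: R_def\<close>)
    then show ?thesis using ls u by (simp add: R_def)
  qed
  have enc: "set_cover_encode s u I = int s # int u # concat R" by (simp add: set_cover_encode_def R_def)
  consider "a < 0" | "a = 0" | "a = 1" | "2 \<le> a" by linarith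
  then show "mem (init (set_cover_encode s u I)) a = (if a < 0 then 0 else if a = 0 then int s else if a = 1 then int u
      else if a < 2 + int (s * u)
        then of_bool ((nat (a - 2) div u, nat (a - 2) mod u) \<in> snd (snd I)) else 0)"
  proof cases
    case 4
    define l where "l = nat (a - 2)"
    have a: "a = 2 + int l" using 4 by (simp add: l_def)
    have "nat a = Suc (Suc l)" using a by simp
    moreover have "int l < int s * int u \<longleftrightarrow> l < s * u" by (metis of_nat_less_iff of_nat_mult)
    ultimately show ?thesis using nthR[of l] by (cases "l < s * u") (simp_all add: init_def enc lenR a)
  qed (auto simp: init_def enc)
qed

section \<open>The reduction from k-SUM\<close>

text \<open>The deepest nesting is the loop over the matrix, the sum over blocks, the sum of the
  residues of a block, and the power in a digit.\<close>

lemma sdepth_reduction_prog: "\<forall>c\<in>set (reduction_prog k q0). sdepth c \<le> 4"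
  by (simp add: reduction_prog_def search_exp_def bit_exp_def cover_exp_def inner_exp_def digit_exp_def sum_exp_def power_exp_def eq_exp_def)

lemma ksum_reduction:
  assumes k4: "4 \<le> k" and q0: "4 * k * (k + 2) + 2 \<le> q0" and gap: "2 * (real k + 3) \<le> (1 + \<delta>) ^ k" "0 < \<delta>" "\<delta> < 1"
    and dist: "distinguishes (\<lambda>I. opt I \<le> enat k)
        (\<lambda>I. ereal_of_enat (opt I) > ereal (gap_threshold \<delta> k (num_vertices I))) Q c T"
    and Ss: "ksum_instance k n Ss"
    and Wb: "(k + 4) * (gadget_size k (least_param k q0 n) + 2) ^ 2 + (n ^ (2 * k) + n + 1) \<le> W"
       "word_bound c ((k + 1) * gadget_size k (least_param k q0 n)) \<le> W"
  shows "answers (prepend (reduction_prog k q0) Q) W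
     (real (costs ((k + 4) * (gadget_size k (least_param k q0 n) + 2) ^ 2) (reduction_prog k q0) + widths (reduction_prog k q0)) +
       T ((k + 1) * gadget_size k (least_param k q0 n))) (ksum_encode n Ss) (ksum_solvable Ss)"
proof -
  define q where "q = least_param k q0 n"
  \<comment> \<open>Indices beyond \<open>n\<close> repeat the elements cyclically. For
    \<open>n = 0\<close> all entries are 1, so that every sum is \<open>k\<close> and the unsolvable
    instance stays unsolvable.\<close>
  define x where "x j i = (if n = 0 then 1 else if j < k then Ss ! j ! (i mod n) else 0)" for j i
  define B where "B = (k + 4) * (gadget_size k q + 2) ^ 2"
  define X where "X = n ^ (2 * k) + n + 1"
  have k1: "1 \<le> k" and q02: "2 \<le> q0" using k4 q0 by auto
  note sel = least_param[OF k1 q02, where n = n, folded q_def]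
  have len: "length Ss = k" and Slen: "\<And>S. S \<in> set Ss \<Longrightarrow> length S = n"
    and Sran: "\<And>S y. S \<in> set Ss \<Longrightarrow> y \<in> set S \<Longrightarrow> \<bar>y\<bar> \<le> int n ^ (2 * k)"
    using Ss unfolding ksum_instance_def by (auto simp: subset_iff abs_le_iff) fastforce+
  have Sel: "Ss ! j ! i \<in> set (Ss ! j)" if "j < k" "i < n" for j i
    using that len Slen by simp
  have xbd: "\<bar>x j i\<bar> \<le> (if n = 0 then 1 else int n ^ (2 * k))" for j i
  proof (cases "n = 0 \<or> \<not> j < k")
    case False
    then have "Ss ! j \<in> set Ss" "Ss ! j ! (i mod n) \<in> set (Ss ! j)" using len Sel[of j "i mod n"] by auto
    then show ?thesis using Sran False by (auto simp: x_def)
  qed (auto simp: x_def)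
  interpret ram_gadget q "q ^ (2 * k)" k x W B X
  proof
    show "2 \<le> q" using sel(1) q02 by simp
    show "1 \<le> k" by (rule k1)
    show "(k + 4) * (gadget.M q (q ^ (2 * k)) k + 2)\<^sup>2 \<le> B"
      unfolding B_def gadget_size_def gadget.M_def gadget.ndigits_def ..
    show "B + X \<le> W" using Wb(1) unfolding B_def X_def q_def .
    show "1 \<le> X" by (simp add: X_def)
    show "\<bar>x j i\<bar> \<le> int X" for j i using xbd[of j i] unfolding X_def by (auto simp: power_0_left split: if_splits)
  qed simp
  have W0: "0 < W" using W_ge(2) by simp
  let ?N = "(k + 1) * M"
  have num: "num_vertices cover = ?N" by (rule cover_simps)
  have bounds: "real k \<le> gap_threshold \<delta> k ?N" "gap_threshold \<delta> k ?N \<le> real q"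
    using gap_threshold_bounds[OF gap(2,3) k4 gap(1)] q0 sel(1) unfolding M_eq_gadget_size by auto
  have sum_bound: "\<bar>\<Sum>j<k. x j (y j)\<bar> \<le> int (k * M ^ (2 * k))" for y
  proof -
    have "1 \<le> M" using parameters_le_M(5) by simp
    then have M1: "1 \<le> M ^ (2 * k)" by simp
    have "n ^ (2 * k) \<le> M ^ (2 * k)" using sel(2) unfolding M_eq_gadget_size by (intro power_mono) auto
    then have "int n ^ (2 * k) \<le> int (M ^ (2 * k))" by (metis of_nat_le_iff of_nat_power)
    moreover have "1 \<le> int (M ^ (2 * k))" using M1 by linarith
    ultimately have "(if n = 0 then 1 else int n ^ (2 * k)) \<le> int (M ^ (2 * k))" by (simp only: simp_thms split: if_split)
    then have b: "\<bar>x j i\<bar> \<le> int (M ^ (2 * k))" for j i by (rule order_trans[OF xbd])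
    have "\<bar>\<Sum>j<k. x j (y j)\<bar> \<le> (\<Sum>j<k. \<bar>x j (y j)\<bar>)" by (rule sum_abs)
    also have "\<dots> \<le> (\<Sum>j<k. int (M ^ (2 * k)))" using b by (intro sum_mono)
    also have "\<dots> = int (k * M ^ (2 * k))" by simp
    finally show ?thesis .
  qed
  \<comment> \<open>Any answer is allowed where both promises hold, so each case must also refute
    the other promise. Here this needs the threshold to be at least \<open>k\<close>.\<close>
  have yes: "opt cover \<le> enat k \<and> \<not> ereal_of_enat (opt cover) > ereal (gap_threshold \<delta> k ?N)" if sol: "ksum_solvable Ss"
  proof -
    obtain z where z: "\<And>i. i < k \<Longrightarrow> z i \<in> set (Ss ! i)" "(\<Sum>i<k. z i) = 0"
      using sol len unfolding ksum_solvable_def by auto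
    have "\<exists>i. i < n \<and> Ss ! j ! i = z j" if "j < k" for j
      using z(1)[OF that] Slen[of "Ss ! j"] that len by (auto simp: in_set_conv_nth)
    then obtain i where i: "\<And>j. j < k \<Longrightarrow> i j < n \<and> Ss ! j ! i j = z j" by metis
    have "x j (i j) = z j" if "j < k" for j using i[OF that] that by (auto simp: x_def)
    then have "(\<Sum>j<k. x j (i j)) = 0" using z(2) by simp
    moreover have "i j < M" if "j < k" for j using i[OF that] sel(2) unfolding M_eq_gadget_size by simp
    ultimately have le: "opt cover \<le> enat k" using opt_cover_le[of i] k1 by simp
    then have "ereal_of_enat (opt cover) \<le> ereal_of_enat (enat k)" by (simp only: ereal_of_enat_le_iff)
    also have "\<dots> \<le> ereal (gap_threshold \<delta> k ?N)" using bounds(1) by simp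
    finally show ?thesis using le by simp
  qed
  have no: "ereal_of_enat (opt cover) > ereal (gap_threshold \<delta> k ?N) \<and> \<not> opt cover \<le> enat k" if nsol: "\<not> ksum_solvable Ss"
  proof -
    obtain h where h: "1 \<le> h" "2 * h < q ^ (2 * k)" "M ^ (q ^ 2) < 2 ^ h" "k * M ^ (2 * k) < 2 ^ h"
      using modulus_range[OF k4, of q] q0 sel(1) unfolding M_eq_gadget_size by auto
    have "(\<Sum>j<k. x j (y j)) \<noteq> 0" for y
    proof (cases "n = 0")
      case True
      then show ?thesis using k1 by (simp add: x_def)
    next
      case False
      show ?thesis
      proof
        assume "(\<Sum>j<k. x j (y j)) = 0"
        then have "(\<forall>i<length Ss. x i (y i) \<in> set (Ss ! i)) \<and> (\<Sum>i<length Ss. x i (y i)) = 0"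
          using False len Sel by (auto simp: x_def)
        then have "ksum_solvable Ss" unfolding ksum_solvable_def by (rule exI[of _ "\<lambda>i. x i (y i)"])
        then show False using nsol by simp
      qed
    qed
    moreover have "\<bar>\<Sum>j<k. x j (y j)\<bar> < 2 ^ h" for y
    proof -
      have "int (k * M ^ (2 * k)) < int (2 ^ h)" using h(4) by (simp only: of_nat_less_iff)
      then show ?thesis using sum_bound[of y] by simp
    qed
    ultimately have gt: "opt cover > enat q" using opt_cover_gt[OF _ h(2,1,3)] by blast
    have "ereal (gap_threshold \<delta> k ?N) \<le> ereal_of_enat (enat q)" using bounds(2) by simp
    also have "\<dots> < ereal_of_enat (opt cover)" using gt by (simp only: ereal_of_enat_less_iff)
    finally have "ereal_of_enat (opt cover) > ereal (gap_threshold \<delta> k ?N)" .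
    moreover have "enat k \<le> enat q" using q0 sel(1) by simp
    ultimately show ?thesis using gt by (meson leD le_less_trans)
  qed
  have "numbered (k * M) M cover \<and> num_vertices cover \<ge> 1" using cover_simps(1) num parameters_le_M(5) by simp
  note ex = dist[unfolded distinguishes_def, THEN spec, THEN spec, THEN spec, THEN mp, OF this]
  obtain b where b: "answers Q (word_bound c ?N) (T ?N) (set_cover_encode (k * M) M cover) b"
      "opt cover \<le> enat k \<and> \<not> ereal_of_enat (opt cover) > ereal (gap_threshold \<delta> k ?N) \<longrightarrow> b"
      "ereal_of_enat (opt cover) > ereal (gap_threshold \<delta> k ?N) \<and> \<not> opt cover \<le> enat k \<longrightarrow> \<not> b"
    using ex unfolding num by (elim exE conjE) (rule that)
  have b_eq: "b = ksum_solvable Ss" using b(2,3) yes no by blast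
  define xs where "xs = ksum_encode n Ss"
  have lenC: "length (concat Ss) = k * n" using concat_nth_rect(1)[of Ss n] Slen len by simp
  have mem_bd: "\<bar>mem (init xs) a\<bar> \<le> int X" for a
  proof (cases "0 \<le> a \<and> a < int (length xs)")
    case True
    then have "xs ! nat a \<in> set xs" by (intro nth_mem) linarith
    then consider "xs ! nat a = int n" | S where "S \<in> set Ss" "xs ! nat a \<in> set S"
      unfolding xs_def ksum_encode_def by auto
    then have "\<bar>xs ! nat a\<bar> \<le> int X"
    proof cases
      case 2
      then show ?thesis using Sran[of S "xs ! nat a"] unfolding X_def by simp
    qed (simp add: X_def)
    then show ?thesis using True by (simp add: init_def)
  qed (auto simp: init_def)
  have "evs W B (reduction_prog k q0) 0 (\<lambda>_. 0) (mem (init xs))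
    (\<lambda>a. if a < 0 then 0 else if a = 0 then int (k * M) else if a = 1 then int M
      else if a < 2 + int (k * M * M)
        then of_bool (adj (nat (a - 2) div M div M) (nat (a - 2) div M mod M) (nat (a - 2) mod M)) else 0)"
  proof (rule evs_reduction_prog)
    show "n \<le> M" using sel(2) unfolding M_eq_gadget_size .
    show "mem (init xs) 0 = int n" by (simp add: xs_def ksum_encode_def init_def)
    show "mem (init xs) a = 0" if "a < 0 \<or> int (k * n) < a" for a
      using that lenC by (auto simp: xs_def ksum_encode_def init_def)
    show "x j i = (if n = 0 then 1 else mem (init xs) (1 + int j * int n + int (i mod n)))" if ji: "j < k" "i < M" for j i
    proof (cases "n = 0")
      case False
      then have im: "i mod n < n" by simp
      have "(j + 1) * n \<le> k * n" using ji by (intro mult_right_mono) auto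
      then have lt: "j * n + i mod n < k * n" using im by simp
      have "nat (1 + int j * int n + int (i mod n)) = Suc (j * n + i mod n)"
        by (simp add: nat_eq_iff)
      moreover have "1 + int j * int n + int (i mod n) < int (length xs)"
      proof -
        have "1 + j * n + i mod n < length xs" using lt lenC by (simp add: xs_def ksum_encode_def)
        then have "int (1 + j * n + i mod n) < int (length xs)" by (simp only: of_nat_less_iff)
        then show ?thesis by simp
      qed
      ultimately have "mem (init xs) (1 + int j * int n + int (i mod n)) = concat Ss ! (j * n + i mod n)"
        by (simp add: init_def xs_def ksum_encode_def)
      also have "\<dots> = Ss ! j ! (i mod n)" using concat_nth_rect(2)[of Ss n] Slen len ji im by simp
      finally show ?thesis using False ji by (simp add: x_def)
    qed (simp add: x_def)
    show "2 \<le> q0" by (rule q02)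
    show "q0 \<le> q" by (rule sel(1))
    show "gadget_size k q' < n" if "q0 \<le> q'" "q' < q" for q' using sel(3)[OF that] .
    show "\<bar>mem (init xs) a\<bar> \<le> int X" for a by (rule mem_bd)
  qed
  also have "(\<lambda>a. if a < 0 then 0 else if a = 0 then int (k * M) else if a = 1 then int M
      else if a < 2 + int (k * M * M)
        then of_bool (adj (nat (a - 2) div M div M) (nat (a - 2) div M mod M) (nat (a - 2) mod M)) else 0) =
      mem (init (set_cover_encode (k * M) M cover))"
  proof
    fix a
    let ?l = "nat (a - 2)"
    have "(?l div M, ?l mod M) \<in> snd (snd cover) \<longleftrightarrow> adj (?l div M div M) (?l div M mod M) (?l mod M)"
      if "2 \<le> a" "a < 2 + int (k * M * M)"
    proof -
      have "?l < k * M * M" using that by linarith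
      then have "?l div M < k * M" by (rule less_mult_imp_div_less)
      then show ?thesis using parameters_le_M(5) by (simp add: cover_def)
    qed
    then show "(if a < 0 then 0 else if a = 0 then int (k * M) else if a = 1 then int M
      else if a < 2 + int (k * M * M)
        then of_bool (adj (nat (a - 2) div M div M) (nat (a - 2) div M mod M) (nat (a - 2) mod M)) else 0) =
      mem (init (set_cover_encode (k * M) M cover)) a"
      unfolding mem_init_set_cover_encode by auto
  qed
  finally have ev: "evs W B (reduction_prog k q0) 0 (\<lambda>_. 0) (mem (init xs)) (mem (init (set_cover_encode (k * M) M cover)))" .
  have XW: "int X \<le> int W" using W_ge(4) by simp
  have fits: "fits W (init xs)"
    unfolding fits_def using order_trans[OF mem_bd XW] by (simp add: init_def)
  have MW: "word_bound c ?N \<le> W" using Wb(2) unfolding M_eq_gadget_size unfolding q_def .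
  show ?thesis
    using answers_prepend[OF ev W_ge(2,3) MW fits b(1)[unfolded b_eq]]
    unfolding xs_def B_def M_eq_gadget_size unfolding q_def .
qed

theorem theorem3:
  assumes "ksum_hypothesis"
  shows "\<forall>\<delta>::real. \<forall>\<epsilon>::real. 0 < \<delta> \<and> \<delta> < 1 \<and> 0 < \<epsilon> \<and> \<epsilon> < 1 \<longrightarrow>
    (\<exists>k0::nat. \<forall>k\<ge>k0. \<forall>f. computable f \<longrightarrow>
      \<not> (\<exists>P c. distinguishes
            (\<lambda>I. opt I \<le> enat k)
            (\<lambda>I. ereal_of_enat (opt I) > ereal (gap_threshold \<delta> k (num_vertices I)))
            P c
            (\<lambda>N. real (f k) * real N powr (real_of_int \<lceil>real k / 2\<rceil> - \<epsilon>))))"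
proof (intro allI impI)
  fix \<delta> \<epsilon> :: real
  assume de: "0 < \<delta> \<and> \<delta> < 1 \<and> 0 < \<epsilon> \<and> \<epsilon> < 1"
  obtain k1 where k1: "\<And>k. k \<ge> k1 \<Longrightarrow> 2 * (real k + 3) \<le> (1 + \<delta>) ^ k"
    using exists_large_k de by blast
  show "\<exists>k0::nat. \<forall>k\<ge>k0. \<forall>f. computable f \<longrightarrow>
      \<not> (\<exists>P c. distinguishes
            (\<lambda>I. opt I \<le> enat k)
            (\<lambda>I. ereal_of_enat (opt I) > ereal (gap_threshold \<delta> k (num_vertices I)))
            P c
            (\<lambda>N. real (f k) * real N powr (real_of_int \<lceil>real k / 2\<rceil> - \<epsilon>)))"
  \<comment> \<open>40 makes \<open>K\<close> at least 20, so that the time of the reduction is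
    negligible.\<close>
  proof (intro exI[of _ "max k1 40"] allI impI notI)
    fix k f
    assume kk: "max k1 40 \<le> k"
    then have k: "k1 \<le> k" "40 \<le> k" by auto
    define K where "K = real_of_int \<lceil>real k / 2\<rceil>"
    have K: "20 \<le> K"
    proof -
      have "20 \<le> real k / 2" using k by simp
      also have "\<dots> \<le> K" unfolding K_def by (rule le_of_int_ceiling)
      finally show ?thesis .
    qed
    assume "\<exists>P c. distinguishes (\<lambda>I. opt I \<le> enat k)
            (\<lambda>I. ereal_of_enat (opt I) > ereal (gap_threshold \<delta> k (num_vertices I))) P c
            (\<lambda>N. real (f k) * real N powr (real_of_int \<lceil>real k / 2\<rceil> - \<epsilon>))"
    then obtain Q c where dist: "distinguishes (\<lambda>I. opt I \<le> enat k)
            (\<lambda>I. ereal_of_enat (opt I) > ereal (gap_threshold \<delta> k (num_vertices I))) Q c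
            (\<lambda>N. real (f k) * real N powr (K - \<epsilon>))" unfolding K_def by blast
    define \<eta> where "\<eta> = min 1 (\<epsilon> / (2 * K))"
    have eta: "0 < \<eta>" "\<eta> \<le> 1" "\<eta> \<le> \<epsilon> / (2 * K)" using de K by (auto simp: \<eta>_def)
    obtain q1 where q1: "\<And>q. q1 \<le> q \<Longrightarrow> real (gadget_size k (Suc q)) \<le> real (gadget_size k q) powr (1 + \<eta>)"
      using gadget_size_growth[OF eta(1)] by blast
    define q0 where "q0 = max q1 (4 * k * (k + 2) + 2)"
    have q0: "q1 \<le> q0" "4 * k * (k + 2) + 2 \<le> q0" "2 \<le> q0" "1 \<le> k" "4 \<le> k" using k by (auto simp: q0_def)
    define S where "S n = gadget_size k (least_param k q0 n)" for n
    note sel = least_param[OF q0(4,3)]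
    have S2: "2 \<le> S n" for n
    proof -
      have "2 \<le> least_param k q0 n" using sel(1)[of n] q0(3) by linarith
      then have "2 * k * (1 + least_param k q0 n + (k + 1) * least_param k q0 n ^ k) < S n" unfolding S_def by (rule gadget_size_gt)
      moreover have "1 * 1 \<le> 2 * k * (1 + least_param k q0 n + (k + 1) * least_param k q0 n ^ k)"
        using q0(4) by (intro mult_mono) auto
      ultimately show ?thesis by linarith
    qed
    have Sle: "real (S n) \<le> real (gadget_size k q0) * real n powr (1 + \<eta>)" if "1 \<le> n" for n
      unfolding S_def by (rule gadget_size_least_param_le[OF q0(4,3) eta(1) that]) (use q1 q0(1) in auto)
    have G: "1 \<le> real (gadget_size k q0)"
    proof -
      have "1 \<le> gadget_size k q0" using q0(3) unfolding gadget_size_eq by (intro one_le_power) simp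
      then show ?thesis by simp
    qed
    have "poly_bounded S"
    proof (rule poly_bounded_le)
      show "poly_bounded (\<lambda>n. (gadget_size k q0 + S 0) * (n + 1) ^ 2)"
        by (intro poly_bounded_mult poly_bounded_const poly_bounded_power poly_bounded_add poly_bounded_id)
      fix n
      show "S n \<le> (gadget_size k q0 + S 0) * (n + 1) ^ 2"
      proof (cases "n = 0")
        case False
        then have n: "1 \<le> n" by simp
        have "real (S n) \<le> real (gadget_size k q0) * real n powr 2"
        proof (rule order_trans[OF Sle[OF n]])
          show "real (gadget_size k q0) * real n powr (1 + \<eta>) \<le> real (gadget_size k q0) * real n powr 2"
            using eta n by (intro mult_left_mono powr_mono) auto
        qed
        also have "\<dots> = real (gadget_size k q0 * n ^ 2)" using n by (simp add: powr_numeral)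
        finally have "S n \<le> gadget_size k q0 * n ^ 2" by (simp only: of_nat_le_iff)
        also have "\<dots> \<le> (gadget_size k q0 + S 0) * (n + 1) ^ 2" by (intro mult_mono power_mono) auto
        finally show ?thesis .
      qed simp
    qed
    then have "poly_bounded (\<lambda>n. ((k + 4) * (S n + 2) ^ 2 + (n ^ (2 * k) + n + 1)) +
        c * ((k + 1) * S n + 1) ^ c)"
      by (intro poly_bounded_mult poly_bounded_const poly_bounded_power poly_bounded_add poly_bounded_id)
    then obtain c' where c': "\<And>n. ((k + 4) * (S n + 2) ^ 2 + (n ^ (2 * k) + n + 1)) +
        c * ((k + 1) * S n + 1) ^ c \<le> word_bound c' n"
      unfolding poly_bounded_def by blast
    have Wd: "(k + 4) * (S n + 2) ^ 2 + (n ^ (2 * k) + n + 1) \<le> word_bound c' n"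
      "word_bound c ((k + 1) * S n) \<le> word_bound c' n" for n
      using c'[of n] unfolding word_bound_def[of c "(k + 1) * S n"] by linarith+
    let ?cs = "reduction_prog k q0"
    let ?T = "\<lambda>n. real (costs ((k + 4) * (S n + 2) ^ 2) ?cs) + real (widths ?cs) +
       real (f k) * real ((k + 1) * S n) powr (K - \<epsilon>)"
    obtain C where C: "\<And>B. costs B ?cs \<le> C * (B + 1) ^ 4"
      using costs_le[of ?cs 4] sdepth_reduction_prog by blast
    have "decides_ksum k (prepend ?cs Q) c' ?T"
      unfolding decides_ksum_def
    proof (intro allI impI)
      fix n Ss assume Ss: "ksum_instance k n Ss"
      show "answers (prepend ?cs Q) (word_bound c' n) (?T n) (ksum_encode n Ss) (ksum_solvable Ss)"
        using ksum_reduction[OF q0(5,2) k1[OF k(1)] _ _ dist Ss Wd[unfolded S_def]] de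
        by (simp add: S_def add.assoc)
    qed
    moreover have "?T \<in> O(\<lambda>n. real n powr (K - \<epsilon> / 2))"
      by (rule time_bound[OF K _ _ eta _ _ G S2 Sle C]) (use de in auto)
    ultimately have "\<exists>P c T. T \<in> O(\<lambda>n. real n powr (real_of_int \<lceil>real k / 2\<rceil> - \<epsilon> / 2)) \<and> decides_ksum k P c T"
      unfolding K_def by blast
    moreover have "2 \<le> k" "0 < \<epsilon> / 2" using k de by auto
    ultimately show False using assms unfolding ksum_hypothesis_def by blast
  qed
qed

end
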